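(* Let $n\ge1$, let $w_1,\dots,w_{n+1}$ be positive integers and let $\lambda_1=\gcd(w_1,\dots,w_{n+1})\neq 1$. Choose integers $c_1,\dots,c_{n+1}$ with $\sum_{i=1}^{n+1}c_i\frac{w_i}{\lambda_1}\equiv1\pmod{\lambda_1}$, and set $\boldsymbol{c}=([c_1],\dots,[c_{n+1}])$, where $[c_i]$ is the class of $c_i$ modulo $\lambda_1$. Let $B'$ be the $n\times(n+1)$ integer matrix, described in the context, giving a stacky fan with fan $\Sigma$ for the weighted projective orbifold $\mathbb{P}(\frac{w_1}{\lambda_1},\dots,\frac{w_{n+1}}{\lambda_1})$. Define $\beta:\mathbb{Z}^{n+1}\to\mathbb{Z}^n\oplus\mathbb{Z}/\lambda_1\mathbb{Z}$ by $B=\begin{bmatrix}B'\\ \boldsymbol{c}\end{bmatrix}$. Then the toric Deligne–Mumford stack associated with the stacky fan $(\mathbb{Z}^n\oplus\mathbb{Z}/\lambda_1\mathbb{Z},\Sigma,\beta)$ is the weighted projective stack $\mathbb{P}(w_1,\dots,w_{n+1})$.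
   Context: $\mathbb{P}(w_1,\dots,w_{n+1})$ is the quotient stack $[(\mathbb{C}^{n+1}\setminus\{0\})/\mathbb{C}^*]$ with $\mu\cdot(x_1,\dots,x_{n+1})=(\mu^{w_1}x_1,\dots,\mu^{w_{n+1}}x_{n+1})$. Stacky fans (Borisov–Chen–Smith): a triple $(N,\Sigma,\beta:\mathbb{Z}^k\to N)$ where $N$ is a finitely generated abelian group of rank $d$, $\Sigma$ is a rational simplicial fan in $N\otimes\mathbb{Q}$ with $k$ rays $\rho_1,\dots,\rho_k$, and $\beta$ has finite cokernel with $\beta(e_i)\otimes1$ on $\rho_i$. The associated stack is $[Z_\Sigma/G_\beta]$, where $Z_\Sigma=\mathbb{C}^k\setminus V(J_\Sigma)$, $J_\Sigma=\langle\prod_{\rho_i\not\subset\sigma}z_i\mid\sigma\in\Sigma\rangle$. To define $G_\beta$, take a free resolution $0\to\mathbb{Z}^s\xrightarrow{Q}\mathbb{Z}^{d+s}\to N\to0$, lift $\beta$ to a matrix $\widetilde B:\mathbb{Z}^k\to\mathbb{Z}^{d+s}$, let $\mathrm{DG}(\beta)=(\mathbb{Z}^{k+s})^\star/\mathrm{Im}([\widetilde B\ Q]^\star)$ with $(-)^\star=\mathrm{Hom}_{\mathbb{Z}}(-,\mathbb{Z})$, and $G_\beta=\mathrm{Hom}_{\mathbb{Z}}(\mathrm{DG}(\beta),\mathbb{C}^* )$, acting on $Z_\Sigma$ through the homomorphism $G_\beta\to(\mathbb{C}^* )^k$ dual to $(\mathbb{Z}^k)^\star\to(\mathbb{Z}^{k+s})^\star\to\mathrm{DG}(\beta)$.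 The matrix $B'$: write $w_i'=w_i/\lambda_1$ and $\lambda_i'=\gcd(w_i',\dots,w_{n+1}')$ for $1\le i\le n$ (so $\lambda'_1=1$). For $1\le i\le n-1$, row $i$ of $B'$ has entries $0$ in columns $<i$, $\lambda'_{i+1}/\lambda'_i$ in column $i$, and integers $b_{ij}$ in columns $j>i$ with $\frac{\lambda'_{i+1}}{\lambda'_i}w'_i+\sum_{j=i+1}^{n+1}b_{ij}w'_j=0$; moreover $0\le b_{1i},\dots,b_{i-1,i}<\lambda'_{i+1}/\lambda'_i$ for $2\le i\le n-1$. Row $n$ has entries $0$ in columns $<n$, $w'_{n+1}/\lambda'_n$ in column $n$ and $-w'_n/\lambda'_n$ in column $n+1$. The fan $\Sigma$ in $\mathbb{Q}^n$ has rays spanned by the columns of $B'$ and its maximal cones are generated by any $n$ of them. *)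

theory Defs
  imports Complex_Main "HOL-Algebra.Product_Groups" "HOL-Algebra.Group_Action" "HOL-Algebra.RingHom"
    "HOL-Number_Theory.Cong"
begin

section \<open>Algebras over the complex numbers\<close>

text \<open>
  Stacks over \<open>\<complex>\<close> are considered as categories fibred in groupoids over the category of affine
  \<open>\<complex>\<close>-schemes with the etale topology, that is, over the opposite of the category of commutative
  \<open>\<complex>\<close>-algebras.  The type variable \<open>'u\<close> plays the role of the universe: the site consists of all
  \<open>\<complex>\<close>-algebras whose carrier is a subset of \<open>'u\<close>, and sheaves of torsors take values in subsets
  of \<open>'u\<close>.  If \<open>'u\<close> has infinite cardinality \<open>\<kappa>\<close>, every algebra with at most \<open>\<kappa>\<close> elements is
  isomorphic to one of these.
\<close>

definition complex_ring :: "complex ring" where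
  "complex_ring = \<lparr>carrier = UNIV, monoid.mult = (*), one = 1, ring.zero = 0, ring.add = (+)\<rparr>"

record 'u calg = "'u ring" +
  scal :: "complex \<Rightarrow> 'u"

definition is_calg :: "'u calg \<Rightarrow> bool" where
  "is_calg A \<longleftrightarrow> cring A \<and> scal A \<in> ring_hom complex_ring A"

definition calg_hom :: "'u calg \<Rightarrow> 'v calg \<Rightarrow> ('u \<Rightarrow> 'v) set" where
  "calg_hom A B = {f \<in> ring_hom A B \<inter> extensional (carrier A). \<forall>z. f (scal A z) = scal B z}"

text \<open>A polynomial over \<open>A\<close> in the variables indexed by \<open>{1..m}\<close> is given by its coefficient function
  on exponent vectors.  \<open>poly_eval\<close> moves the coefficients along \<open>a : A \<rightarrow> U\<close> before evaluating at \<open>t\<close>.\<close>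

definition is_poly :: "'u calg \<Rightarrow> ((nat \<Rightarrow> nat) \<Rightarrow> 'u) \<Rightarrow> bool" where
  "is_poly A q \<longleftrightarrow> (\<forall>e. q e \<in> carrier A) \<and> finite {e. q e \<noteq> \<zero>\<^bsub>A\<^esub>}"

definition poly_eval ::
  "nat \<Rightarrow> 'u calg \<Rightarrow> 'u calg \<Rightarrow> ('u \<Rightarrow> 'u) \<Rightarrow> (nat \<Rightarrow> 'u) \<Rightarrow> ((nat \<Rightarrow> nat) \<Rightarrow> 'u) \<Rightarrow> 'u" where
  "poly_eval m A U a t q =
     finsum U (\<lambda>e. a (q e) \<otimes>\<^bsub>U\<^esub> finprod U (\<lambda>i. t i [^]\<^bsub>U\<^esub> e i) {1..m}) {e. q e \<noteq> \<zero>\<^bsub>A\<^esub>}"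

text \<open>\<open>S\<close> is isomorphic to \<open>A[X\<^sub>1,\<dots>,X\<^sub>m]/(F)\<close> for a finite set \<open>F\<close>; the quotient ring is described by its
  universal property, with \<open>s i\<close> the image of \<open>X\<^sub>i\<close>.\<close>

definition finitely_presented :: "'u calg \<Rightarrow> 'u calg \<Rightarrow> ('u \<Rightarrow> 'u) \<Rightarrow> bool" where
  "finitely_presented A S f \<longleftrightarrow>
     (\<exists>m s F. s \<in> {1..m} \<rightarrow>\<^sub>E carrier S \<and> finite F \<and> (\<forall>q\<in>F. is_poly A q) \<and>
        (\<forall>q\<in>F. poly_eval m A S f s q = \<zero>\<^bsub>S\<^esub>) \<and>
        (\<forall>U a t. is_calg U \<longrightarrow> a \<in> calg_hom A U \<longrightarrow> t \<in> {1..m} \<rightarrow>\<^sub>E carrier U \<longrightarrow>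
           (\<forall>q\<in>F. poly_eval m A U a t q = \<zero>\<^bsub>U\<^esub>) \<longrightarrow>
           (\<exists>!h. h \<in> calg_hom S U \<and> compose (carrier A) h f = a \<and> (\<forall>i\<in>{1..m}. h (s i) = t i))))"

text \<open>Unique lifting along surjections \<open>r : U \<rightarrow> V\<close> with kernel of square zero.\<close>

definition formally_etale :: "'u calg \<Rightarrow> 'u calg \<Rightarrow> ('u \<Rightarrow> 'u) \<Rightarrow> bool" where
  "formally_etale A S f \<longleftrightarrow>
     (\<forall>(U :: 'u calg) (V :: 'u calg) r a g. is_calg U \<longrightarrow> is_calg V \<longrightarrow>
        r \<in> calg_hom U V \<longrightarrow> r ` carrier U = carrier V \<longrightarrow>
        (\<forall>x\<in>a_kernel U V r. \<forall>y\<in>a_kernel U V r. x \<otimes>\<^bsub>U\<^esub> y = \<zero>\<^bsub>U\<^esub>) \<longrightarrow>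
        a \<in> calg_hom A U \<longrightarrow> g \<in> calg_hom S V \<longrightarrow>
        compose (carrier A) g f = compose (carrier A) r a \<longrightarrow>
        (\<exists>!h. h \<in> calg_hom S U \<and> compose (carrier A) h f = a \<and> compose (carrier S) r h = g))"

definition etale :: "'u calg \<Rightarrow> 'u calg \<Rightarrow> ('u \<Rightarrow> 'u) \<Rightarrow> bool" where
  "etale A S f \<longleftrightarrow> finitely_presented A S f \<and> formally_etale A S f"

text \<open>Finite jointly surjective families of etale morphisms \<open>Spec S \<rightarrow> Spec A\<close>.\<close>

definition etale_cover :: "'u calg \<Rightarrow> ('u calg \<times> ('u \<Rightarrow> 'u)) set \<Rightarrow> bool" where
  "etale_cover A C \<longleftrightarrow>
     finite C \<and>
     (\<forall>(S, f)\<in>C. is_calg S \<and> f \<in> calg_hom A S \<and> etale A S f) \<and>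
     (\<forall>I. primeideal I A \<longrightarrow> (\<exists>(S, f)\<in>C. \<exists>J. primeideal J S \<and> I = {x \<in> carrier A. f x \<in> J}))"


section \<open>Sheaves, group actions and torsors\<close>

text \<open>A presheaf on affine \<open>\<complex>\<close>-schemes is a covariant functor on \<open>\<complex>\<close>-algebras.\<close>

record ('u, 'p) psh =
  sec :: "'u calg \<Rightarrow> 'p set"
  res :: "'u calg \<Rightarrow> 'u calg \<Rightarrow> ('u \<Rightarrow> 'u) \<Rightarrow> 'p \<Rightarrow> 'p"

definition is_psh :: "('u, 'p, 'z) psh_scheme \<Rightarrow> bool" where
  "is_psh P \<longleftrightarrow>
     (\<forall>A B f. is_calg A \<longrightarrow> is_calg B \<longrightarrow> f \<in> calg_hom A B \<longrightarrow> res P A B f \<in> sec P A \<rightarrow> sec P B) \<and>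
     (\<forall>A. is_calg A \<longrightarrow> (\<forall>x\<in>sec P A. res P A A (\<lambda>a\<in>carrier A. a) x = x)) \<and>
     (\<forall>A B C f g. is_calg A \<longrightarrow> is_calg B \<longrightarrow> is_calg C \<longrightarrow> f \<in> calg_hom A B \<longrightarrow> g \<in> calg_hom B C \<longrightarrow>
        (\<forall>x\<in>sec P A. res P A C (compose (carrier A) g f) x = res P B C g (res P A B f x)))"

definition psh_hom ::
  "('u, 'p, 'z) psh_scheme \<Rightarrow> ('u, 'q, 'y) psh_scheme \<Rightarrow> ('u calg \<Rightarrow> 'p \<Rightarrow> 'q) set" where
  "psh_hom P Q = {\<eta> \<in> extensional (Collect is_calg).
     (\<forall>A. is_calg A \<longrightarrow> \<eta> A \<in> sec P A \<rightarrow>\<^sub>E sec Q A) \<and>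
     (\<forall>A B f. is_calg A \<longrightarrow> is_calg B \<longrightarrow> f \<in> calg_hom A B \<longrightarrow>
        (\<forall>x\<in>sec P A. \<eta> B (res P A B f x) = res Q A B f (\<eta> A x)))}"

definition spec :: "'u calg \<Rightarrow> ('u, 'u \<Rightarrow> 'u) psh" where
  "spec R = \<lparr>sec = (\<lambda>A. calg_hom R A), res = (\<lambda>A B f x. compose (carrier R) f x)\<rparr>"

text \<open>Sections over the fibre products \<open>Spec S \<times> Spec S'\<close> over \<open>Spec A\<close> are compared on all affine test
  schemes \<open>Spec U\<close> mapping to the fibre product.\<close>

definition is_etale_sheaf :: "('u, 'p, 'z) psh_scheme \<Rightarrow> bool" where
  "is_etale_sheaf P \<longleftrightarrow> is_psh P \<and>
     (\<forall>A C \<sigma>. is_calg A \<longrightarrow> etale_cover A C \<longrightarrow>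
        (\<forall>(S, f)\<in>C. \<sigma> (S, f) \<in> sec P S) \<longrightarrow>
        (\<forall>(S, f)\<in>C. \<forall>(S', f')\<in>C. \<forall>U. \<forall>a\<in>calg_hom S U. \<forall>a'\<in>calg_hom S' U.
           is_calg U \<longrightarrow> compose (carrier A) a f = compose (carrier A) a' f' \<longrightarrow>
           res P S U a (\<sigma> (S, f)) = res P S' U a' (\<sigma> (S', f'))) \<longrightarrow>
        (\<exists>!x. x \<in> sec P A \<and> (\<forall>(S, f)\<in>C. res P A S f x = \<sigma> (S, f))))"

record ('u, 'g) group_functor =
  pt_group :: "'u calg \<Rightarrow> 'g monoid"
  pt_map :: "'u calg \<Rightarrow> 'u calg \<Rightarrow> ('u \<Rightarrow> 'u) \<Rightarrow> 'g \<Rightarrow> 'g"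

record ('u, 'g, 'p) gpsh = "('u, 'p) psh" +
  act :: "'u calg \<Rightarrow> 'g \<Rightarrow> 'p \<Rightarrow> 'p"

definition is_gpsh :: "('u, 'g) group_functor \<Rightarrow> ('u, 'g, 'p) gpsh \<Rightarrow> bool" where
  "is_gpsh G P \<longleftrightarrow> is_psh P \<and>
     (\<forall>A. is_calg A \<longrightarrow> group_action (pt_group G A) (sec P A) (act P A)) \<and>
     (\<forall>A B f. is_calg A \<longrightarrow> is_calg B \<longrightarrow> f \<in> calg_hom A B \<longrightarrow>
        (\<forall>g\<in>carrier (pt_group G A). \<forall>x\<in>sec P A.
           res P A B f (act P A g x) = act P B (pt_map G A B f g) (res P A B f x)))"

definition equivariant ::
  "('u, 'g) group_functor \<Rightarrow> ('u, 'g, 'p) gpsh \<Rightarrow> ('u, 'g, 'q) gpsh \<Rightarrow> ('u calg \<Rightarrow> 'p \<Rightarrow> 'q) \<Rightarrow> bool" where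
  "equivariant G P Q \<eta> \<longleftrightarrow>
     (\<forall>A. is_calg A \<longrightarrow> (\<forall>g\<in>carrier (pt_group G A). \<forall>x\<in>sec P A.
        \<eta> A (act P A g x) = act Q A g (\<eta> A x)))"

text \<open>A \<open>G\<close>-torsor over \<open>Spec R\<close>: an etale sheaf \<open>P\<close> with structure morphism \<open>\<pi>\<close> to \<open>Spec R\<close> whose fibres
  are simply transitive \<open>G\<close>-sets as soon as they are nonempty, and which has sections etale locally.\<close>

definition torsor ::
  "('u, 'g) group_functor \<Rightarrow> 'u calg \<Rightarrow> ('u, 'g, 'p) gpsh \<Rightarrow> ('u calg \<Rightarrow> 'p \<Rightarrow> ('u \<Rightarrow> 'u)) \<Rightarrow> bool" where
  "torsor G R P \<pi> \<longleftrightarrow>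
     is_gpsh G P \<and> is_etale_sheaf P \<and> \<pi> \<in> psh_hom P (spec R) \<and>
     (\<forall>A. is_calg A \<longrightarrow> (\<forall>g\<in>carrier (pt_group G A). \<forall>x\<in>sec P A. \<pi> A (act P A g x) = \<pi> A x)) \<and>
     (\<forall>A. is_calg A \<longrightarrow> (\<forall>x\<in>sec P A. \<forall>y\<in>sec P A. \<pi> A x = \<pi> A y \<longrightarrow>
        (\<exists>!g. g \<in> carrier (pt_group G A) \<and> act P A g x = y))) \<and>
     (\<exists>C. etale_cover R C \<and> (\<forall>(S, f)\<in>C. \<exists>x\<in>sec P S. \<pi> S x = f))"


section \<open>Stacks over the complex numbers and their equivalences\<close>

text \<open>A category with a functor to affine \<open>\<complex>\<close>-schemes.  An arrow \<open>x \<rightarrow> y\<close> lies over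
  \<open>Spec (base_of x) \<rightarrow> Spec (base_of y)\<close>, hence over an algebra homomorphism \<open>base_of y \<rightarrow> base_of x\<close>.  The
  composite of \<open>u : x \<rightarrow> y\<close> and \<open>v : y \<rightarrow> z\<close> is \<open>Comp x y z v u\<close>.\<close>

record ('o, 'm, 'u) cat_over =
  Ob :: "'o set"
  Arr :: "'o \<Rightarrow> 'o \<Rightarrow> 'm set"
  Ident :: "'o \<Rightarrow> 'm"
  Comp :: "'o \<Rightarrow> 'o \<Rightarrow> 'o \<Rightarrow> 'm \<Rightarrow> 'm \<Rightarrow> 'm"
  base_of :: "'o \<Rightarrow> 'u calg"
  base_arr :: "'m \<Rightarrow> ('u \<Rightarrow> 'u)"

definition functor_over ::
  "('o, 'm, 'u) cat_over \<Rightarrow> ('p, 'n, 'u) cat_over \<Rightarrow> ('o \<Rightarrow> 'p) \<Rightarrow> ('o \<Rightarrow> 'o \<Rightarrow> 'm \<Rightarrow> 'n) \<Rightarrow> bool" where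
  "functor_over C D Fo Fm \<longleftrightarrow>
     (\<forall>x\<in>Ob C. Fo x \<in> Ob D \<and> base_of D (Fo x) = base_of C x \<and> Fm x x (Ident C x) = Ident D (Fo x)) \<and>
     (\<forall>x\<in>Ob C. \<forall>y\<in>Ob C. \<forall>u\<in>Arr C x y.
        Fm x y u \<in> Arr D (Fo x) (Fo y) \<and> base_arr D (Fm x y u) = base_arr C u) \<and>
     (\<forall>x\<in>Ob C. \<forall>y\<in>Ob C. \<forall>z\<in>Ob C. \<forall>u\<in>Arr C x y. \<forall>v\<in>Arr C y z.
        Fm x z (Comp C x y z v u) = Comp D (Fo x) (Fo y) (Fo z) (Fm y z v) (Fm x y u))"

text \<open>A natural isomorphism between functors \<open>F\<close>, \<open>H\<close> over the base, with components over identities.\<close>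

definition nat_iso_over ::
  "('o, 'm, 'u) cat_over \<Rightarrow> ('p, 'n, 'u) cat_over \<Rightarrow> ('o \<Rightarrow> 'p) \<Rightarrow> ('o \<Rightarrow> 'o \<Rightarrow> 'm \<Rightarrow> 'n) \<Rightarrow>
   ('o \<Rightarrow> 'p) \<Rightarrow> ('o \<Rightarrow> 'o \<Rightarrow> 'm \<Rightarrow> 'n) \<Rightarrow> ('o \<Rightarrow> 'n) \<Rightarrow> bool" where
  "nat_iso_over C D Fo Fm Ho Hm \<eta> \<longleftrightarrow>
     (\<forall>x\<in>Ob C. \<eta> x \<in> Arr D (Fo x) (Ho x) \<and>
        base_arr D (\<eta> x) = (\<lambda>a\<in>carrier (base_of C x). a) \<and>
        (\<exists>\<theta>\<in>Arr D (Ho x) (Fo x).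
           Comp D (Fo x) (Ho x) (Fo x) \<theta> (\<eta> x) = Ident D (Fo x) \<and>
           Comp D (Ho x) (Fo x) (Ho x) (\<eta> x) \<theta> = Ident D (Ho x))) \<and>
     (\<forall>x\<in>Ob C. \<forall>y\<in>Ob C. \<forall>u\<in>Arr C x y.
        Comp D (Fo x) (Fo y) (Ho y) (\<eta> y) (Fm x y u) = Comp D (Fo x) (Ho x) (Ho y) (Hm x y u) (\<eta> x))"

text \<open>Equivalence of stacks.  Every arrow of a category fibred in groupoids is cartesian, so functors over
  the base preserve cartesian arrows automatically.\<close>

definition equivalent_over :: "('o, 'm, 'u) cat_over \<Rightarrow> ('p, 'n, 'u) cat_over \<Rightarrow> bool" where
  "equivalent_over C D \<longleftrightarrow>
     (\<exists>Fo Fm Ho Hm \<eta> \<epsilon>.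
        functor_over C D Fo Fm \<and> functor_over D C Ho Hm \<and>
        nat_iso_over C C (\<lambda>x. x) (\<lambda>x y u. u) (\<lambda>x. Ho (Fo x)) (\<lambda>x y u. Hm (Fo x) (Fo y) (Fm x y u)) \<eta> \<and>
        nat_iso_over D D (\<lambda>x. Fo (Ho x)) (\<lambda>x y u. Fm (Ho x) (Ho y) (Hm x y u)) (\<lambda>x. x) (\<lambda>x y u. u) \<epsilon>)"

text \<open>The quotient stack \<open>[X/G]\<close>: an object over \<open>Spec R\<close> is a \<open>G\<close>-torsor over \<open>Spec R\<close> together with an
  equivariant morphism to \<open>X\<close>.  An arrow is a morphism of affine base schemes with an equivariant morphism
  of torsors above it, compatible with the morphisms to \<open>X\<close>.\<close>

record ('u, 'g, 'x) qobj =
  base :: "'u calg"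
  tors :: "('u, 'g, 'u) gpsh"
  proj :: "'u calg \<Rightarrow> 'u \<Rightarrow> ('u \<Rightarrow> 'u)"
  equi :: "'u calg \<Rightarrow> 'u \<Rightarrow> 'x"

type_synonym 'u qarr = "('u \<Rightarrow> 'u) \<times> ('u calg \<Rightarrow> 'u \<Rightarrow> 'u)"

definition quotient_stack ::
  "('u, 'g) group_functor \<Rightarrow> ('u, 'g, 'x) gpsh \<Rightarrow> (('u, 'g, 'x) qobj, 'u qarr, 'u) cat_over" where
  "quotient_stack G X = \<lparr>
     Ob = {E. is_calg (base E) \<and> torsor G (base E) (tors E) (proj E) \<and>
              equi E \<in> psh_hom (tors E) X \<and> equivariant G (tors E) X (equi E)},
     Arr = (\<lambda>E E'. {(f, \<alpha>). f \<in> calg_hom (base E') (base E) \<and>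
              \<alpha> \<in> psh_hom (tors E) (tors E') \<and> equivariant G (tors E) (tors E') \<alpha> \<and>
              (\<forall>A. is_calg A \<longrightarrow> (\<forall>x\<in>sec (tors E) A.
                 proj E' A (\<alpha> A x) = compose (carrier (base E')) (proj E A x) f \<and>
                 equi E' A (\<alpha> A x) = equi E A x))}),
     Ident = (\<lambda>E. (\<lambda>a\<in>carrier (base E). a, \<lambda>A\<in>Collect is_calg. \<lambda>x\<in>sec (tors E) A. x)),
     Comp = (\<lambda>E E' E'' (f', \<alpha>') (f, \<alpha>).
              (compose (carrier (base E'')) f f',
               \<lambda>A\<in>Collect is_calg. compose (sec (tors E) A) (\<alpha>' A) (\<alpha> A))),
     base_of = base,
     base_arr = fst\<rparr>"


section \<open>Weighted projective stacks\<close>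

text \<open>The \<open>A\<close>-valued points of the complement in affine \<open>k\<close>-space of the common zero locus of a family \<open>F\<close>
  of polynomial functions: those \<open>Spec A \<rightarrow> \<bbbA>\<^sup>k\<close> such that no point of \<open>Spec A\<close> is mapped into
  the zero locus.\<close>

definition complement_points :: "nat \<Rightarrow> 'u calg \<Rightarrow> ((nat \<Rightarrow> 'u) \<Rightarrow> 'u) set \<Rightarrow> (nat \<Rightarrow> 'u) set" where
  "complement_points k A F =
     {z \<in> {1..k} \<rightarrow>\<^sub>E carrier A. \<not> (\<exists>I. primeideal I A \<and> (\<forall>h\<in>F. h z \<in> I))}"

definition mult_group :: "('u, 'u) group_functor" where
  "mult_group = \<lparr>pt_group = units_of, pt_map = (\<lambda>A B f g. f g)\<rparr>"

definition punctured_space :: "nat \<Rightarrow> (nat \<Rightarrow> nat) \<Rightarrow> ('u, 'u, nat \<Rightarrow> 'u) gpsh" where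
  "punctured_space k w =
     (let pts = (\<lambda>A. complement_points k A {h. \<exists>i\<in>{1..k}. h = (\<lambda>z. z i)}) in
      \<lparr>sec = pts,
       res = (\<lambda>A B f z. \<lambda>i\<in>{1..k}. f (z i)),
       act = (\<lambda>A \<mu>. \<lambda>z\<in>pts A. \<lambda>i\<in>{1..k}. (\<mu> [^]\<^bsub>A\<^esub> w i) \<otimes>\<^bsub>A\<^esub> z i)\<rparr>)"

definition weighted_projective_stack ::
  "nat \<Rightarrow> (nat \<Rightarrow> nat) \<Rightarrow> (('u, 'u, nat \<Rightarrow> 'u) qobj, 'u qarr, 'u) cat_over" where
  "weighted_projective_stack k w = quotient_stack mult_group (punctured_space k w)"


section \<open>Simplicial fans in rational vector spaces\<close>

definition Qspace :: "nat \<Rightarrow> (nat \<Rightarrow> rat) set" where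
  "Qspace d = {1..d} \<rightarrow>\<^sub>E UNIV"

definition cone_hull :: "nat \<Rightarrow> (nat \<Rightarrow> rat) set \<Rightarrow> (nat \<Rightarrow> rat) set" where
  "cone_hull d S = {x \<in> Qspace d. \<exists>a. (\<forall>v\<in>S. 0 \<le> a v) \<and> (\<forall>i\<in>{1..d}. x i = (\<Sum>v\<in>S. a v * v i))}"

definition lin_indep :: "nat \<Rightarrow> (nat \<Rightarrow> rat) set \<Rightarrow> bool" where
  "lin_indep d S \<longleftrightarrow> (\<forall>a. (\<forall>i\<in>{1..d}. (\<Sum>v\<in>S. a v * v i) = 0) \<longrightarrow> (\<forall>v\<in>S. a v = 0))"

text \<open>Faces are the supporting-hyperplane faces.\<close>

definition cone_face :: "nat \<Rightarrow> (nat \<Rightarrow> rat) set \<Rightarrow> (nat \<Rightarrow> rat) set \<Rightarrow> bool" where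
  "cone_face d \<tau> \<sigma> \<longleftrightarrow>
     (\<exists>u :: nat \<Rightarrow> rat. (\<forall>x\<in>\<sigma>. 0 \<le> (\<Sum>i=1..d. u i * x i)) \<and> \<tau> = {x \<in> \<sigma>. (\<Sum>i=1..d. u i * x i) = 0})"

definition simplicial_fan :: "nat \<Rightarrow> (nat \<Rightarrow> rat) set set \<Rightarrow> bool" where
  "simplicial_fan d \<Sigma> \<longleftrightarrow> finite \<Sigma> \<and> \<Sigma> \<noteq> {} \<and>
     (\<forall>\<sigma>\<in>\<Sigma>. \<exists>S. finite S \<and> S \<subseteq> Qspace d \<and> lin_indep d S \<and> \<sigma> = cone_hull d S) \<and>
     (\<forall>\<sigma>\<in>\<Sigma>. \<forall>\<tau>. cone_face d \<tau> \<sigma> \<longrightarrow> \<tau> \<in> \<Sigma>) \<and>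
     (\<forall>\<sigma>\<in>\<Sigma>. \<forall>\<tau>\<in>\<Sigma>. cone_face d (\<sigma> \<inter> \<tau>) \<sigma> \<and> cone_face d (\<sigma> \<inter> \<tau>) \<tau>)"

definition fan_rays :: "nat \<Rightarrow> (nat \<Rightarrow> rat) set set \<Rightarrow> (nat \<Rightarrow> rat) set set" where
  "fan_rays d \<Sigma> = {\<rho> \<in> \<Sigma>. \<exists>v\<in>Qspace d. (\<exists>i\<in>{1..d}. v i \<noteq> 0) \<and> \<rho> = cone_hull d {v}}"


section \<open>Stacky fans and their toric stacks\<close>

definition Zn :: "nat \<Rightarrow> (nat \<Rightarrow> int) monoid" where
  "Zn m = product_group {1..m} (\<lambda>_. integer_group)"

definition unit_vec :: "nat \<Rightarrow> nat \<Rightarrow> nat \<Rightarrow> int" where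
  "unit_vec m i = (\<lambda>j\<in>{1..m}. if j = i then 1 else 0)"

text \<open>\<open>\<iota> : N \<rightarrow> \<rat>\<^sup>d\<close> exhibits \<open>\<rat>\<^sup>d\<close> as \<open>N \<otimes> \<rat>\<close>, with \<open>\<iota> x\<close> in the role of \<open>x \<otimes> 1\<close>: its kernel is the
  torsion subgroup and every vector has a positive multiple in its image.  In particular \<open>N\<close> has rank \<open>d\<close>.\<close>

definition rationalization :: "('a, 'b) monoid_scheme \<Rightarrow> nat \<Rightarrow> ('a \<Rightarrow> nat \<Rightarrow> rat) \<Rightarrow> bool" where
  "rationalization N d \<iota> \<longleftrightarrow>
     \<iota> \<in> carrier N \<rightarrow> Qspace d \<and>
     (\<forall>x\<in>carrier N. \<forall>y\<in>carrier N. \<forall>i\<in>{1..d}. \<iota> (x \<otimes>\<^bsub>N\<^esub> y) i = \<iota> x i + \<iota> y i) \<and>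
     (\<forall>x\<in>carrier N. (\<forall>i\<in>{1..d}. \<iota> x i = 0) \<longleftrightarrow> (\<exists>m::nat. m > 0 \<and> x [^]\<^bsub>N\<^esub> m = \<one>\<^bsub>N\<^esub>)) \<and>
     (\<forall>v\<in>Qspace d. \<exists>m::nat. m > 0 \<and> (\<exists>x\<in>carrier N. \<forall>i\<in>{1..d}. \<iota> x i = of_nat m * v i))"

text \<open>The stacky fan \<open>(N, \<Sigma>, \<beta>)\<close> with rays \<open>\<rho> 1, \<dots>, \<rho> k\<close>.  That \<open>\<beta>(e\<^sub>i) \<otimes> 1\<close> is on \<open>\<rho>\<^sub>i\<close> means that it
  spans this ray.\<close>

definition stacky_fan ::
  "('a, 'b) monoid_scheme \<Rightarrow> nat \<Rightarrow> ('a \<Rightarrow> nat \<Rightarrow> rat) \<Rightarrow> (nat \<Rightarrow> rat) set set \<Rightarrow>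
   nat \<Rightarrow> (nat \<Rightarrow> (nat \<Rightarrow> rat) set) \<Rightarrow> ((nat \<Rightarrow> int) \<Rightarrow> 'a) \<Rightarrow> bool" where
  "stacky_fan N d \<iota> \<Sigma> k \<rho> \<beta> \<longleftrightarrow>
     comm_group N \<and> (\<exists>S. finite S \<and> S \<subseteq> carrier N \<and> generate N S = carrier N) \<and>
     rationalization N d \<iota> \<and>
     simplicial_fan d \<Sigma> \<and> bij_betw \<rho> {1..k} (fan_rays d \<Sigma>) \<and>
     \<beta> \<in> hom (Zn k) N \<and> finite (carrier (N Mod (\<beta> ` carrier (Zn k)))) \<and>
     (\<forall>i\<in>{1..k}. \<rho> i = cone_hull d {\<iota> (\<beta> (unit_vec k i))})"

text \<open>A free resolution \<open>0 \<rightarrow> \<int>\<^sup>s \<rightarrow> \<int>\<^bsup>d+s\<^esup> \<rightarrow> N \<rightarrow> 0\<close> with maps \<open>Q\<close> and \<open>p\<close>, and a lift \<open>Bt\<close> of \<open>\<beta>\<close>.\<close>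

definition free_resolution ::
  "('a, 'b) monoid_scheme \<Rightarrow> nat \<Rightarrow> nat \<Rightarrow> ((nat \<Rightarrow> int) \<Rightarrow> (nat \<Rightarrow> int)) \<Rightarrow> ((nat \<Rightarrow> int) \<Rightarrow> 'a) \<Rightarrow> bool" where
  "free_resolution N d s Q p \<longleftrightarrow>
     Q \<in> hom (Zn s) (Zn (d + s)) \<and> inj_on Q (carrier (Zn s)) \<and>
     p \<in> hom (Zn (d + s)) N \<and> Q ` carrier (Zn s) = kernel (Zn (d + s)) N p \<and>
     p ` carrier (Zn (d + s)) = carrier N"

definition is_lift ::
  "nat \<Rightarrow> nat \<Rightarrow> ((nat \<Rightarrow> int) \<Rightarrow> 'a) \<Rightarrow> ((nat \<Rightarrow> int) \<Rightarrow> 'a) \<Rightarrow> ((nat \<Rightarrow> int) \<Rightarrow> (nat \<Rightarrow> int)) \<Rightarrow> bool" where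
  "is_lift k e p \<beta> Bt \<longleftrightarrow> Bt \<in> hom (Zn k) (Zn e) \<and> (\<forall>x\<in>carrier (Zn k). p (Bt x) = \<beta> x)"

text \<open>The group of homomorphisms from \<open>G\<close> to an abelian group \<open>H\<close>.\<close>

definition hom_group :: "('a, 'c) monoid_scheme \<Rightarrow> ('b, 'd) monoid_scheme \<Rightarrow> ('a \<Rightarrow> 'b) monoid" where
  "hom_group G H = \<lparr>carrier = hom G H \<inter> extensional (carrier G),
                    monoid.mult = (\<lambda>f g. \<lambda>x\<in>carrier G. f x \<otimes>\<^bsub>H\<^esub> g x),
                    one = (\<lambda>x\<in>carrier G. \<one>\<^bsub>H\<^esub>)\<rparr>"

abbreviation dual :: "('a, 'c) monoid_scheme \<Rightarrow> ('a \<Rightarrow> int) monoid" where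
  "dual G \<equiv> hom_group G integer_group"

type_synonym dg_elt = "((nat \<Rightarrow> int) \<times> (nat \<Rightarrow> int) \<Rightarrow> int) set"

text \<open>\<open>\<int>\<^bsup>k+s\<^esup>\<close> is written as \<open>\<int>\<^sup>k \<oplus> \<int>\<^sup>s\<close>, so that \<open>[Bt Q]\<close> is \<open>(x, y) \<mapsto> Bt x + Q y\<close>; \<open>e\<close> stands
  for \<open>d + s\<close>.\<close>

definition DG_image ::
  "nat \<Rightarrow> nat \<Rightarrow> nat \<Rightarrow> ((nat \<Rightarrow> int) \<Rightarrow> (nat \<Rightarrow> int)) \<Rightarrow> ((nat \<Rightarrow> int) \<Rightarrow> (nat \<Rightarrow> int)) \<Rightarrow> dg_elt" where
  "DG_image k s e Bt Q =
     (\<lambda>\<theta>. \<lambda>(x, y)\<in>carrier (Zn k \<times>\<times> Zn s). \<theta> (Bt x \<otimes>\<^bsub>Zn e\<^esub> Q y)) ` carrier (dual (Zn e))"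

definition DG ::
  "nat \<Rightarrow> nat \<Rightarrow> nat \<Rightarrow> ((nat \<Rightarrow> int) \<Rightarrow> (nat \<Rightarrow> int)) \<Rightarrow> ((nat \<Rightarrow> int) \<Rightarrow> (nat \<Rightarrow> int)) \<Rightarrow> dg_elt monoid" where
  "DG k s e Bt Q = dual (Zn k \<times>\<times> Zn s) Mod DG_image k s e Bt Q"

text \<open>The image of the \<open>i\<close>-th coordinate function under \<open>(\<int>\<^sup>k)\<^sup>\<star> \<rightarrow> (\<int>\<^bsup>k+s\<^esup>)\<^sup>\<star> \<rightarrow> DG\<close>.\<close>

definition DG_class ::
  "nat \<Rightarrow> nat \<Rightarrow> nat \<Rightarrow> ((nat \<Rightarrow> int) \<Rightarrow> (nat \<Rightarrow> int)) \<Rightarrow> ((nat \<Rightarrow> int) \<Rightarrow> (nat \<Rightarrow> int)) \<Rightarrow> nat \<Rightarrow> dg_elt" where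
  "DG_class k s e Bt Q i =
     DG_image k s e Bt Q #>\<^bsub>dual (Zn k \<times>\<times> Zn s)\<^esub> (\<lambda>(x, y)\<in>carrier (Zn k \<times>\<times> Zn s). x i)"

text \<open>The diagonalizable group scheme \<open>Hom(M, \<complex>\<^sup>*)\<close>, with \<open>A\<close>-valued points \<open>Hom(M, A\<^sup>\<times>)\<close>.\<close>

definition diag_group :: "('m, 'c) monoid_scheme \<Rightarrow> ('u, 'm \<Rightarrow> 'u) group_functor" where
  "diag_group M = \<lparr>pt_group = (\<lambda>A. hom_group M (units_of A)),
                   pt_map = (\<lambda>A B f g. compose (carrier M) f g)\<rparr>"

text \<open>\<open>Z\<^sub>\<Sigma>\<close>, the complement of the zero locus of the ideal generated by, for each cone
  \<open>\<sigma>\<close>, the product of the \<open>z\<^sub>i\<close> with \<open>\<rho>\<^sub>i\<close> not contained in \<open>\<sigma>\<close>, on which \<open>g\<close> in \<open>Hom(M, \<complex>\<^sup>*)\<close> acts by multiplying \<open>z\<^sub>i\<close> with \<open>g (\<chi>\<^sub>i)\<close>.\<close>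

definition Z_space ::
  "nat \<Rightarrow> (nat \<Rightarrow> (nat \<Rightarrow> rat) set) \<Rightarrow> (nat \<Rightarrow> rat) set set \<Rightarrow> (nat \<Rightarrow> 'm) \<Rightarrow>
   ('u, 'm \<Rightarrow> 'u, nat \<Rightarrow> 'u) gpsh" where
  "Z_space k \<rho> \<Sigma> \<chi> =
     (let pts = (\<lambda>A. complement_points k A
                  {h. \<exists>\<sigma>\<in>\<Sigma>. h = (\<lambda>z. finprod A z {i \<in> {1..k}. \<not> \<rho> i \<subseteq> \<sigma>})}) in
      \<lparr>sec = pts,
       res = (\<lambda>A B f z. \<lambda>i\<in>{1..k}. f (z i)),
       act = (\<lambda>A g. \<lambda>z\<in>pts A. \<lambda>i\<in>{1..k}. g (\<chi> i) \<otimes>\<^bsub>A\<^esub> z i)\<rparr>)"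

text \<open>The stack \<open>[Z\<^sub>\<Sigma> / G\<^sub>\<beta>]\<close> computed with a free resolution and a lift as above.\<close>

definition toric_stack ::
  "nat \<Rightarrow> (nat \<Rightarrow> rat) set set \<Rightarrow> nat \<Rightarrow> (nat \<Rightarrow> (nat \<Rightarrow> rat) set) \<Rightarrow> nat \<Rightarrow>
   ((nat \<Rightarrow> int) \<Rightarrow> (nat \<Rightarrow> int)) \<Rightarrow> ((nat \<Rightarrow> int) \<Rightarrow> (nat \<Rightarrow> int)) \<Rightarrow>
   (('u, dg_elt \<Rightarrow> 'u, nat \<Rightarrow> 'u) qobj, 'u qarr, 'u) cat_over" where
  "toric_stack d \<Sigma> k \<rho> s Q Bt =
     quotient_stack (diag_group (DG k s (d + s) Bt Q)) (Z_space k \<rho> \<Sigma> (DG_class k s (d + s) Bt Q))"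


section \<open>The stacky fan of a weighted projective stack\<close>

text \<open>The weights \<open>v\<close> are the reduced ones, so \<open>tail_gcd n v 1 = 1\<close> in the application.\<close>

definition tail_gcd :: "nat \<Rightarrow> (nat \<Rightarrow> nat) \<Rightarrow> nat \<Rightarrow> nat" where
  "tail_gcd n v i = Gcd (v ` {i..n+1})"

definition orbifold_matrix :: "nat \<Rightarrow> (nat \<Rightarrow> nat) \<Rightarrow> (nat \<Rightarrow> nat \<Rightarrow> int) \<Rightarrow> bool" where
  "orbifold_matrix n v B \<longleftrightarrow>
     (\<forall>i\<in>{1..n-1}.
        (\<forall>j\<in>{1..<i}. B i j = 0) \<and>
        B i i = int (tail_gcd n v (i+1) div tail_gcd n v i) \<and>
        int (tail_gcd n v (i+1) div tail_gcd n v i) * int (v i) + (\<Sum>j=i+1..n+1. B i j * int (v j)) = 0) \<and>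
     (\<forall>i\<in>{2..n-1}. \<forall>j\<in>{1..i-1}.
        0 \<le> B j i \<and> B j i < int (tail_gcd n v (i+1) div tail_gcd n v i)) \<and>
     (\<forall>j\<in>{1..<n}. B n j = 0) \<and>
     B n n = int (v (n+1) div tail_gcd n v n) \<and>
     B n (n+1) = - int (v n div tail_gcd n v n)"

definition matrix_column :: "nat \<Rightarrow> (nat \<Rightarrow> nat \<Rightarrow> int) \<Rightarrow> nat \<Rightarrow> (nat \<Rightarrow> rat)" where
  "matrix_column n B j = (\<lambda>i\<in>{1..n}. of_int (B i j))"

definition column_ray :: "nat \<Rightarrow> (nat \<Rightarrow> nat \<Rightarrow> int) \<Rightarrow> nat \<Rightarrow> (nat \<Rightarrow> rat) set" where
  "column_ray n B j = cone_hull n {matrix_column n B j}"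

text \<open>The maximal cones, generated by \<open>n\<close> of the \<open>n + 1\<close> columns, together with all their faces.\<close>

definition column_fan :: "nat \<Rightarrow> (nat \<Rightarrow> nat \<Rightarrow> int) \<Rightarrow> (nat \<Rightarrow> rat) set set" where
  "column_fan n B =
     {\<tau>. \<exists>I \<subseteq> {1..n+1}. card I = n \<and> cone_face n \<tau> (cone_hull n (matrix_column n B ` I))}"

definition target_group :: "nat \<Rightarrow> nat \<Rightarrow> ((nat \<Rightarrow> int) \<times> int) monoid" where
  "target_group n m = Zn n \<times>\<times> integer_mod_group m"

definition target_map :: "nat \<Rightarrow> (nat \<Rightarrow> int) \<times> int \<Rightarrow> nat \<Rightarrow> rat" where
  "target_map n = (\<lambda>(x, t). \<lambda>i\<in>{1..n}. of_int (x i))"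

text \<open>The homomorphism \<open>\<int>\<^bsup>n+1\<^esup> \<rightarrow> \<int>\<^sup>n \<oplus> \<int>/m\<close> with matrix \<open>B\<close> in the first component and row \<open>c\<close> in the
  second.\<close>

definition stacky_beta ::
  "nat \<Rightarrow> nat \<Rightarrow> (nat \<Rightarrow> nat \<Rightarrow> int) \<Rightarrow> (nat \<Rightarrow> int) \<Rightarrow> (nat \<Rightarrow> int) \<Rightarrow> (nat \<Rightarrow> int) \<times> int" where
  "stacky_beta n m B c x =
     (\<lambda>i\<in>{1..n}. \<Sum>j=1..n+1. B i j * x j, (\<Sum>j=1..n+1. c j * x j) mod int m)"

end

theory Submission
  imports Defs
begin

text \<open>
  Let \<open>v\<close> be the reduced weights.  The triangular shape of \<open>B'\<close> and Bezout's identity, applied row by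
  row from below, show that \<open>B'\<close> maps \<open>\<int>\<^bsup>n+1\<^esup>\<close> onto \<open>\<int>\<^sup>n\<close> with kernel \<open>\<int>v\<close>.  Since \<open>v\<close> is the only linear
  relation between the columns and has positive entries, the cones over proper subsets of the columns form a
  simplicial fan.  The condition on \<open>c\<close> makes \<open>\<beta>\<close> surjective with kernel \<open>\<int>w\<close>.  Hence \<open>[Bt Q]\<close> is
  onto with infinite cyclic kernel, generated by some \<open>(w, y)\<close>.  This kernel is a direct summand, so
  evaluation at \<open>(w, y)\<close> identifies \<open>DG(\<beta>)\<close> with \<open>\<int>\<close> and the class of the \<open>i\<close>-th coordinate with
  \<open>w\<^sub>i\<close>.  So \<open>G\<^sub>\<beta>\<close> is the multiplicative group acting with weights \<open>w\<^sub>i\<close> on \<open>Z\<^sub>\<Sigma>\<close>, which is the punctured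
  affine space, and transport of the action along \<open>G\<^sub>\<beta> \<cong> \<complex>\<^sup>*\<close> is an equivalence of the quotient stacks.
\<close>

section \<open>The lattice relations of the orbifold matrix\<close>

text \<open>The toric stack depends on a choice of \<open>s\<close>, \<open>Q\<close>,
  \<open>p\<close> and \<open>Bt\<close>, and the equivalence is claimed for every choice; so no
  convenient resolution is picked and only exactness is used. The obstacle is torsion:
  \<open>w\<close> is divisible by \<open>lam\<close> in the lattice indexed by the columns, and
  evaluating forms of that lattice at \<open>w\<close> only reaches multiples of \<open>lam\<close>.
  The extra \<open>s\<close> coordinates record the relations of the target group, and (w, y) is
  indivisible although \<open>w\<close> is not. This is how a fan built from the reduced weights
  yields an action with the weights \<open>w\<close>. On the fan side everything is drawn from one
  dual statement: a family of values on the columns comes from a linear functional as soon as it is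
  orthogonal to the reduced weights. It supplies the supporting functionals of the faces and, by
  testing relations against functionals, the uniqueness of the relation. The stacks are compared
  without touching any torsor as a sheaf: the functors exchange the acting group and are the
  identity on arrows.\<close>

lemma orbifold_matrix_row:
  assumes B: "orbifold_matrix n v B" and pos: "\<forall>i\<in>{1..n+1}. v i > 0" and m: "m \<in> {1..n}"
  obtains h f where "tail_gcd n v (m+1) = h * tail_gcd n v m" "v m = f * tail_gcd n v m"
    "coprime (int h) (int f)" "B m m = int h"
    "int h * int (v m) + (\<Sum>j=m+1..n+1. B m j * int (v j)) = 0" "\<forall>j\<in>{1..<m}. B m j = 0"
proof -
  let ?g = "tail_gcd n v"
  have g: "?g m = gcd (v m) (?g (m+1))"
  proof -
    have "{m..n+1} = insert m {m+1..n+1}" using m by auto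
    then show ?thesis by (simp add: tail_gcd_def)
  qed
  have gpos: "?g m > 0" using g bspec[OF pos, of m] m by simp
  \<comment> \<open>The tail gcd at \<open>m\<close> is the gcd of \<open>v m\<close> and the next
    tail gcd, so dividing these two by it leaves a coprime pair. This pair drives the inductions
    over the rows.\<close>
  define h f where "h = ?g (m+1) div ?g m" and "f = v m div ?g m"
  have h: "?g (m+1) = h * ?g m" and f: "v m = f * ?g m"
    unfolding h_def f_def using g by (metis dvd_div_mult_self gcd_dvd2, metis dvd_div_mult_self gcd_dvd1)
  have "coprime (v m div ?g m) (?g (m+1) div ?g m)"
    unfolding g using gpos by (intro div_gcd_coprime) (use bspec[OF pos, of m] m in auto)
  then have "coprime (int h) (int f)"
    by (simp add: h_def f_def coprime_commute)
  moreover have "B m m = int h \<and> int h * int (v m) + (\<Sum>j=m+1..n+1. B m j * int (v j)) = 0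
     \<and> (\<forall>j\<in>{1..<m}. B m j = 0)"
  proof (cases "m = n")
    case True
    \<comment> \<open>Row \<open>n\<close> has its own clause in the definition. It fits the pattern
      of the other rows because the last tail gcd is the single weight
      \<open>v (n+1)\<close>.\<close>
    have g1: "?g (n+1) = v (n+1)" by (simp add: tail_gcd_def)
    have "int h * int (v m) = int h * int (?g m) * int f"
      by (subst f) simp
    also have "\<dots> = int f * int (v (n+1))"
      using h True g1 by (simp flip: of_nat_mult)
    finally show ?thesis using B True
      by (simp add: orbifold_matrix_def h_def f_def g1[simplified])
  next
    case False
    then have "m \<in> {1..n-1}" using m by auto
    then show ?thesis using B unfolding orbifold_matrix_def h_def by blast
  qed
  ultimately show ?thesis using that h f by blast
qed

lemma tail_gcd_dvd: "j \<in> {m..n+1} \<Longrightarrow> tail_gcd n v m dvd v j"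
  by (simp add: tail_gcd_def)

lemma tail_gcd_pos:
  assumes "\<forall>i\<in>{1..n+1}. v i > 0" "m \<in> {1..n+1}"
  shows "tail_gcd n v m > 0"
  using assms tail_gcd_dvd[of m m n v] by (metis atLeastAtMost_iff dvd_pos_nat le_refl)

lemma orbifold_matrix_row_sum:
  assumes B: "orbifold_matrix n v B" and pos: "\<forall>i\<in>{1..n+1}. v i > 0" and i: "i \<in> {1..n}"
  shows "(\<Sum>j=1..n+1. B i j * x j) = (\<Sum>j=i..n+1. B i j * x j)"
proof (rule sum.mono_neutral_right)
  have "\<forall>j\<in>{1..<i}. B i j = 0" by (rule orbifold_matrix_row[OF B pos i])
  then show "\<forall>j\<in>{1..n+1} - {i..n+1}. B i j * x j = 0" by auto
qed (use i in auto)

lemma orbifold_matrix_weights_tail: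
  assumes B: "orbifold_matrix n v B" and pos: "\<forall>i\<in>{1..n+1}. v i > 0" and i: "i \<in> {1..n}"
  shows "(\<Sum>j=i..n+1. B i j * int (v j)) = 0"
proof -
  have "(\<Sum>j=i..n+1. B i j * int (v j)) = B i i * int (v i) + (\<Sum>j=i+1..n+1. B i j * int (v j))"
    using i by (simp add: sum.atLeast_Suc_atMost)
  also have "\<dots> = 0" by (rule orbifold_matrix_row[OF B pos i]) (simp only:)
  finally show ?thesis .
qed

text \<open>Rows are solved from the bottom up. A solution for the rows after \<open>m\<close> may
  be shifted along the tail of \<open>v\<close> divided by its gcd, which these rows do not see. Row
  \<open>m\<close> sees such a shift with factor \<open>f\<close> up to sign, and its own entry with
  factor \<open>h\<close>, so coprimality lets it reach any \<open>y m\<close>.\<close>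

lemma orbifold_matrix_surj_tail:
  assumes B: "orbifold_matrix n v B" and pos: "\<forall>i\<in>{1..n+1}. v i > 0"
    and "m \<le> n+1" "1 \<le> m"
  shows "\<exists>x. \<forall>i\<in>{m..n}. (\<Sum>j=i..n+1. B i j * x j) = y i"
  using assms(3,4)
proof (induction m rule: inc_induct)
  case base
  then show ?case by auto
next
  case (step m)
  let ?g = "tail_gcd n v"
  have m: "m \<in> {1..n}" using step by auto
  obtain x where x: "\<forall>i\<in>{Suc m..n}. (\<Sum>j=i..n+1. B i j * x j) = y i" using step by auto
  obtain h f where hf: "?g (m+1) = h * ?g m" "v m = f * ?g m"
    "coprime (int h) (int f)" "B m m = int h"
    "int h * int (v m) + (\<Sum>j=m+1..n+1. B m j * int (v j)) = 0"
    by (rule orbifold_matrix_row[OF B pos m])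
  have gpos: "?g (m+1) > 0" using tail_gcd_pos[OF pos, of "m+1"] m by simp
  \<comment> \<open>The tail of \<open>v\<close> divided by its gcd; the division is exact for the
    columns after \<open>m\<close>, which are the ones that matter below.\<close>
  define e where "e j = int (v j div ?g (m+1))" for j
  have e: "int (v j) = int (?g (m+1)) * e j" if "j \<in> {m+1..n+1}" for j
    using tail_gcd_dvd[OF that, of v] by (simp add: e_def flip: of_nat_mult)
  have e_sum: "(\<Sum>j=l..n+1. B i j * int (v j)) = int (?g (m+1)) * (\<Sum>j=l..n+1. B i j * e j)"
    if "l \<ge> m+1" for i l
    unfolding sum_distrib_left using that e by (intro sum.cong) auto
  have e0: "(\<Sum>j=i..n+1. B i j * e j) = 0" if "i \<in> {Suc m..n}" for i
    using e_sum[of i i] orbifold_matrix_weights_tail[OF B pos, of i] that gpos by auto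
  have "int (?g (m+1)) * (int f + (\<Sum>j=m+1..n+1. B m j * e j)) = 0"
    using hf(5) e_sum[of "m+1" m] unfolding hf(1,2) by (simp add: algebra_simps)
  then have em: "(\<Sum>j=m+1..n+1. B m j * e j) = - int f" using gpos by simp
  obtain p q where pq: "p * int h + q * int f = 1"
    using hf(3) by (metis bezout_int coprime_iff_gcd_eq_1)
  \<comment> \<open>\<open>r\<close> is the defect of row \<open>m\<close> for the old tail. The
    identity 1 = p h + q f splits it between the entry in column \<open>m\<close> and a shift along
    \<open>e\<close>.\<close>
  define r where "r = y m - (\<Sum>j=m+1..n+1. B m j * x j)"
  define x' where "x' j = (if j = m then p * r else x j - q * r * e j)" for j
  have "(\<Sum>j=i..n+1. B i j * x' j) = y i" if "i \<in> {m..n}" for i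
  proof (cases "i = m")
    case False
    have "(\<Sum>j=i..n+1. B i j * x' j) = (\<Sum>j=i..n+1. B i j * x j - q * r * (B i j * e j))"
      using False that by (intro sum.cong) (auto simp: x'_def algebra_simps)
    also have "\<dots> = y i" using x e0[of i] False that
      by (simp add: sum_subtractf flip: sum_distrib_left)
    finally show ?thesis .
  next
    case True
    have "(\<Sum>j=m+1..n+1. B m j * x' j) = (\<Sum>j=m+1..n+1. B m j * x j - q * r * (B m j * e j))"
      by (intro sum.cong) (auto simp: x'_def algebra_simps)
    also have "\<dots> = y m - r + q * r * int f"
      using em by (simp only: sum_subtractf flip: sum_distrib_left) (simp add: r_def)
    finally have "(\<Sum>j=m..n+1. B m j * x' j) = int h * (p * r) + (y m - r + q * r * int f)"
      using m hf(4) by (simp add: sum.atLeast_Suc_atMost x'_def)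
    also have "\<dots> = y m + (p * int h + q * int f - 1) * r" by (simp add: algebra_simps)
    finally show ?thesis using pq True by simp
  qed
  then show ?case by blast
qed

text \<open>The claim says, without division, that the tail of \<open>x\<close> is an integer
  multiple \<open>t\<close> of the tail of \<open>v\<close> divided by its gcd. Passing from
  \<open>m+1\<close> to \<open>m\<close>, row \<open>m\<close> gives h x_m = t f, so coprimality
  makes \<open>t\<close> divisible by \<open>h\<close>, which is exactly the ratio of the two
  gcds.\<close>

lemma orbifold_matrix_kernel_tail:
  assumes B: "orbifold_matrix n v B" and pos: "\<forall>i\<in>{1..n+1}. v i > 0"
    and x: "\<forall>i\<in>{1..n}. (\<Sum>j=i..n+1. B i j * x j) = 0"
    and "m \<le> n+1" "1 \<le> m"
  shows "\<exists>t. \<forall>j\<in>{m..n+1}. x j * int (tail_gcd n v m) = t * int (v j)"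
  using assms(4,5)
proof (induction m rule: inc_induct)
  case base
  then show ?case by (auto simp: tail_gcd_def)
next
  case (step m)
  let ?g = "tail_gcd n v"
  have m: "m \<in> {1..n}" using step by auto
  obtain t where t: "\<forall>j\<in>{m+1..n+1}. x j * int (?g (m+1)) = t * int (v j)" using step by auto
  obtain h f where hf: "?g (m+1) = h * ?g m" "v m = f * ?g m"
    "coprime (int h) (int f)" "B m m = int h"
    "int h * int (v m) + (\<Sum>j=m+1..n+1. B m j * int (v j)) = 0"
    by (rule orbifold_matrix_row[OF B pos m])
  have gpos: "?g m > 0" using tail_gcd_pos[OF pos, of m] m by simp
  have hpos: "h > 0" using tail_gcd_pos[OF pos, of "m+1"] m hf(1) by (simp add: zero_less_mult_iff)
  have "int h * x m + (\<Sum>j=m+1..n+1. B m j * x j) = 0"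
    using bspec[OF x m] m hf(4) by (simp add: sum.atLeast_Suc_atMost)
  \<comment> \<open>Multiplied by the tail gcd, the row equation can absorb the induction
    hypothesis.\<close>
  then have "int h * x m * int (?g (m+1)) + (\<Sum>j=m+1..n+1. B m j * (x j * int (?g (m+1)))) = 0"
    by (simp only: mult.assoc[symmetric] flip: sum_distrib_right distrib_right)
  also have "(\<Sum>j=m+1..n+1. B m j * (x j * int (?g (m+1)))) = t * (\<Sum>j=m+1..n+1. B m j * int (v j))"
    unfolding sum_distrib_left using t by (intro sum.cong) (auto simp: mult.left_commute)
  also have "\<dots> = - (t * (int h * int (v m)))" using hf(5) by (metis add.inverse_inverse add_eq_0_iff mult_minus_right)
  finally have "int h * int (?g m) * (int h * x m - t * int f) = 0"
    unfolding hf(1,2) by (simp add: algebra_simps)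
  then have eq: "int h * x m = t * int f" using gpos hpos by simp
  then have "int h dvd t" using hf(3) by (metis coprime_dvd_mult_left_iff dvd_triv_left)
  then obtain t' where t': "t = int h * t'" by blast
  have "x j * int (?g m) = t' * int (v j)" if "j \<in> {m..n+1}" for j
  proof (cases "j = m")
    case True
    have "x m = t' * int f" using eq hpos unfolding t' by simp
    moreover have "int (v m) = int f * int (?g m)" by (subst hf(2)) simp
    ultimately show ?thesis using True by simp
  next
    case False
    then have "int h * (x j * int (?g m)) = int h * (t' * int (v j))"
      using t that unfolding hf(1) t' by (auto simp: algebra_simps)
    then show ?thesis using hpos by simp
  qed
  then show ?case by blast
qed

lemma orbifold_matrix_weights:
  assumes "orbifold_matrix n v B" "\<forall>i\<in>{1..n+1}. v i > 0" "i \<in> {1..n}"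
  shows "(\<Sum>j=1..n+1. B i j * int (v j)) = 0"
  by (simp only: orbifold_matrix_row_sum[OF assms] orbifold_matrix_weights_tail[OF assms])

lemma orbifold_matrix_surj:
  assumes "orbifold_matrix n v B" "\<forall>i\<in>{1..n+1}. v i > 0"
  obtains x where "\<forall>i\<in>{1..n}. (\<Sum>j=1..n+1. B i j * x j) = y i"
  using orbifold_matrix_surj_tail[OF assms, of 1 y] orbifold_matrix_row_sum[OF assms] by auto

lemma orbifold_matrix_kernel:
  assumes B: "orbifold_matrix n v B" "\<forall>i\<in>{1..n+1}. v i > 0" and g: "Gcd (v ` {1..n+1}) = 1"
    and x: "\<forall>i\<in>{1..n}. (\<Sum>j=1..n+1. B i j * x j) = 0"
  obtains t where "\<forall>j\<in>{1..n+1}. x j = t * int (v j)"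
proof -
  have "\<forall>i\<in>{1..n}. (\<Sum>j=i..n+1. B i j * x j) = 0"
    using x orbifold_matrix_row_sum[OF B, of _ x] by simp
  from orbifold_matrix_kernel_tail[OF B this, of 1] g show ?thesis using that
    by (auto simp: tail_gcd_def)
qed


section \<open>The fan of a complete simplex\<close>

text \<open>\<open>functional\<close> is the dual form of the statement that \<open>v\<close> spans
  all relations between the generators. It is assumed in this form because faces need functionals
  with prescribed values; the uniqueness of the relation is derived from it.\<close>

locale complete_simplex =
  fixes n :: nat and v :: "nat \<Rightarrow> rat" and u :: "nat \<Rightarrow> nat \<Rightarrow> rat"
  assumes n_pos: "n \<ge> 1"
    and v_pos: "j \<in> {1..n+1} \<Longrightarrow> v j > 0"
    and u_in: "u j \<in> Qspace n"
    and relation: "i \<in> {1..n} \<Longrightarrow> (\<Sum>j=1..n+1. v j * u j i) = 0"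
    and functional: "(\<Sum>j=1..n+1. a j * v j) = 0 \<Longrightarrow>
          \<exists>f. \<forall>j\<in>{1..n+1}. (\<Sum>i=1..n. f i * u j i) = a j"
begin

declare sum.cl_ivl_Suc [simp del]

lemma relation_unique:
  assumes r: "\<forall>i\<in>{1..n}. (\<Sum>j=1..n+1. r j * u j i) = 0" and p: "p \<in> {1..n+1}" and q: "q \<in> {1..n+1}"
  shows "r p * v q = r q * v p"
proof (cases "p = q")
  case False
  \<comment> \<open>The values v_q at \<open>p\<close> and -v_p at \<open>q\<close> are orthogonal
    to \<open>v\<close>, hence come from a functional. Pairing a relation \<open>r\<close> with them
    must give 0, and this pairing is the minor in the claim.\<close>
  define a where "a j = (if j = p then v q else 0) - (if j = q then v p else 0)" for j
  have a_sum: "(\<Sum>j=1..n+1. x j * a j) = x p * v q - x q * v p" for x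
    using p q by (simp add: a_def right_diff_distrib sum_subtractf if_distrib[of "(*) _"] sum.delta
        cong: if_cong)
  have "(\<Sum>j=1..n+1. a j * v j) = 0" using a_sum[of v] by (simp only: mult.commute[of "a _"]) simp
  then obtain f where f: "\<forall>j\<in>{1..n+1}. (\<Sum>i=1..n. f i * u j i) = a j" using functional by blast
  have "r p * v q - r q * v p = (\<Sum>j=1..n+1. r j * (\<Sum>i=1..n. f i * u j i))"
    unfolding a_sum[symmetric] using f by (intro sum.cong) auto
  also have "\<dots> = (\<Sum>i=1..n. f i * (\<Sum>j=1..n+1. r j * u j i))"
    unfolding sum_distrib_left by (subst sum.swap) (simp only: mult.left_commute)
  also have "\<dots> = 0" using r by simp
  finally show ?thesis by simp
qed simp

lemma relation_zero:
  assumes r: "\<forall>i\<in>{1..n}. (\<Sum>j=1..n+1. r j * u j i) = 0"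
    and p: "p \<in> {1..n+1}" "r p = 0" and q: "q \<in> {1..n+1}"
  shows "r q = 0"
  using relation_unique[OF r p(1) q] p(2) v_pos[OF p(1)] by simp

text \<open>The difference of the coordinates is a multiple of \<open>v\<close>, hence of constant
  sign. A zero of \<open>a\<close> makes it nonpositive, a zero of \<open>b\<close>
  nonnegative.\<close>

lemma eq_cone_coords:
  assumes "\<forall>i\<in>{1..n}. (\<Sum>j=1..n+1. a j * u j i) = (\<Sum>j=1..n+1. b j * u j i)"
    and a: "\<forall>j\<in>{1..n+1}. a j \<ge> 0" and b: "\<forall>j\<in>{1..n+1}. b j \<ge> 0"
    and p: "p \<in> {1..n+1}" "a p = 0" and q: "q \<in> {1..n+1}" "b q = 0" and j: "j \<in> {1..n+1}"
  shows "a j = b j"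
proof -
  define r where "r j = a j - b j" for j
  have r: "\<forall>i\<in>{1..n}. (\<Sum>j=1..n+1. r j * u j i) = 0"
    using assms(1) unfolding r_def by (simp only: left_diff_distrib sum_subtractf) simp
  have "r p * v q = r q * v p" using relation_unique[OF r p(1) q(1)] .
  moreover have "r p * v q \<le> 0" "r q * v p \<ge> 0"
    using a b p q v_pos[OF p(1)] v_pos[OF q(1)]
    by (auto simp: r_def zero_le_mult_iff mult_le_0_iff)
  ultimately have "r p = 0" using v_pos[OF q(1)] by auto
  from relation_zero[OF r p(1) this j] show ?thesis by (simp add: r_def)
qed

text \<open>Equal generators would give a relation with entries 1 and -1, against the positivity of
  \<open>v\<close>. Injectivity permits coefficients indexed by columns in place of coefficients
  indexed by vectors.\<close>

lemma inj_u: "inj_on u {1..n+1}"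
proof (rule inj_onI, rule ccontr)
  fix p q assume p: "p \<in> {1..n+1}" and q: "q \<in> {1..n+1}" and eq: "u p = u q" and ne: "p \<noteq> q"
  let ?r = "\<lambda>j. (if j = p then 1 else 0) - (if j = q then 1 else 0) :: rat"
  have r: "\<forall>i\<in>{1..n}. (\<Sum>j=1..n+1. ?r j * u j i) = 0"
    using p q eq by (simp add: left_diff_distrib sum_subtractf if_distrib[of "\<lambda>x. x * _"]
        cong: if_cong)
  show False using relation_unique[OF r p q] ne v_pos[OF p] v_pos[OF q] by simp
qed

section \<open>Cones on sets of columns and their faces\<close>

definition cone :: "nat set \<Rightarrow> (nat \<Rightarrow> rat) set" where
  "cone J = cone_hull n (u ` J)"

text \<open>Coefficients extended by zero to all columns let different cones be compared in one
  coordinate system.\<close>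

lemma cone_iff:
  assumes J: "J \<subseteq> {1..n+1}"
  shows "x \<in> cone J \<longleftrightarrow> x \<in> Qspace n \<and> (\<exists>a. (\<forall>j\<in>{1..n+1}. a j \<ge> 0) \<and> (\<forall>j\<in>{1..n+1} - J. a j = 0)
           \<and> (\<forall>i\<in>{1..n}. x i = (\<Sum>j=1..n+1. a j * u j i)))" (is "_ \<longleftrightarrow> _ \<and> ?R")
proof -
  have inj: "inj_on u J" using inj_u J by (rule inj_on_subset)
  have sum_u: "(\<Sum>w\<in>u ` J. a w * w i) = (\<Sum>j\<in>J. a (u j) * u j i)" for a i
    using inj by (simp add: sum.reindex)
  have sum_J: "(\<Sum>j=1..n+1. a j * u j i) = (\<Sum>j\<in>J. a j * u j i)"
    if "\<forall>j\<in>{1..n+1} - J. a j = 0" for a i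
    using J that by (intro sum.mono_neutral_right) auto
  have "(\<exists>a. (\<forall>w\<in>u ` J. 0 \<le> a w) \<and> (\<forall>i\<in>{1..n}. x i = (\<Sum>w\<in>u ` J. a w * w i))) \<longleftrightarrow> ?R" (is "?L \<longleftrightarrow> _")
  proof
    assume ?L
    then obtain a where a: "\<forall>w\<in>u ` J. 0 \<le> a w" "\<forall>i\<in>{1..n}. x i = (\<Sum>w\<in>u ` J. a w * w i)" by blast
    let ?b = "\<lambda>j. if j \<in> J then a (u j) else 0"
    have "(\<Sum>j=1..n+1. ?b j * u j i) = (\<Sum>w\<in>u ` J. a w * w i)" for i
      by (subst sum_J) (auto simp: sum_u)
    then show ?R using a by (intro exI[of _ ?b]) auto
  next
    assume ?R
    then obtain a where a: "\<forall>j\<in>{1..n+1}. a j \<ge> 0" "\<forall>j\<in>{1..n+1} - J. a j = 0"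
      "\<forall>i\<in>{1..n}. x i = (\<Sum>j=1..n+1. a j * u j i)" by blast
    have "(\<Sum>w\<in>u ` J. a (inv_into J u w) * w i) = (\<Sum>j=1..n+1. a j * u j i)" for i
      unfolding sum_u sum_J[OF a(2)] using inj by (intro sum.cong) auto
    then show ?L using a J inj by (intro exI[of _ "\<lambda>w. a (inv_into J u w)"]) auto
  qed
  then show ?thesis by (simp add: cone_def cone_hull_def)
qed

lemma u_in_cone:
  assumes "j \<in> J" "J \<subseteq> {1..n+1}"
  shows "u j \<in> cone J"
proof -
  have j: "j \<in> {1..n+1}" using assms by blast
  have "u j i = (\<Sum>k=1..n+1. (if k = j then 1 else 0) * u k i)" for i
    using j by (simp add: if_distrib[of "\<lambda>x. x * _"] cong: if_cong)
  then show ?thesis unfolding cone_iff[OF assms(2)] using assms(1) u_in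
    by (intro conjI exI[of _ "\<lambda>k. if k = j then 1 else 0"]) auto
qed

lemma cone_coords_unique:
  assumes I: "I \<subset> {1..n+1}" and J: "J \<subset> {1..n+1}"
    and a: "\<forall>j\<in>{1..n+1}. a j \<ge> 0" "\<forall>j\<in>{1..n+1} - I. a j = 0"
    and b: "\<forall>j\<in>{1..n+1}. b j \<ge> 0" "\<forall>j\<in>{1..n+1} - J. b j = 0"
    and eq: "\<forall>i\<in>{1..n}. (\<Sum>j=1..n+1. a j * u j i) = (\<Sum>j=1..n+1. b j * u j i)"
    and j: "j \<in> {1..n+1}"
  shows "a j = b j"
proof -
  obtain p q where "p \<in> {1..n+1} - I" "q \<in> {1..n+1} - J" using I J by blast
  then show ?thesis using eq_cone_coords[OF eq a(1) b(1) _ _ _ _ j] a(2) b(2) by blast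
qed

text \<open>Properness of both index sets provides vanishing coordinates, so the two expansions of a
  common point agree and its support lies in both sets.\<close>

lemma cone_Int:
  assumes I: "I \<subset> {1..n+1}" and J: "J \<subset> {1..n+1}"
  shows "cone I \<inter> cone J = cone (I \<inter> J)"
proof (intro equalityI subsetI)
  fix x assume x: "x \<in> cone I \<inter> cone J"
  obtain a where a: "\<forall>j\<in>{1..n+1}. a j \<ge> 0" "\<forall>j\<in>{1..n+1} - I. a j = 0"
      "\<forall>i\<in>{1..n}. x i = (\<Sum>j=1..n+1. a j * u j i)"
    using x I cone_iff[of I x] by blast
  obtain b where b: "\<forall>j\<in>{1..n+1}. b j \<ge> 0" "\<forall>j\<in>{1..n+1} - J. b j = 0"
      "\<forall>i\<in>{1..n}. x i = (\<Sum>j=1..n+1. b j * u j i)"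
    using x J cone_iff[of J x] by blast
  have "a j = b j" if "j \<in> {1..n+1}" for j
    by (rule cone_coords_unique[OF I J a(1,2) b(1,2) _ that]) (use a(3) b(3) in simp)
  then have "\<forall>j\<in>{1..n+1} - I \<inter> J. a j = 0" using a(2) b(2) by auto
  moreover have "x \<in> Qspace n" using x I cone_iff[of I x] by blast
  ultimately show "x \<in> cone (I \<inter> J)" using a I by (subst cone_iff) auto
next
  fix x assume "x \<in> cone (I \<inter> J)"
  then show "x \<in> cone I \<inter> cone J" using I J
    by (subst (asm) cone_iff, blast) (auto simp: cone_iff[OF psubset_imp_subset])
qed

lemma functional_on_cone:
  assumes "\<forall>i\<in>{1..n}. x i = (\<Sum>j=1..n+1. a j * u j i)"
  shows "(\<Sum>i=1..n. f i * x i) = (\<Sum>j=1..n+1. a j * (\<Sum>i=1..n. f i * u j i))"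
proof -
  have "(\<Sum>i=1..n. f i * x i) = (\<Sum>i=1..n. \<Sum>j=1..n+1. f i * (a j * u j i))"
    using assms unfolding sum_distrib_left[symmetric] by (intro sum.cong) auto
  also have "\<dots> = (\<Sum>j=1..n+1. a j * (\<Sum>i=1..n. f i * u j i))"
    unfolding sum_distrib_left by (subst sum.swap) (simp only: mult.left_commute)
  finally show ?thesis .
qed

text \<open>On the cone the functional is a sum of nonnegative terms, one for each generator. It
  vanishes only where each term does, which leaves the generators in its zero set.\<close>

lemma cone_face_by_functional:
  assumes I: "I \<subseteq> {1..n+1}" and f: "\<forall>j\<in>I. 0 \<le> (\<Sum>i=1..n. f i * u j i)"
  shows "\<forall>x\<in>cone I. 0 \<le> (\<Sum>i=1..n. f i * x i)"
    and "{x \<in> cone I. (\<Sum>i=1..n. f i * x i) = 0} = cone {j \<in> I. (\<Sum>i=1..n. f i * u j i) = 0}"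
proof -
  let ?F = "\<lambda>x. \<Sum>i=1..n. f i * x i"
  have nonneg: "\<forall>j\<in>{1..n+1}. 0 \<le> a j * ?F (u j)"
    if "\<forall>j\<in>{1..n+1}. a j \<ge> 0" "\<forall>j\<in>{1..n+1} - I. a j = 0" for a
  proof
    fix j assume "j \<in> {1..n+1}"
    then show "0 \<le> a j * ?F (u j)" using that f by (cases "j \<in> I") auto
  qed
  show "\<forall>x\<in>cone I. 0 \<le> ?F x"
  proof
    fix x assume "x \<in> cone I"
    then obtain a where a: "\<forall>j\<in>{1..n+1}. a j \<ge> 0" "\<forall>j\<in>{1..n+1} - I. a j = 0"
      "\<forall>i\<in>{1..n}. x i = (\<Sum>j=1..n+1. a j * u j i)" using cone_iff[OF I] by blast
    show "0 \<le> ?F x" unfolding functional_on_cone[OF a(3)]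
      using nonneg[OF a(1,2)] by (intro sum_nonneg) blast
  qed
  show "{x \<in> cone I. ?F x = 0} = cone {j \<in> I. ?F (u j) = 0}" (is "_ = cone ?J")
  proof (intro equalityI subsetI)
    fix x assume x: "x \<in> {x \<in> cone I. ?F x = 0}"
    then obtain a where a: "\<forall>j\<in>{1..n+1}. a j \<ge> 0" "\<forall>j\<in>{1..n+1} - I. a j = 0"
      "\<forall>i\<in>{1..n}. x i = (\<Sum>j=1..n+1. a j * u j i)" and xQ: "x \<in> Qspace n" using cone_iff[OF I] by blast
    have "(\<Sum>j=1..n+1. a j * ?F (u j)) = 0" using x functional_on_cone[OF a(3), of f] by (simp only: mem_Collect_eq)
    then have "\<forall>j\<in>{1..n+1}. a j * ?F (u j) = 0"
      using nonneg[OF a(1,2)] sum_nonneg_eq_0_iff[of "{1..n+1}" "\<lambda>j. a j * ?F (u j)"] by blast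
    then have "\<forall>j\<in>{1..n+1} - ?J. a j = 0" using a(2) by auto
    then show "x \<in> cone ?J" using a xQ I by (subst cone_iff) auto
  next
    fix x assume x: "x \<in> cone ?J"
    have J: "?J \<subseteq> {1..n+1}" using I by blast
    obtain a where a: "\<forall>j\<in>{1..n+1}. a j \<ge> 0" "\<forall>j\<in>{1..n+1} - ?J. a j = 0"
      "\<forall>i\<in>{1..n}. x i = (\<Sum>j=1..n+1. a j * u j i)" and xQ: "x \<in> Qspace n"
      using x cone_iff[OF J] by blast
    have "(\<Sum>j=1..n+1. a j * ?F (u j)) = 0" 
    proof (intro sum.neutral ballI)
      fix j assume "j \<in> {1..n+1}"
      then show "a j * ?F (u j) = 0" using a(2) by (cases "j \<in> ?J") auto
    qed
    then have "?F x = 0" using functional_on_cone[OF a(3), of f] by (simp only:)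
    moreover have "x \<in> cone I" using a xQ I by (auto simp: cone_iff)
    ultimately show "x \<in> {x \<in> cone I. ?F x = 0}" by blast
  qed
qed

lemma cone_face_cone:
  assumes "cone_face n \<tau> (cone I)" "I \<subseteq> {1..n+1}"
  obtains J where "J \<subseteq> I" "\<tau> = cone J"
proof -
  obtain f where f: "\<forall>x\<in>cone I. 0 \<le> (\<Sum>i=1..n. f i * x i)"
    and \<tau>: "\<tau> = {x \<in> cone I. (\<Sum>i=1..n. f i * x i) = 0}"
    using assms(1) unfolding cone_face_def by blast
  have "\<forall>j\<in>I. 0 \<le> (\<Sum>i=1..n. f i * u j i)"
    by (intro ballI bspec[OF f] u_in_cone[OF _ assms(2)])
  from cone_face_by_functional(2)[OF assms(2) this]
  have "\<tau> = cone {j \<in> I. (\<Sum>i=1..n. f i * u j i) = 0}" by (simp only: \<tau>)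
  then show ?thesis by (rule that[rotated]) simp
qed

text \<open>The supporting functional takes the value 1 on the generators outside the face; the value
  at a generator outside the ambient cone compensates for this in the relation.\<close>

lemma cone_face_subset:
  assumes "J \<subseteq> I" "I \<subset> {1..n+1}"
  shows "cone_face n (cone J) (cone I)"
proof -
  obtain p where p: "p \<in> {1..n+1}" "p \<notin> I" using assms(2) by blast
  define a where "a j = (if j \<in> I - J then 1 else 0) - (if j = p then (\<Sum>j\<in>I - J. v j) / v p else 0)" for j
  have "(\<Sum>j=1..n+1. (if j \<in> I - J then 1 else 0) * v j) = (\<Sum>j\<in>I - J. v j)"
  proof -
    have "(\<Sum>j=1..n+1. (if j \<in> I - J then 1 else 0) * v j) = (\<Sum>j\<in>{1..n+1}. if j \<in> I - J then v j else 0)"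
      by (intro sum.cong) auto
    also have "\<dots> = (\<Sum>j\<in>{1..n+1} \<inter> (I - J). v j)" by (simp only: sum.inter_restrict finite_atLeastAtMost)
    also have "{1..n+1} \<inter> (I - J) = I - J" using assms(2) by blast
    finally show ?thesis .
  qed
  moreover have "(\<Sum>j=1..n+1. (if j = p then (\<Sum>j\<in>I - J. v j) / v p else 0) * v j) = (\<Sum>j\<in>I - J. v j)"
    using p v_pos[OF p(1)] by (simp add: if_distrib[of "\<lambda>x. x * _"] cong: if_cong)
  ultimately have "(\<Sum>j=1..n+1. a j * v j) = 0"
    unfolding a_def left_diff_distrib sum_subtractf by simp
  then obtain f where f: "\<forall>j\<in>{1..n+1}. (\<Sum>i=1..n. f i * u j i) = a j" using functional by blast
  have aI: "a j = (if j \<in> J then 0 else 1)" if "j \<in> I" for j using that p by (auto simp: a_def)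
  have fI: "(\<Sum>i=1..n. f i * u j i) = (if j \<in> J then 0 else 1)" if "j \<in> I" for j
    using bspec[OF f, of j] that assms(2) aI[OF that] by auto
  have I: "I \<subseteq> {1..n+1}" using assms(2) by blast
  have fpos: "\<forall>j\<in>I. 0 \<le> (\<Sum>i=1..n. f i * u j i)" using fI by simp
  have "(\<Sum>i=1..n. f i * u j i) = 0 \<longleftrightarrow> j \<in> J" if "j \<in> I" for j
    using fI[OF that] by simp
  then have "{j \<in> I. (\<Sum>i=1..n. f i * u j i) = 0} = J" using assms(1) by blast
  then have "cone J = {x \<in> cone I. (\<Sum>i=1..n. f i * x i) = 0}"
    using cone_face_by_functional(2)[OF I fpos] by (simp only:)
  with cone_face_by_functional(1)[OF I fpos] show ?thesis
    unfolding cone_face_def by (intro exI[of _ f] conjI)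
qed

section \<open>The fan and its rays\<close>

definition fan :: "(nat \<Rightarrow> rat) set set" where
  "fan = {\<tau>. \<exists>I \<subseteq> {1..n+1}. card I = n \<and> cone_face n \<tau> (cone_hull n (u ` I))}"

text \<open>A proper subset of the columns omits some column and so lies in the index set of a
  maximal cone; the faces of that cone correspond to subsets of its generators.\<close>

lemma fan_eq: "fan = cone ` {J. J \<subset> {1..n+1}}"
proof (intro equalityI subsetI)
  fix \<tau> assume "\<tau> \<in> fan"
  then obtain I where I: "I \<subseteq> {1..n+1}" "card I = n" "cone_face n \<tau> (cone I)"
    unfolding fan_def cone_def by blast
  then obtain J where J: "J \<subseteq> I" "\<tau> = cone J" using cone_face_cone by blast
  have "I \<noteq> {1..n+1}" using I(2) by (metis Suc_eq_plus1 card_atLeastAtMost diff_Suc_1 n_not_Suc_n)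
  then show "\<tau> \<in> cone ` {J. J \<subset> {1..n+1}}" using I J by blast
next
  fix \<tau> assume "\<tau> \<in> cone ` {J. J \<subset> {1..n+1}}"
  then obtain J where J: "J \<subset> {1..n+1}" "\<tau> = cone J" by blast
  then obtain p where p: "p \<in> {1..n+1}" "p \<notin> J" by blast
  let ?I = "{1..n+1} - {p}"
  have "cone_face n \<tau> (cone ?I)" unfolding J(2) by (rule cone_face_subset) (use J p in auto)
  moreover have "card ?I = n" using p by (simp del: atLeastAtMost_iff)
  ultimately show "\<tau> \<in> fan" unfolding fan_def cone_def by blast
qed

text \<open>With \<open>n\<close> at least 1 there are two columns or more, so a ray is indexed by a
  proper subset and the results on intersections apply to it.\<close>

lemma singleton_psubset:
  assumes "j \<in> {1..n+1}"
  shows "{j} \<subset> {1..n+1}"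
proof -
  have "card {j} \<noteq> card {1..n+1}" using n_pos by simp
  then have "{j} \<noteq> {1..n+1}" by (rule contrapos_nn) (rule arg_cong)
  then show ?thesis using assms by blast
qed

text \<open>A zero column would give a relation supported at one index, while a relation with one
  zero entry is zero everywhere.\<close>

lemma u_nonzero:
  assumes j: "j \<in> {1..n+1}"
  shows "\<exists>i\<in>{1..n}. u j i \<noteq> 0"
proof (rule ccontr)
  assume "\<not> ?thesis"
  then have r: "\<forall>i\<in>{1..n}. (\<Sum>k=1..n+1. (if k = j then 1 else 0) * u k i) = 0"
    using j by (simp add: if_distrib[of "\<lambda>x. x * _"] cong: if_cong)
  obtain q where q: "q \<in> {1..n+1}" "q \<noteq> j" using singleton_psubset[OF j] by blast
  show False using relation_zero[OF r q(1) _ j] q(2) by simp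
qed

lemma lin_indep_u:
  assumes J: "J \<subset> {1..n+1}"
  shows "lin_indep n (u ` J)"
  unfolding lin_indep_def
proof (intro allI impI ballI)
  fix a w assume a: "\<forall>i\<in>{1..n}. (\<Sum>w\<in>u ` J. a w * w i) = 0" and w: "w \<in> u ` J"
  have inj: "inj_on u J" using inj_u J by (blast intro: inj_on_subset)
  let ?r = "\<lambda>j. if j \<in> J then a (u j) else 0"
  have "(\<Sum>j=1..n+1. ?r j * u j i) = (\<Sum>w\<in>u ` J. a w * w i)" for i
  proof -
    have "(\<Sum>j=1..n+1. ?r j * u j i) = (\<Sum>j\<in>J. ?r j * u j i)"
      using J by (intro sum.mono_neutral_right) auto
    also have "\<dots> = (\<Sum>j\<in>J. a (u j) * u j i)" by simp
    finally show ?thesis using inj by (simp add: sum.reindex)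
  qed
  then have r: "\<forall>i\<in>{1..n}. (\<Sum>j=1..n+1. ?r j * u j i) = 0" using a by simp
  obtain p where p: "p \<in> {1..n+1}" "p \<notin> J" using J by blast
  obtain j where j: "j \<in> J" "w = u j" using w by blast
  show "a w = 0" using relation_zero[OF r p(1), of j] p(2) j J by auto
qed

text \<open>If \<open>j\<close> is outside \<open>J\<close>, the two cones meet in the zero cone,
  but \<open>u j\<close> is nonzero. This turns the containments that define the ideal of the fan
  into membership of indices.\<close>

lemma cone_subset_iff:
  assumes j: "j \<in> {1..n+1}" and J: "J \<subset> {1..n+1}"
  shows "cone {j} \<subseteq> cone J \<longleftrightarrow> j \<in> J"
proof
  assume sub: "cone {j} \<subseteq> cone J"
  show "j \<in> J"
  proof (rule ccontr)
    assume nj: "j \<notin> J"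
    have "u j \<in> cone ({j} \<inter> J)" using cone_Int[OF singleton_psubset[OF j] J] sub u_in_cone[of j "{j}"] j by blast
    then have "u j \<in> cone {}" using nj by simp
    then show False using u_nonzero[OF j] by (auto simp: cone_def cone_hull_def)
  qed
next
  assume "j \<in> J"
  then have "{j} \<inter> J = {j}" by blast
  then show "cone {j} \<subseteq> cone J" using cone_Int[OF singleton_psubset[OF j] J] by auto
qed

lemma simplicial_fan: "simplicial_fan n fan"
  unfolding simplicial_fan_def
proof (intro conjI ballI allI impI)
  have "{J. J \<subset> {1..n+1}} \<subseteq> Pow {1..n+1}" by blast
  then show "finite fan" unfolding fan_eq by (meson finite_Pow_iff finite_atLeastAtMost finite_imageI finite_subset)
  show "fan \<noteq> {}" unfolding fan_eq by auto
next
  fix \<sigma> assume "\<sigma> \<in> fan"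
  then obtain J where J: "J \<subset> {1..n+1}" "\<sigma> = cone J" unfolding fan_eq by blast
  then have "finite J" by (meson finite_atLeastAtMost finite_subset psubset_imp_subset)
  then show "\<exists>S. finite S \<and> S \<subseteq> Qspace n \<and> lin_indep n S \<and> \<sigma> = cone_hull n S"
    using lin_indep_u[OF J(1)] J(2) u_in by (intro exI[of _ "u ` J"]) (auto simp: cone_def)
next
  fix \<sigma> \<tau> assume "\<sigma> \<in> fan" and \<tau>: "cone_face n \<tau> \<sigma>"
  then obtain J where J: "J \<subset> {1..n+1}" "\<sigma> = cone J" unfolding fan_eq by blast
  then obtain I where "I \<subseteq> J" "\<tau> = cone I" using \<tau> cone_face_cone by blast
  then show "\<tau> \<in> fan" unfolding fan_eq using J by blast
next
  fix \<sigma> \<tau> assume "\<sigma> \<in> fan" "\<tau> \<in> fan"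
  then obtain I J where IJ: "I \<subset> {1..n+1}" "J \<subset> {1..n+1}" "\<sigma> = cone I" "\<tau> = cone J"
    unfolding fan_eq by blast
  show "cone_face n (\<sigma> \<inter> \<tau>) \<sigma>" "cone_face n (\<sigma> \<inter> \<tau>) \<tau>"
    unfolding IJ(3,4) cone_Int[OF IJ(1,2)] using IJ cone_face_subset by auto
qed

text \<open>A fan cone that is a half-line has exactly one generator: its generators are positive
  multiples of the spanning vector, and two of them would satisfy a relation with coefficients of
  opposite signs.\<close>

lemma fan_rays_eq: "fan_rays n fan = (\<lambda>j. cone {j}) ` {1..n+1}"
proof (intro equalityI subsetI)
  fix \<rho> assume "\<rho> \<in> fan_rays n fan"
  then obtain x where "\<rho> \<in> fan" and x: "x \<in> Qspace n" "\<exists>i\<in>{1..n}. x i \<noteq> 0" "\<rho> = cone_hull n {x}"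
    unfolding fan_rays_def by blast
  then obtain J where J: "J \<subset> {1..n+1}" "\<rho> = cone J" unfolding fan_eq by blast
  have "x \<in> cone J" unfolding J(2)[symmetric] x(3)
    using x(1) by (auto simp: cone_hull_def intro: exI[of _ "\<lambda>_. 1"])
  then have "J \<noteq> {}" using x(2) by (auto simp: cone_def cone_hull_def)
  then obtain j where j: "j \<in> J" by blast
  have multiple: "\<exists>a>0. \<forall>i\<in>{1..n}. u k i = a * x i" if "k \<in> J" for k
  proof -
    have k: "k \<in> {1..n+1}" using that J by blast
    have "u k \<in> cone_hull n {x}" using u_in_cone[of k J] that J x(3) by blast
    then obtain a where "a \<ge> 0" and a: "\<forall>i\<in>{1..n}. u k i = a * x i"
      by (auto simp: cone_hull_def)
    moreover have "a \<noteq> 0" using a u_nonzero[OF k] by auto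
    ultimately show ?thesis by (intro exI[of _ a]) simp
  qed
  have "k = j" if k: "k \<in> J" for k
  proof (rule ccontr)
    assume ne: "k \<noteq> j"
    obtain a b where a: "a > 0" "\<forall>i\<in>{1..n}. u k i = a * x i" and b: "b > 0" "\<forall>i\<in>{1..n}. u j i = b * x i"
      using multiple k j by meson
    \<comment> \<open>This is a relation because \<open>b\<close> times \<open>u k\<close> and
      \<open>a\<close> times \<open>u j\<close> both equal \<open>a * b\<close> times
      \<open>x\<close>.\<close>
    let ?r = "\<lambda>i. (if i = k then b else 0) - (if i = j then a else 0)"
    have jk: "j \<in> {1..n+1}" "k \<in> {1..n+1}" using J j k by auto
    have r: "\<forall>i\<in>{1..n}. (\<Sum>l=1..n+1. ?r l * u l i) = 0"
      using jk a(2) b(2) by (simp add: left_diff_distrib sum_subtractf if_distrib[of "\<lambda>x. x * _"]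
        cong: if_cong)
    have "b * v j = - (a * v k)" using relation_unique[OF r jk(2,1)] ne by simp
    moreover have "0 < b * v j" "0 < a * v k" using a(1) b(1) v_pos jk by simp_all
    ultimately show False by linarith
  qed
  then have "J = {j}" using j by blast
  then show "\<rho> \<in> (\<lambda>j. cone {j}) ` {1..n+1}" using J by blast
next
  fix \<rho> assume "\<rho> \<in> (\<lambda>j. cone {j}) ` {1..n+1}"
  then obtain j where j: "j \<in> {1..n+1}" "\<rho> = cone {j}" by blast
  have "\<rho> \<in> fan" unfolding fan_eq j(2) using singleton_psubset[OF j(1)] by blast
  moreover have "\<rho> = cone_hull n {u j}" by (simp add: j(2) cone_def)
  ultimately show "\<rho> \<in> fan_rays n fan" unfolding fan_rays_def
    using u_nonzero[OF j(1)] u_in[of j] by blast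
qed

lemma bij_betw_rays: "bij_betw (\<lambda>j. cone {j}) {1..n+1} (fan_rays n fan)"
  unfolding bij_betw_def fan_rays_eq
proof
  show "inj_on (\<lambda>j. cone {j}) {1..n+1}"
    using cone_subset_iff singleton_psubset by (intro inj_onI) (metis order_refl singletonD)
qed simp

text \<open>In terms of the ideal of the fan: none of its monomials is an empty product.\<close>

lemma fan_misses_ray:
  assumes "\<sigma> \<in> fan"
  obtains j where "j \<in> {1..n+1}" "\<not> cone {j} \<subseteq> \<sigma>"
proof -
  obtain J where J: "J \<subset> {1..n+1}" "\<sigma> = cone J" using assms unfolding fan_eq by blast
  then show ?thesis using that cone_subset_iff by blast
qed

text \<open>The cone on all columns but \<open>j\<close> contributes the variable of index
  \<open>j\<close> itself to the ideal; together with the previous lemma this makes the zero locus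
  the origin.\<close>

lemma fan_misses_only_ray:
  assumes "j \<in> {1..n+1}"
  obtains \<sigma> where "\<sigma> \<in> fan" "{i \<in> {1..n+1}. \<not> cone {i} \<subseteq> \<sigma>} = {j}"
proof -
  let ?J = "{1..n+1} - {j}"
  have J: "?J \<subset> {1..n+1}" using assms by blast
  have "{i \<in> {1..n+1}. \<not> cone {i} \<subseteq> cone ?J} = {j}" using cone_subset_iff[OF _ J] assms by blast
  then show ?thesis using that J unfolding fan_eq by blast
qed

end


section \<open>Quotient stacks along an isomorphism of group functors\<close>

text \<open>Naturality is demanded of \<gamma> only, since that of its inverse follows. That
  \<open>pt_map\<close> lands in the carrier is part of the condition because the record of a group
  functor carries no axioms.\<close>

definition group_functor_iso ::
  "('u, 'g) group_functor \<Rightarrow> ('u, 'h) group_functor \<Rightarrow> ('u calg \<Rightarrow> 'g \<Rightarrow> 'h) \<Rightarrow> ('u calg \<Rightarrow> 'h \<Rightarrow> 'g) \<Rightarrow> bool" where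
  "group_functor_iso G G' \<gamma> \<delta> \<longleftrightarrow>
     (\<forall>A. is_calg A \<longrightarrow> group (pt_group G A) \<and> group (pt_group G' A) \<and>
        \<gamma> A \<in> hom (pt_group G A) (pt_group G' A) \<and> \<delta> A \<in> hom (pt_group G' A) (pt_group G A) \<and>
        (\<forall>g\<in>carrier (pt_group G A). \<delta> A (\<gamma> A g) = g) \<and>
        (\<forall>h\<in>carrier (pt_group G' A). \<gamma> A (\<delta> A h) = h)) \<and>
     (\<forall>A B f. is_calg A \<longrightarrow> is_calg B \<longrightarrow> f \<in> calg_hom A B \<longrightarrow>
        (\<forall>g\<in>carrier (pt_group G A). pt_map G A B f g \<in> carrier (pt_group G B) \<and>
           \<gamma> B (pt_map G A B f g) = pt_map G' A B f (\<gamma> A g)))"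

definition compatible_actions ::
  "('u, 'g) group_functor \<Rightarrow> ('u calg \<Rightarrow> 'g \<Rightarrow> 'h) \<Rightarrow> ('u, 'g, 'p) gpsh \<Rightarrow> ('u, 'h, 'p) gpsh \<Rightarrow> bool" where
  "compatible_actions G \<gamma> X X' \<longleftrightarrow>
     (\<forall>A. is_calg A \<longrightarrow> sec X A = sec X' A \<and>
        (\<forall>g\<in>carrier (pt_group G A). \<forall>x\<in>sec X A. act X A g x = act X' A (\<gamma> A g) x)) \<and>
     (\<forall>A B f. is_calg A \<longrightarrow> is_calg B \<longrightarrow> f \<in> calg_hom A B \<longrightarrow>
        (\<forall>x\<in>sec X A. res X A B f x = res X' A B f x))"

lemma group_functor_isoD:
  assumes "group_functor_iso G G' \<gamma> \<delta>" "is_calg A"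
  shows "group (pt_group G A)" "group (pt_group G' A)"
    "\<gamma> A \<in> hom (pt_group G A) (pt_group G' A)" "\<delta> A \<in> hom (pt_group G' A) (pt_group G A)"
    "g \<in> carrier (pt_group G A) \<Longrightarrow> \<delta> A (\<gamma> A g) = g"
    "h \<in> carrier (pt_group G' A) \<Longrightarrow> \<gamma> A (\<delta> A h) = h"
    "g \<in> carrier (pt_group G A) \<Longrightarrow> \<gamma> A g \<in> carrier (pt_group G' A)"
    "h \<in> carrier (pt_group G' A) \<Longrightarrow> \<delta> A h \<in> carrier (pt_group G A)"
proof -
  show *: "group (pt_group G A)" "group (pt_group G' A)"
    "\<gamma> A \<in> hom (pt_group G A) (pt_group G' A)" "\<delta> A \<in> hom (pt_group G' A) (pt_group G A)"
    "g \<in> carrier (pt_group G A) \<Longrightarrow> \<delta> A (\<gamma> A g) = g"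
    "h \<in> carrier (pt_group G' A) \<Longrightarrow> \<gamma> A (\<delta> A h) = h"
    using assms(1)[unfolded group_functor_iso_def, THEN conjunct1, rule_format, OF assms(2)] by simp_all
  show "g \<in> carrier (pt_group G A) \<Longrightarrow> \<gamma> A g \<in> carrier (pt_group G' A)"
    "h \<in> carrier (pt_group G' A) \<Longrightarrow> \<delta> A h \<in> carrier (pt_group G A)"
    using hom_in_carrier[OF *(3)] hom_in_carrier[OF *(4)] by blast+
qed

lemma group_functor_iso_natural:
  assumes iso: "group_functor_iso G G' \<gamma> \<delta>" and A: "is_calg A" and B: "is_calg B" and f: "f \<in> calg_hom A B"
    and h: "h \<in> carrier (pt_group G' A)"
  shows "\<delta> B (pt_map G' A B f h) = pt_map G A B f (\<delta> A h)" "pt_map G' A B f h \<in> carrier (pt_group G' B)"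
proof -
  note A = group_functor_isoD[OF iso A] and B = group_functor_isoD[OF iso B]
  have 1: "pt_map G A B f (\<delta> A h) \<in> carrier (pt_group G B)"
    and 2: "\<gamma> B (pt_map G A B f (\<delta> A h)) = pt_map G' A B f h"
    using iso[unfolded group_functor_iso_def, THEN conjunct2, rule_format, OF assms(2-4) A(8)[OF h]] A(6)[OF h]
    by simp_all
  show "\<delta> B (pt_map G' A B f h) = pt_map G A B f (\<delta> A h)" "pt_map G' A B f h \<in> carrier (pt_group G' B)"
    using B(5,7)[OF 1] 2 by simp_all
qed

lemma group_functor_iso_sym:
  assumes iso: "group_functor_iso G G' \<gamma> \<delta>"
  shows "group_functor_iso G' G \<delta> \<gamma>"
  unfolding group_functor_iso_def
  by (simp add: group_functor_iso_natural[OF iso] group_functor_isoD[OF iso])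

lemma compatible_actions_sym:
  assumes iso: "group_functor_iso G G' \<gamma> \<delta>" and X: "compatible_actions G \<gamma> X X'"
  shows "compatible_actions G' \<delta> X' X"
  unfolding compatible_actions_def
proof (intro conjI allI impI ballI)
  fix A h x assume A: "is_calg A" and h: "h \<in> carrier (pt_group G' A)" and x: "x \<in> sec X' A"
  then have "x \<in> sec X A" using X unfolding compatible_actions_def by blast
  then have "act X A (\<delta> A h) x = act X' A (\<gamma> A (\<delta> A h)) x"
    using X A group_functor_isoD(8)[OF iso A h] unfolding compatible_actions_def by blast
  then show "act X' A h x = act X A (\<delta> A h) x" using group_functor_isoD(6)[OF iso A h] by simp
qed (use X in \<open>auto simp: compatible_actions_def\<close>)

section \<open>Transport of torsors along an isomorphism of group functors\<close>

definition pullback_action :: "('u calg \<Rightarrow> 'h \<Rightarrow> 'g) \<Rightarrow> ('u, 'g, 'p) gpsh \<Rightarrow> ('u, 'h, 'p) gpsh" where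
  "pullback_action \<delta> P = \<lparr>sec = sec P, res = res P, act = (\<lambda>A h. act P A (\<delta> A h))\<rparr>"

lemma pullback_action_simps [simp]:
  "sec (pullback_action \<delta> P) = sec P" "res (pullback_action \<delta> P) = res P"
  "act (pullback_action \<delta> P) A h = act P A (\<delta> A h)"
  by (simp_all add: pullback_action_def)

definition pullback_obj ::
  "('u calg \<Rightarrow> 'h \<Rightarrow> 'g) \<Rightarrow> ('u, 'g, 'x) qobj \<Rightarrow> ('u, 'h, 'x) qobj" where
  "pullback_obj \<delta> E = \<lparr>base = base E, tors = pullback_action \<delta> (tors E), proj = proj E, equi = equi E\<rparr>"

lemma pullback_obj_simps [simp]:
  "base (pullback_obj \<delta> E) = base E" "tors (pullback_obj \<delta> E) = pullback_action \<delta> (tors E)"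
  "proj (pullback_obj \<delta> E) = proj E" "equi (pullback_obj \<delta> E) = equi E"
  by (simp_all add: pullback_obj_def)

lemma is_psh_cong: "sec P = sec Q \<Longrightarrow> res P = res Q \<Longrightarrow> is_psh P = is_psh Q"
  by (simp add: is_psh_def)

lemma is_etale_sheaf_cong: "sec P = sec Q \<Longrightarrow> res P = res Q \<Longrightarrow> is_etale_sheaf P = is_etale_sheaf Q"
  by (simp add: is_etale_sheaf_def is_psh_cong[of P Q])

text \<open>Presheaves are total functions, so two of them may coincide on algebras and differ
  elsewhere; morphisms see only the values on algebras.\<close>

lemma psh_hom_cong:
  assumes "\<And>A. is_calg A \<Longrightarrow> sec P A = sec P' A" "\<And>A. is_calg A \<Longrightarrow> sec Q A = sec Q' A"
    "\<And>A B f x. is_calg A \<Longrightarrow> is_calg B \<Longrightarrow> f \<in> calg_hom A B \<Longrightarrow> x \<in> sec P A \<Longrightarrow> res P A B f x = res P' A B f x"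
    "\<And>A B f x. is_calg A \<Longrightarrow> is_calg B \<Longrightarrow> f \<in> calg_hom A B \<Longrightarrow> x \<in> sec Q A \<Longrightarrow> res Q A B f x = res Q' A B f x"
  shows "psh_hom P Q = psh_hom P' Q'"
proof -
  \<comment> \<open>The restrictions of \<open>Q\<close> and \<open>Q'\<close> agree on sections
    only, so the two naturality conditions can be compared once \<eta> is known to map sections to
    sections.\<close>
  have nat: "(\<forall>A B f. is_calg A \<longrightarrow> is_calg B \<longrightarrow> f \<in> calg_hom A B \<longrightarrow>
        (\<forall>x\<in>sec P A. \<eta> B (res P A B f x) = res Q A B f (\<eta> A x))) \<longleftrightarrow>
      (\<forall>A B f. is_calg A \<longrightarrow> is_calg B \<longrightarrow> f \<in> calg_hom A B \<longrightarrow>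
        (\<forall>x\<in>sec P' A. \<eta> B (res P' A B f x) = res Q' A B f (\<eta> A x)))"
    if \<eta>: "\<And>A. is_calg A \<Longrightarrow> \<eta> A \<in> sec P A \<rightarrow>\<^sub>E sec Q A" for \<eta>
  proof -
    have "\<eta> A x \<in> sec Q A" if "is_calg A" "x \<in> sec P A" for A x
      using \<eta>[OF that(1)] that(2) by (rule PiE_mem)
    then have "\<eta> B (res P A B f x) = res Q A B f (\<eta> A x) \<longleftrightarrow> \<eta> B (res P' A B f x) = res Q' A B f (\<eta> A x)"
      if "is_calg A" "is_calg B" "f \<in> calg_hom A B" "x \<in> sec P A" for A B f x
      using assms(3)[OF that] assms(4)[OF that(1-3)] that by simp
    then show ?thesis by (simp add: assms(1) cong: ball_cong)
  qed
  have maps: "(\<forall>A. is_calg A \<longrightarrow> \<eta> A \<in> sec P A \<rightarrow>\<^sub>E sec Q A) \<longleftrightarrow>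
      (\<forall>A. is_calg A \<longrightarrow> \<eta> A \<in> sec P' A \<rightarrow>\<^sub>E sec Q' A)" for \<eta>
    using assms(1,2) by simp
  show ?thesis unfolding psh_hom_def
  proof (intro Collect_cong conj_cong refl maps nat)
    fix \<eta> and A :: "'a calg" assume "\<forall>A. is_calg A \<longrightarrow> \<eta> A \<in> sec P' A \<rightarrow>\<^sub>E sec Q' A" "is_calg A"
    then show "\<eta> A \<in> sec P A \<rightarrow>\<^sub>E sec Q A" by (simp add: assms(1,2))
  qed
qed

lemma group_action_pullback:
  assumes "group_action H E \<phi>" "group K" "h \<in> hom K H"
  shows "group_action K E (\<lambda>g. \<phi> (h g))"
proof -
  interpret group_action H E \<phi> by fact
  have "(\<lambda>g. \<phi> (h g)) \<in> hom K (BijGroup E)"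
    using hom_compose[OF assms(3) group_hom.homh[OF group_hom]] by (simp add: comp_def)
  then show ?thesis
    using assms(2) by (simp add: group_action_def group_hom_def group_hom_axioms_def group_BijGroup)
qed

lemma torsor_ex1:
  assumes "torsor G R P \<pi>" "is_calg A" "x \<in> sec P A" "y \<in> sec P A" "\<pi> A x = \<pi> A y"
  shows "\<exists>!g. g \<in> carrier (pt_group G A) \<and> act P A g x = y"
proof -
  have "\<forall>A. is_calg A \<longrightarrow> (\<forall>x\<in>sec P A. \<forall>y\<in>sec P A. \<pi> A x = \<pi> A y \<longrightarrow>
        (\<exists>!g. g \<in> carrier (pt_group G A) \<and> act P A g x = y))"
    using assms(1) unfolding torsor_def by (elim conjE)
  from this[rule_format, OF assms(2-5)] show ?thesis .
qed

lemma torsor_proj_act: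
  assumes "torsor G R P \<pi>" "is_calg A" "g \<in> carrier (pt_group G A)" "x \<in> sec P A"
  shows "\<pi> A (act P A g x) = \<pi> A x"
proof -
  have "\<forall>A. is_calg A \<longrightarrow> (\<forall>g\<in>carrier (pt_group G A). \<forall>x\<in>sec P A. \<pi> A (act P A g x) = \<pi> A x)"
    using assms(1) unfolding torsor_def by (elim conjE)
  from this[rule_format, OF assms(2-4)] show ?thesis .
qed

text \<open>The sheaf condition and local sections do not involve the group. The action axioms pass
  along the homomorphism \<delta>, compatibility with restriction uses its naturality, and simple
  transitivity its bijectivity.\<close>

lemma torsor_pullback:
  assumes iso: "group_functor_iso G G' \<gamma> \<delta>" and T: "torsor G R P \<pi>"
  shows "torsor G' R (pullback_action \<delta> P) \<pi>"
proof -
  let ?P = "pullback_action \<delta> P"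
  note D = group_functor_isoD[OF iso]
  have gpsh: "is_gpsh G P" using T by (simp add: torsor_def)
  have "is_gpsh G' ?P"
    unfolding is_gpsh_def
  proof (intro conjI allI impI ballI)
    show "is_psh ?P" using gpsh is_psh_cong[of P ?P] by (simp add: is_gpsh_def)
  next
    fix A :: "'a calg" assume A: "is_calg A"
    show "group_action (pt_group G' A) (sec ?P A) (act ?P A)"
      using group_action_pullback[OF _ D(2)[OF A] D(4)[OF A], of "sec P A" "act P A"] gpsh A
      by (simp add: is_gpsh_def pullback_action_def)
  next
    fix A B :: "'a calg" and f g x
    assume *: "is_calg A" "is_calg B" "f \<in> calg_hom A B" "g \<in> carrier (pt_group G' A)" "x \<in> sec ?P A"
    then show "res ?P A B f (act ?P A g x) = act ?P B (pt_map G' A B f g) (res ?P A B f x)"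
      using gpsh[unfolded is_gpsh_def, THEN conjunct2, THEN conjunct2, rule_format, OF *(1-3) D(8)[OF *(1,4)]]
      by (simp add: group_functor_iso_natural(1)[OF iso *(1-4)])
  qed
  moreover have "is_etale_sheaf ?P" using T is_etale_sheaf_cong[of P ?P] by (simp add: torsor_def)
  moreover have "\<pi> \<in> psh_hom ?P (spec R)"
    using T psh_hom_cong[of P ?P "spec R" "spec R"] by (simp add: torsor_def)
  moreover have "\<exists>!g. g \<in> carrier (pt_group G' A) \<and> act P A (\<delta> A g) x = y"
    if A: "is_calg A" and xy: "x \<in> sec P A" "y \<in> sec P A" "\<pi> A x = \<pi> A y" for A x y
  proof -
    have ex1: "\<exists>!g. g \<in> carrier (pt_group G A) \<and> act P A g x = y"
      by (rule torsor_ex1[OF T A xy])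
    then obtain g where g: "g \<in> carrier (pt_group G A)" "act P A g x = y" by blast
    show ?thesis
    proof (intro ex1I[of _ "\<gamma> A g"] conjI)
      show "\<gamma> A g \<in> carrier (pt_group G' A)" "act P A (\<delta> A (\<gamma> A g)) x = y"
        using D(5,7)[OF A g(1)] g(2) by simp_all
      fix h assume h: "h \<in> carrier (pt_group G' A) \<and> act P A (\<delta> A h) x = y"
      then have "\<delta> A h = g" using D(8)[OF A, of h] g by (intro Uniq_D[OF ex1_iff_ex_Uniq[THEN iffD1, OF ex1, THEN conjunct2]]) simp_all
      then show "h = \<gamma> A g" using h D(6)[OF A, of h] by simp
    qed
  qed
  moreover have "\<pi> A (act P A (\<delta> A g) x) = \<pi> A x"
    if "is_calg A" "g \<in> carrier (pt_group G' A)" "x \<in> sec P A" for A g x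
    by (rule torsor_proj_act[OF T that(1) D(8)[OF that(1,2)] that(3)])
  moreover have "\<exists>C. etale_cover R C \<and> (\<forall>(S, f)\<in>C. \<exists>x\<in>sec P S. \<pi> S x = f)"
    using T unfolding torsor_def by (elim conjE)
  ultimately show ?thesis
    unfolding torsor_def pullback_action_simps by (intro conjI allI impI ballI) simp_all
qed

lemma pullback_obj_Ob:
  assumes iso: "group_functor_iso G G' \<gamma> \<delta>" and X: "compatible_actions G \<gamma> X X'"
    and E: "E \<in> Ob (quotient_stack G X)"
  shows "pullback_obj \<delta> E \<in> Ob (quotient_stack G' X')"
proof -
  note D = group_functor_isoD[OF iso]
  have E: "is_calg (base E)" "torsor G (base E) (tors E) (proj E)"
    "equi E \<in> psh_hom (tors E) X" "equivariant G (tors E) X (equi E)"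
    using E by (simp_all add: quotient_stack_def)
  have "psh_hom (tors E) X = psh_hom (pullback_action \<delta> (tors E)) X'"
    using X by (intro psh_hom_cong) (auto simp: compatible_actions_def)
  moreover have "equivariant G' (pullback_action \<delta> (tors E)) X' (equi E)"
    unfolding equivariant_def pullback_action_simps
  proof (intro allI impI ballI)
    fix A :: "'a calg" and h x assume A: "is_calg A" and h: "h \<in> carrier (pt_group G' A)" and x: "x \<in> sec (tors E) A"
    have "equi E A x \<in> sec X A" using E(3) A x by (auto simp: psh_hom_def)
    then have "act X A (\<delta> A h) (equi E A x) = act X' A h (equi E A x)"
      using X A D(8)[OF A h] D(6)[OF A h] by (simp add: compatible_actions_def)
    then show "equi E A (act (tors E) A (\<delta> A h) x) = act X' A h (equi E A x)"
      using E(4) A x D(8)[OF A h] by (simp add: equivariant_def)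
  qed
  ultimately show ?thesis using E torsor_pullback[OF iso E(2)] by (simp add: quotient_stack_def)
qed

text \<open>An arrow is a pair of functions that records neither its endpoints nor the group, so the
  same pair serves after the change of group.\<close>

lemma pullback_obj_Arr:
  assumes iso: "group_functor_iso G G' \<gamma> \<delta>" and u: "u \<in> Arr (quotient_stack G X) E E'"
  shows "u \<in> Arr (quotient_stack G' X') (pullback_obj \<delta> E) (pullback_obj \<delta> E')"
proof -
  have "psh_hom (tors E) (tors E') = psh_hom (pullback_action \<delta> (tors E)) (pullback_action \<delta> (tors E'))"
    by (intro psh_hom_cong) simp_all
  then show ?thesis using u group_functor_isoD(8)[OF iso]
    by (auto simp: quotient_stack_def equivariant_def)
qed

lemma quotient_stack_base [simp]:
  "base_of (quotient_stack G X) = base" "base_arr (quotient_stack G X) = fst"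
  by (simp_all add: quotient_stack_def)

lemma functor_over_pullback:
  assumes "group_functor_iso G G' \<gamma> \<delta>" "compatible_actions G \<gamma> X X'"
  shows "functor_over (quotient_stack G X) (quotient_stack G' X') (pullback_obj \<delta>) (\<lambda>x y u. u)"
  unfolding functor_over_def
proof (intro conjI ballI)
  fix E assume "E \<in> Ob (quotient_stack G X)"
  then show "pullback_obj \<delta> E \<in> Ob (quotient_stack G' X')" by (rule pullback_obj_Ob[OF assms])
next
  fix E E' u assume "u \<in> Arr (quotient_stack G X) E E'"
  then show "u \<in> Arr (quotient_stack G' X') (pullback_obj \<delta> E) (pullback_obj \<delta> E')"
    by (rule pullback_obj_Arr[OF assms(1)])
qed (simp_all add: quotient_stack_def)

section \<open>Isomorphisms between objects whose actions differ only outside the carriers\<close>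

lemma calg_hom_id: "is_calg A \<Longrightarrow> (\<lambda>a\<in>carrier A. a) \<in> calg_hom A A"
proof -
  assume A: "is_calg A"
  then interpret cring A by (simp add: is_calg_def)
  have "scal A z \<in> carrier A" for z
    using A by (auto simp: is_calg_def ring_hom_def complex_ring_def)
  then show ?thesis by (auto simp: calg_hom_def ring_hom_def)
qed

text \<open>Pulling an action back along mutually inverse homomorphisms changes it only outside the carriers,
  so identities of the underlying presheaves remain isomorphisms of torsors.\<close>

definition same_obj :: "('u, 'g) group_functor \<Rightarrow> ('u, 'g, 'x) qobj \<Rightarrow> ('u, 'g, 'x) qobj \<Rightarrow> bool" where
  "same_obj G E E' \<longleftrightarrow> base E = base E' \<and> sec (tors E) = sec (tors E') \<and> res (tors E) = res (tors E') \<and>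
     proj E = proj E' \<and> equi E = equi E' \<and>
     (\<forall>A. is_calg A \<longrightarrow> (\<forall>g\<in>carrier (pt_group G A). \<forall>x\<in>sec (tors E) A. act (tors E) A g x = act (tors E') A g x))"

lemma same_obj_refl: "same_obj G E E"
  by (simp add: same_obj_def)

lemma same_obj_sym: "same_obj G E E' \<Longrightarrow> same_obj G E' E"
  by (simp add: same_obj_def)

lemma same_obj_pullback:
  assumes iso: "group_functor_iso G G' \<gamma> \<delta>"
  shows "same_obj G E (pullback_obj \<gamma> (pullback_obj \<delta> E))"
  using group_functor_isoD(5)[OF iso] by (simp add: same_obj_def)

text \<open>The identity of \<open>E\<close> itself serves as the arrow to \<open>E'\<close>,
  because the conditions on an arrow see an object only through the data that
  \<open>same_obj\<close> compares.\<close>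

lemma Ident_Arr:
  assumes same: "same_obj G E E'" and E: "E \<in> Ob (quotient_stack G X)"
  shows "Ident (quotient_stack G X) E \<in> Arr (quotient_stack G X) E E'"
proof -
  have "is_calg (base E)" and T: "torsor G (base E) (tors E) (proj E)"
    using E by (simp_all add: quotient_stack_def)
  then have psh: "is_psh (tors E)"
    and actE: "\<forall>A. is_calg A \<longrightarrow> group_action (pt_group G A) (sec (tors E) A) (act (tors E) A)"
    by (simp_all add: torsor_def is_gpsh_def)
  have act_in: "act (tors E) A g x \<in> sec (tors E) A"
    if "is_calg A" "g \<in> carrier (pt_group G A)" "x \<in> sec (tors E) A" for A g x
    using group_action.element_image[OF actE[rule_format, OF that(1)] that(2,3)] by simp
  have proj: "proj E A x \<in> extensional (carrier (base E))" "proj E A x \<in> calg_hom (base E) A"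
    if "is_calg A" "x \<in> sec (tors E) A" for A x
    using T that by (auto simp: torsor_def psh_hom_def spec_def calg_hom_def)
  have "compose (carrier (base E)) (proj E A x) (\<lambda>a\<in>carrier (base E). a) = proj E A x"
    if "is_calg A" "x \<in> sec (tors E) A" for A x
    using proj[OF that] by (auto simp: compose_def fun_eq_iff extensional_def)
  then show ?thesis
    using same calg_hom_id[OF \<open>is_calg (base E)\<close>] psh act_in
    by (auto simp: quotient_stack_def same_obj_def psh_hom_def equivariant_def is_psh_def Pi_iff)
qed

text \<open>Composition restricts every component again, and \<open>u\<close> is recovered because
  its components are extensional. The endpoints passed to \<open>Comp\<close> enter only through
  base and sections, which allows \<open>E'\<close> and \<open>F'\<close> in place of
  \<open>E\<close> and \<open>F\<close>.\<close>

lemma Comp_Ident: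
  assumes E: "E \<in> Ob (quotient_stack G X)" and u: "u \<in> Arr (quotient_stack G X) E F"
    and E': "same_obj G E E'" and F': "same_obj G F F'"
  shows "Comp (quotient_stack G X) E F F' (Ident (quotient_stack G X) F) u = u"
    "Comp (quotient_stack G X) E E' F' u (Ident (quotient_stack G X) E) = u"
proof -
  obtain f \<alpha> where u_eq: "u = (f, \<alpha>)" by force
  have f: "f \<in> calg_hom (base F) (base E)" and \<alpha>: "\<alpha> \<in> psh_hom (tors E) (tors F)"
    using u by (auto simp: u_eq quotient_stack_def)
  have fE: "f \<in> extensional (carrier (base F))" "f \<in> carrier (base F) \<rightarrow> carrier (base E)"
    using f by (auto simp: calg_hom_def ring_hom_def)
  have \<alpha>E: "\<alpha> \<in> extensional (Collect is_calg)" "\<And>A. is_calg A \<Longrightarrow> \<alpha> A \<in> sec (tors E) A \<rightarrow>\<^sub>E sec (tors F) A"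
    using \<alpha> by (auto simp: psh_hom_def)
  have same: "base E' = base E" "base F' = base F" "sec (tors E') = sec (tors E)" "sec (tors F') = sec (tors F)"
    using E' F' by (simp_all add: same_obj_def)
  have "compose (carrier (base F)) f (\<lambda>a\<in>carrier (base F). a) = f"
    "compose (carrier (base F)) (\<lambda>a\<in>carrier (base E). a) f = f"
    using fE by (auto simp: compose_def fun_eq_iff extensional_def)
  moreover have "compose (sec (tors E) A) (\<lambda>x\<in>sec (tors F) A. x) (\<alpha> A) = \<alpha> A"
    "compose (sec (tors E) A) (\<alpha> A) (\<lambda>x\<in>sec (tors E) A. x) = \<alpha> A" if "is_calg A" for A
    using \<alpha>E(2)[OF that] by (auto simp: compose_def fun_eq_iff PiE_iff extensional_def)
  then have "(\<lambda>A\<in>Collect is_calg. compose (sec (tors E) A) ((\<lambda>A\<in>Collect is_calg. \<lambda>x\<in>sec (tors F) A. x) A) (\<alpha> A)) = \<alpha>"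
    "(\<lambda>A\<in>Collect is_calg. compose (sec (tors E) A) (\<alpha> A) ((\<lambda>A\<in>Collect is_calg. \<lambda>x\<in>sec (tors E) A. x) A)) = \<alpha>"
    using \<alpha>E(1) by (auto simp: fun_eq_iff extensional_def)
  ultimately show "Comp (quotient_stack G X) E F F' (Ident (quotient_stack G X) F) u = u"
    "Comp (quotient_stack G X) E E' F' u (Ident (quotient_stack G X) E) = u"
    using same by (simp_all add: u_eq quotient_stack_def)
qed

text \<open>Applied with one functor the identity and the other a round trip, in either order. Both
  leave arrows unchanged, so the naturality square reduces to the neutrality of identities.\<close>

lemma nat_iso_over_same_obj:
  assumes Fo: "\<And>x. x \<in> Ob C \<Longrightarrow> Fo x \<in> Ob (quotient_stack G X) \<and> base (Fo x) = base_of C x"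
    and Ho: "\<And>x. x \<in> Ob C \<Longrightarrow> Ho x \<in> Ob (quotient_stack G X)"
    and same: "\<And>x. x \<in> Ob C \<Longrightarrow> same_obj G (Fo x) (Ho x)"
    and Fm: "\<And>x y u. x \<in> Ob C \<Longrightarrow> y \<in> Ob C \<Longrightarrow> u \<in> Arr C x y \<Longrightarrow> u \<in> Arr (quotient_stack G X) (Fo x) (Fo y)"
  shows "nat_iso_over C (quotient_stack G X) Fo (\<lambda>x y u. u) Ho (\<lambda>x y u. u) (\<lambda>x. Ident (quotient_stack G X) (Fo x))"
    (is "nat_iso_over C ?D _ _ _ _ _")
  unfolding nat_iso_over_def
proof (intro conjI ballI)
  fix x assume x: "x \<in> Ob C"
  have HF: "same_obj G (Ho x) (Fo x)" using same_obj_sym[OF same[OF x]] .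
  show arr: "Ident ?D (Fo x) \<in> Arr ?D (Fo x) (Ho x)" using Ident_Arr[OF same[OF x]] Fo[OF x] by blast
  show "base_arr ?D (Ident ?D (Fo x)) = (\<lambda>a\<in>carrier (base_of C x). a)"
    using Fo[OF x] by (simp add: quotient_stack_def)
  show "\<exists>\<theta>\<in>Arr ?D (Ho x) (Fo x).
           Comp ?D (Fo x) (Ho x) (Fo x) \<theta> (Ident ?D (Fo x)) = Ident ?D (Fo x) \<and>
           Comp ?D (Ho x) (Fo x) (Ho x) (Ident ?D (Fo x)) \<theta> = Ident ?D (Ho x)"
  proof (intro bexI conjI)
    show arr': "Ident ?D (Ho x) \<in> Arr ?D (Ho x) (Fo x)" using Ident_Arr[OF HF Ho[OF x]] .
    show "Comp ?D (Fo x) (Ho x) (Fo x) (Ident ?D (Ho x)) (Ident ?D (Fo x)) = Ident ?D (Fo x)"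
      using Comp_Ident(1)[OF _ arr same_obj_refl HF] Fo[OF x] by blast
    show "Comp ?D (Ho x) (Fo x) (Ho x) (Ident ?D (Fo x)) (Ident ?D (Ho x)) = Ident ?D (Ho x)"
      using Comp_Ident(1)[OF Ho[OF x] arr' same_obj_refl same[OF x]] .
  qed
next
  fix x y u assume xy: "x \<in> Ob C" "y \<in> Ob C" and "u \<in> Arr C x y"
  then have u: "u \<in> Arr ?D (Fo x) (Fo y)" using Fm by blast
  show "Comp ?D (Fo x) (Fo y) (Ho y) (Ident ?D (Fo y)) u = Comp ?D (Fo x) (Ho x) (Ho y) u (Ident ?D (Fo x))"
    using Comp_Ident[OF _ u same[OF xy(1)] same[OF xy(2)]] Fo[OF xy(1)] by simp
qed

lemma equivalent_over_quotient_stack: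
  assumes iso: "group_functor_iso G G' \<gamma> \<delta>" and X: "compatible_actions G \<gamma> X X'"
  shows "equivalent_over (quotient_stack G X) (quotient_stack G' X')"
proof -
  note iso' = group_functor_iso_sym[OF iso] and X' = compatible_actions_sym[OF iso X]
  let ?C = "quotient_stack G X" and ?D = "quotient_stack G' X'"
  note Ob = pullback_obj_Ob[OF iso X] and Ob' = pullback_obj_Ob[OF iso' X']
  note Arr = pullback_obj_Arr[OF iso, where X = X and X' = X']
    and Arr' = pullback_obj_Arr[OF iso', where X = X' and X' = X]
  have "nat_iso_over ?C ?C (\<lambda>x. x) (\<lambda>x y u. u) (\<lambda>x. pullback_obj \<gamma> (pullback_obj \<delta> x)) (\<lambda>x y u. u) (Ident ?C)"
    by (rule nat_iso_over_same_obj) (use same_obj_pullback[OF iso] Ob Ob' in auto)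
  moreover have "nat_iso_over ?D ?D (\<lambda>x. pullback_obj \<delta> (pullback_obj \<gamma> x)) (\<lambda>x y u. u) (\<lambda>x. x) (\<lambda>x y u. u)
      (\<lambda>x. Ident ?D (pullback_obj \<delta> (pullback_obj \<gamma> x)))"
    by (rule nat_iso_over_same_obj)
      (use same_obj_sym[OF same_obj_pullback[OF iso']] Ob Ob' in \<open>auto intro: Arr Arr'\<close>)
  ultimately show ?thesis unfolding equivalent_over_def
    using functor_over_pullback[OF iso X] functor_over_pullback[OF iso' X'] by blast
qed


section \<open>The dual group as a quotient by a primitive vector\<close>

lemma Zn_simps [simp]:
  "carrier (Zn m) = {1..m} \<rightarrow>\<^sub>E UNIV"
  "x \<otimes>\<^bsub>Zn m\<^esub> y = (\<lambda>i\<in>{1..m}. x i + y i)"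
  "\<one>\<^bsub>Zn m\<^esub> = (\<lambda>i\<in>{1..m}. 0)"
  by (simp_all add: Zn_def)

lemma comm_group_Zn [simp]: "comm_group (Zn m)"
proof (rule group.group_comm_groupI)
  show "group (Zn m)" unfolding Zn_def by (rule product_group) simp
qed (auto simp: add.commute)

lemma group_Zn [simp]: "group (Zn m)"
  using comm_group_Zn by (rule comm_group.axioms)

lemma int_pow_Zn:
  assumes "x \<in> carrier (Zn m)"
  shows "x [^]\<^bsub>Zn m\<^esub> (t::int) = (\<lambda>i\<in>{1..m}. t * x i)"
proof (rule extensionalityI[of _ "{1..m}"])
  have x: "x [^]\<^bsub>Zn m\<^esub> t \<in> carrier (Zn m)" using group.int_pow_closed[OF group_Zn assms] .
  then show "x [^]\<^bsub>Zn m\<^esub> t \<in> extensional {1..m}" by (auto simp: PiE_iff)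
  fix i assume i: "i \<in> {1..m}"
  have "(\<lambda>x. x i) \<in> hom (Zn m) integer_group" using i by (auto simp: hom_def)
  from hom_int_pow[OF this assms group_Zn group_integer_group, of t]
  show "(x [^]\<^bsub>Zn m\<^esub> t) i = (\<lambda>i\<in>{1..m}. t * x i) i" using i by simp
qed simp

lemma int_pow_DirProd:
  assumes "group G" "group H" "x \<in> carrier G" "y \<in> carrier H"
  shows "(x, y) [^]\<^bsub>G \<times>\<times> H\<^esub> (t::int) = (x [^]\<^bsub>G\<^esub> t, y [^]\<^bsub>H\<^esub> t)"
proof (rule prod_eqI)
  have G: "group (G \<times>\<times> H)" using assms DirProd_group by blast
  have xy: "(x, y) \<in> carrier (G \<times>\<times> H)" using assms by simp
  have "fst \<in> hom (G \<times>\<times> H) G" "snd \<in> hom (G \<times>\<times> H) H" by (auto simp: hom_def DirProd_def)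
  then show "fst ((x, y) [^]\<^bsub>G \<times>\<times> H\<^esub> t) = fst (x [^]\<^bsub>G\<^esub> t, y [^]\<^bsub>H\<^esub> t)"
    "snd ((x, y) [^]\<^bsub>G \<times>\<times> H\<^esub> t) = snd (x [^]\<^bsub>G\<^esub> t, y [^]\<^bsub>H\<^esub> t)"
    using hom_int_pow[OF _ xy G] assms by fastforce+
qed

lemma hom_group_simps [simp]:
  "carrier (hom_group G H) = hom G H \<inter> extensional (carrier G)"
  "f \<otimes>\<^bsub>hom_group G H\<^esub> g = (\<lambda>x\<in>carrier G. f x \<otimes>\<^bsub>H\<^esub> g x)"
  "\<one>\<^bsub>hom_group G H\<^esub> = (\<lambda>x\<in>carrier G. \<one>\<^bsub>H\<^esub>)"
  by (simp_all add: hom_group_def)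

lemma restrict_hom:
  assumes "group G" "f \<in> hom G H"
  shows "restrict f (carrier G) \<in> hom G H"
  using assms by (auto simp: hom_def group.is_monoid monoid.m_closed)

lemma comm_group_hom_group:
  assumes G: "group G" and H: "comm_group H"
  shows "comm_group (hom_group G H)"
proof -
  interpret G: group G by fact
  interpret H: comm_group H by fact
  have "group (hom_group G H)"
  proof (rule groupI)
    fix f g assume "f \<in> carrier (hom_group G H)" "g \<in> carrier (hom_group G H)"
    then show "f \<otimes>\<^bsub>hom_group G H\<^esub> g \<in> carrier (hom_group G H)"
      by (auto simp: hom_def Pi_iff H.m_ac)
  next
    show "\<one>\<^bsub>hom_group G H\<^esub> \<in> carrier (hom_group G H)" by (auto simp: hom_def)
  next
    fix f g h assume "f \<in> carrier (hom_group G H)" "g \<in> carrier (hom_group G H)" "h \<in> carrier (hom_group G H)"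
    then show "f \<otimes>\<^bsub>hom_group G H\<^esub> g \<otimes>\<^bsub>hom_group G H\<^esub> h = f \<otimes>\<^bsub>hom_group G H\<^esub> (g \<otimes>\<^bsub>hom_group G H\<^esub> h)"
      by (auto simp: hom_def Pi_iff H.m_assoc fun_eq_iff)
  next
    fix f assume f: "f \<in> carrier (hom_group G H)"
    then show "\<one>\<^bsub>hom_group G H\<^esub> \<otimes>\<^bsub>hom_group G H\<^esub> f = f"
      by (auto simp: hom_def Pi_iff fun_eq_iff extensional_def)
    show "\<exists>g\<in>carrier (hom_group G H). g \<otimes>\<^bsub>hom_group G H\<^esub> f = \<one>\<^bsub>hom_group G H\<^esub>"
      using f by (intro bexI[of _ "\<lambda>x\<in>carrier G. inv\<^bsub>H\<^esub> f x"])
        (auto simp: hom_def Pi_iff H.inv_mult fun_eq_iff)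
  qed
  then show ?thesis
    by (rule group.group_comm_groupI) (auto simp: hom_def Pi_iff H.m_comm fun_eq_iff)
qed

lemma hom_eq_on_fibres:
  assumes G: "group G" and H: "group H" and K: "group K"
    and \<pi>: "\<pi> \<in> hom G H" and \<phi>: "\<phi> \<in> hom G K" and ker: "\<forall>x\<in>kernel G H \<pi>. \<phi> x = \<one>\<^bsub>K\<^esub>"
    and xy: "x \<in> carrier G" "y \<in> carrier G" "\<pi> x = \<pi> y"
  shows "\<phi> x = \<phi> y"
proof -
  interpret G: group G by fact
  interpret H: group H by fact
  interpret K: group K by fact
  interpret \<pi>: group_hom G H \<pi> using \<pi> by unfold_locales
  interpret \<phi>: group_hom G K \<phi> using \<phi> by unfold_locales
  have "\<pi> (x \<otimes>\<^bsub>G\<^esub> inv\<^bsub>G\<^esub> y) = \<one>\<^bsub>H\<^esub>" using xy by simp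
  then have "x \<otimes>\<^bsub>G\<^esub> inv\<^bsub>G\<^esub> y \<in> kernel G H \<pi>" using xy by (simp add: kernel_def)
  then have "\<phi> x \<otimes>\<^bsub>K\<^esub> inv\<^bsub>K\<^esub> \<phi> y = \<one>\<^bsub>K\<^esub>" using ker xy by force
  then show ?thesis using xy by (metis K.inv_equality K.inv_inv K.inv_closed \<phi>.hom_closed)
qed

lemma hom_factors_through_surj:
  assumes G: "group G" and H: "group H" and K: "group K"
    and \<pi>: "\<pi> \<in> hom G H" "\<pi> ` carrier G = carrier H"
    and \<phi>: "\<phi> \<in> hom G K" and ker: "\<forall>x\<in>kernel G H \<pi>. \<phi> x = \<one>\<^bsub>K\<^esub>"
  obtains \<theta> where "\<theta> \<in> hom H K" "\<theta> \<in> extensional (carrier H)" "\<forall>x\<in>carrier G. \<theta> (\<pi> x) = \<phi> x"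
proof -
  define \<theta> where "\<theta> = (\<lambda>y\<in>carrier H. \<phi> (inv_into (carrier G) \<pi> y))"
  have \<pi>_in: "\<pi> x \<in> carrier H" if "x \<in> carrier G" for x using that \<pi>(2) by blast
  have \<theta>: "\<theta> (\<pi> x) = \<phi> x" if x: "x \<in> carrier G" for x
  proof -
    have *: "inv_into (carrier G) \<pi> (\<pi> x) \<in> carrier G" "\<pi> (inv_into (carrier G) \<pi> (\<pi> x)) = \<pi> x"
      using x by (auto intro: inv_into_into f_inv_into_f)
    show ?thesis unfolding \<theta>_def using \<pi>_in[OF x] hom_eq_on_fibres[OF G H K \<pi>(1) \<phi> ker *(1) x *(2)] by simp
  qed
  have "\<theta> \<in> hom H K"
  proof (rule homI)
    fix y assume "y \<in> carrier H"
    then obtain x where x: "x \<in> carrier G" "y = \<pi> x" using \<pi>(2) by blast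
    then show "\<theta> y \<in> carrier K" using \<theta> hom_in_carrier[OF \<phi>] by simp
    fix y' assume "y' \<in> carrier H"
    then obtain x' where x': "x' \<in> carrier G" "y' = \<pi> x'" using \<pi>(2) by blast
    have "x \<otimes>\<^bsub>G\<^esub> x' \<in> carrier G" using G x x' by (simp add: group.is_monoid monoid.m_closed)
    then show "\<theta> (y \<otimes>\<^bsub>H\<^esub> y') = \<theta> y \<otimes>\<^bsub>K\<^esub> \<theta> y'"
      using \<theta>[of "x \<otimes>\<^bsub>G\<^esub> x'"] \<theta>[OF x(1)] \<theta>[OF x'(1)] x x' hom_mult[OF \<pi>(1)] hom_mult[OF \<phi>] by simp
  qed
  then show ?thesis using that[of \<theta>] \<theta> by (simp add: \<theta>_def)
qed

text \<open>The kernel of \<pi> is generated by \<kappa>, and \<open>\<phi>0\<close> splits it off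
  from \<open>L\<close>. Dually, \<open>I\<close> is the kernel of evaluation at \<kappa> on the
  dual of \<open>L\<close>, and \<open>\<phi>0\<close> makes this evaluation onto; the first
  isomorphism theorem does the rest.\<close>

lemma dual_cokernel_iso:
  fixes \<kappa> :: 'a and L :: "('a, 'b) monoid_scheme" and M :: "('c, 'd) monoid_scheme"
  assumes L: "group L" and M: "group M" and \<pi>: "\<pi> \<in> hom L M" "\<pi> ` carrier L = carrier M"
    and \<kappa>: "\<kappa> \<in> carrier L" "kernel L M \<pi> = range (\<lambda>t::int. \<kappa> [^]\<^bsub>L\<^esub> t)"
    and \<phi>0: "\<phi>0 \<in> hom L integer_group" "\<phi>0 \<kappa> = 1"
  defines "I \<equiv> (\<lambda>\<theta>. \<lambda>l\<in>carrier L. \<theta> (\<pi> l)) ` carrier (dual M)"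
  obtains \<psi> where "group (dual L Mod I)" "\<psi> \<in> iso (dual L Mod I) integer_group"
    "\<forall>\<phi>\<in>carrier (dual L). I #>\<^bsub>dual L\<^esub> \<phi> \<in> carrier (dual L Mod I) \<and> \<psi> (I #>\<^bsub>dual L\<^esub> \<phi>) = \<phi> \<kappa>"
proof -
  interpret dL: comm_group "dual L" by (rule comm_group_hom_group[OF L abelian_integer_group])
  define ev where "ev = (\<lambda>\<phi> :: 'a \<Rightarrow> int. \<phi> \<kappa>)"
  have ev_hom: "ev \<in> hom (dual L) integer_group" using \<kappa>(1) by (auto simp: hom_def ev_def)
  then interpret ev: group_hom "dual L" integer_group ev
    by (intro group_hom.intro group_hom_axioms.intro dL.group_axioms group_integer_group)
  have "1 \<in> ev ` carrier (dual L)"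
    using restrict_hom[OF L \<phi>0(1)] \<phi>0(2) \<kappa>(1)
    by (intro image_eqI[of _ _ "restrict \<phi>0 (carrier L)"]) (auto simp: ev_def)
  then have "1 [^]\<^bsub>integer_group\<^esub> t \<in> ev ` carrier (dual L)" for t :: int
    using ev.img_is_subgroup group.subgroup_int_pow_closed[OF group_integer_group] by blast
  then have surj: "ev ` carrier (dual L) = carrier integer_group" by auto
  have kernel: "kernel (dual L) integer_group ev = I"
  proof (intro equalityI subsetI)
    fix \<phi> assume "\<phi> \<in> kernel (dual L) integer_group ev"
    then have \<phi>: "\<phi> \<in> hom L integer_group" "\<phi> \<in> extensional (carrier L)" "\<phi> \<kappa> = 0"
      by (auto simp: kernel_def ev_def)
    \<comment> \<open>A form vanishing at \<kappa> vanishes on the whole kernel of \<pi>, so it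
      descends to \<open>M\<close>.\<close>
    have "\<phi> (\<kappa> [^]\<^bsub>L\<^esub> t) = 0" for t :: int
      using hom_int_pow[OF \<phi>(1) \<kappa>(1) L group_integer_group, of t] \<phi>(3) by simp
    then have "\<forall>x\<in>kernel L M \<pi>. \<phi> x = \<one>\<^bsub>integer_group\<^esub>" unfolding \<kappa>(2) by auto
    then obtain \<theta> where \<theta>: "\<theta> \<in> hom M integer_group" "\<theta> \<in> extensional (carrier M)"
      "\<forall>x\<in>carrier L. \<theta> (\<pi> x) = \<phi> x"
      using hom_factors_through_surj[OF L M group_integer_group \<pi> \<phi>(1)] by blast
    have "\<phi> = (\<lambda>l\<in>carrier L. \<theta> (\<pi> l))" using \<theta>(3) \<phi>(2) by (auto simp: fun_eq_iff extensional_def)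
    then show "\<phi> \<in> I" unfolding I_def using \<theta> by auto
  next
    fix \<phi> assume "\<phi> \<in> I"
    then obtain \<theta> where \<theta>: "\<theta> \<in> hom M integer_group" "\<phi> = (\<lambda>l\<in>carrier L. \<theta> (\<pi> l))" unfolding I_def by auto
    have "\<phi> \<in> hom L integer_group" unfolding \<theta>(2)
      using restrict_hom[OF L hom_compose[OF \<pi>(1) \<theta>(1)]] by (simp add: comp_def)
    moreover have "\<kappa> [^]\<^bsub>L\<^esub> (1::int) \<in> kernel L M \<pi>" unfolding \<kappa>(2) by blast
    then have "\<pi> \<kappa> = \<one>\<^bsub>M\<^esub>" using \<kappa>(1) L by (simp add: kernel_def group.int_pow_1)
    then have "\<phi> \<kappa> = 0" using \<kappa>(1) hom_one[OF \<theta>(1) M group_integer_group] by (simp add: \<theta>(2))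
    ultimately show "\<phi> \<in> kernel (dual L) integer_group ev" by (auto simp: kernel_def ev_def \<theta>(2))
  qed
  show ?thesis
  \<comment> \<open>Evaluation at \<kappa> is constant on cosets of its kernel, so the image of a
    coset is a singleton and \<open>the_elem\<close> extracts its value.\<close>
  proof (rule that[of "\<lambda>X. the_elem (ev ` X)"])
    show "group (dual L Mod I)" using normal.factorgroup_is_group[OF ev.normal_kernel] unfolding kernel .
    show "(\<lambda>X. the_elem (ev ` X)) \<in> iso (dual L Mod I) integer_group"
      using ev.FactGroup_iso_set[OF surj] unfolding kernel .
    have "ev ` (I #>\<^bsub>dual L\<^esub> \<phi>) = {\<phi> \<kappa>}" if \<phi>: "\<phi> \<in> carrier (dual L)" for \<phi>
    proof -
      have "ev (i \<otimes>\<^bsub>dual L\<^esub> \<phi>) = \<phi> \<kappa>" if "i \<in> I" for i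
        using that \<kappa>(1) unfolding kernel[symmetric] by (simp add: kernel_def ev_def)
      moreover have "I \<noteq> {}" unfolding kernel[symmetric] using ev.subgroup_kernel subgroup.one_closed by blast
      moreover have "ev ` (I #>\<^bsub>dual L\<^esub> \<phi>) = (\<lambda>i. ev (i \<otimes>\<^bsub>dual L\<^esub> \<phi>)) ` I"
        unfolding r_coset_def by blast
      ultimately show ?thesis by (simp add: image_constant_conv del: hom_group_simps cong: image_cong)
    qed
    moreover have "I #>\<^bsub>dual L\<^esub> \<phi> \<in> carrier (dual L Mod I)" if "\<phi> \<in> carrier (dual L)" for \<phi>
      using that unfolding FactGroup_def RCOSETS_def by auto
    ultimately show "\<forall>\<phi>\<in>carrier (dual L). I #>\<^bsub>dual L\<^esub> \<phi> \<in> carrier (dual L Mod I) \<and>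
        the_elem (ev ` (I #>\<^bsub>dual L\<^esub> \<phi>)) = \<phi> \<kappa>" by simp
  qed
qed

lemma bezout_Gcd_int:
  fixes x :: "'a \<Rightarrow> int"
  assumes "finite I"
  obtains a where "(\<Sum>i\<in>I. a i * x i) = Gcd (x ` I)"
proof -
  have "\<exists>a. (\<Sum>i\<in>I. a i * x i) = Gcd (x ` I)" using assms
  proof (induction I rule: finite_induct)
    case (insert j I)
    then obtain a where a: "(\<Sum>i\<in>I. a i * x i) = Gcd (x ` I)" by blast
    obtain p q where pq: "p * x j + q * Gcd (x ` I) = gcd (x j) (Gcd (x ` I))" using bezout_int by blast
    have "(\<Sum>i\<in>I. (if i = j then p else q * a i) * x i) = (\<Sum>i\<in>I. q * (a i * x i))"
      using insert(2) by (intro sum.cong) auto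
    also have "\<dots> = q * Gcd (x ` I)" unfolding sum_distrib_left[symmetric] a ..
    finally have "(\<Sum>i\<in>insert j I. (if i = j then p else q * a i) * x i) = Gcd (x ` insert j I)"
      using insert(1,2) pq by simp
    then show ?case by (intro exI[of _ "\<lambda>i. if i = j then p else q * a i"])
  qed simp
  then show ?thesis using that by blast
qed

lemma linear_form_hom:
  "(\<lambda>(x, y). (\<Sum>i=1..k. a i * x i) + (\<Sum>i=1..s. b i * y i)) \<in> hom (Zn k \<times>\<times> Zn s) integer_group"
  by (auto simp: hom_def DirProd_def distrib_left sum.distrib)

text \<open>If \<open>g\<close> divides \<open>(w, y)\<close>, then \<open>(w, y) / g\<close> still lies in the kernel, as \<open>\<int>\<^sup>e\<close> is torsion free.
  Hence it is a multiple of \<open>(w, y)\<close> and \<open>g = 1\<close>.\<close>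

lemma primitive_kernel_generator:
  assumes \<pi>: "\<pi> \<in> hom (Zn k \<times>\<times> Zn s) (Zn e)"
    and \<kappa>: "w \<in> carrier (Zn k)" "y \<in> carrier (Zn s)"
      "kernel (Zn k \<times>\<times> Zn s) (Zn e) \<pi> = range (\<lambda>t::int. (w, y) [^]\<^bsub>Zn k \<times>\<times> Zn s\<^esub> t)"
    and nz: "j \<in> {1..k}" "w j \<noteq> 0"
  obtains \<phi> where "\<phi> \<in> hom (Zn k \<times>\<times> Zn s) integer_group" "\<phi> (w, y) = 1"
proof -
  let ?L = "Zn k \<times>\<times> Zn s"
  have L: "group ?L" by (simp add: DirProd_group)
  have pow: "(x, z) [^]\<^bsub>?L\<^esub> t = (\<lambda>i\<in>{1..k}. t * x i, \<lambda>i\<in>{1..s}. t * z i)"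
    if "x \<in> carrier (Zn k)" "z \<in> carrier (Zn s)" for x z and t :: int
    using that by (simp only: int_pow_DirProd[OF group_Zn group_Zn that] int_pow_Zn)
  define g where "g = gcd (Gcd (w ` {1..k})) (Gcd (y ` {1..s}))"
  have dvd: "g dvd w i" if "i \<in> {1..k}" for i unfolding g_def using that by (meson Gcd_dvd dvd_trans gcd_dvd1 imageI)
  have dvd': "g dvd y i" if "i \<in> {1..s}" for i unfolding g_def using that by (meson Gcd_dvd dvd_trans gcd_dvd2 imageI)
  have g: "g \<noteq> 0" "g \<ge> 0" using dvd[OF nz(1)] nz(2) by (auto simp: g_def)
  define w' y' where "w' = (\<lambda>i\<in>{1..k}. w i div g)" and "y' = (\<lambda>i\<in>{1..s}. y i div g)"
  have w': "w' \<in> carrier (Zn k)" and y': "y' \<in> carrier (Zn s)" by (auto simp: w'_def y'_def)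
  have wy: "(w', y') [^]\<^bsub>?L\<^esub> g = (w, y)"
    using dvd dvd' \<kappa>(1,2) unfolding pow[OF w' y'] by (auto simp: w'_def y'_def fun_eq_iff PiE_iff extensional_def)
  have "(w, y) [^]\<^bsub>?L\<^esub> (1::int) \<in> kernel ?L (Zn e) \<pi>" unfolding \<kappa>(3) by blast
  then have "\<pi> ((w', y') [^]\<^bsub>?L\<^esub> g) = \<one>\<^bsub>Zn e\<^esub>" unfolding wy
    using \<kappa>(1,2) L by (simp add: kernel_def group.int_pow_1)
  moreover have \<pi>_in: "\<pi> (w', y') \<in> carrier (Zn e)" using hom_in_carrier[OF \<pi>] w' y' by simp
  moreover have "(w', y') \<in> carrier ?L" using w' y' by simp
  ultimately have *: "(\<lambda>i\<in>{1..e}. g * \<pi> (w', y') i) = (\<lambda>i\<in>{1..e}. 0)"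
    using hom_int_pow[OF \<pi> _ L group_Zn, of "(w', y')" g] int_pow_Zn[OF \<pi>_in, of g] by simp
  have "\<pi> (w', y') i = 0" if "i \<in> {1..e}" for i using fun_cong[OF *, of i] that g by simp
  then have "\<pi> (w', y') = \<one>\<^bsub>Zn e\<^esub>" using \<pi>_in by (auto simp: fun_eq_iff PiE_iff extensional_def)
  then have "(w', y') \<in> kernel ?L (Zn e) \<pi>" using w' y' by (simp add: kernel_def)
  then obtain t :: int where "(w', y') = (w, y) [^]\<^bsub>?L\<^esub> t" unfolding \<kappa>(3) by blast
  then have "w' j = t * w j" using pow[OF \<kappa>(1,2), of t] nz(1) by simp
  then have "w j div g = t * w j" using nz(1) by (simp add: w'_def)
  then have "w j = g * (t * w j)" using dvd[OF nz(1)] by (metis dvd_mult_div_cancel)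
  then have "g * t = 1" using nz(2) by (metis mult.assoc mult_cancel_right2)
  then have g1: "g = 1" using g(2) by (auto simp: zmult_eq_1_iff)
  \<comment> \<open>Three Bezout identities, for \<open>w\<close>, for \<open>y\<close> and for
    their two gcds, combine into a linear form whose value at (w, y) is \<open>g\<close>, that is,
    1.\<close>
  obtain a where a: "(\<Sum>i=1..k. a i * w i) = Gcd (w ` {1..k})" using bezout_Gcd_int[of "{1..k}" w] by blast
  obtain b where b: "(\<Sum>i=1..s. b i * y i) = Gcd (y ` {1..s})" using bezout_Gcd_int[of "{1..s}" y] by blast
  obtain p q where pq: "p * Gcd (w ` {1..k}) + q * Gcd (y ` {1..s}) = g" unfolding g_def using bezout_int by blast
  show ?thesis
  proof (rule that[OF linear_form_hom[where a = "\<lambda>i. p * a i" and b = "\<lambda>i. q * b i"]])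
    show "(\<lambda>(x, y). (\<Sum>i=1..k. p * a i * x i) + (\<Sum>i=1..s. q * b i * y i)) (w, y) = 1"
      using pq g1 by (simp only: prod.case mult.assoc a b flip: sum_distrib_left)
  qed
qed

text \<open>Since \<open>p\<close> maps \<open>Bt x + Q y\<close> to \<open>\<beta> x\<close>, the
  component \<open>y\<close> only moves a point within a fibre of \<open>p\<close>, and injectivity
  of \<open>Q\<close> makes it unique. Hence the projection to \<open>x\<close> identifies the
  kernel of [Bt Q] with that of \<beta>, whatever resolution and lift are used.\<close>

lemma DG_iso_integers:
  assumes N: "group N" and \<beta>: "\<beta> \<in> hom (Zn k) N" "\<beta> ` carrier (Zn k) = carrier N"
    and w: "w \<in> carrier (Zn k)" "j \<in> {1..k}" "w j \<noteq> 0"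
    and ker: "kernel (Zn k) N \<beta> = range (\<lambda>t::int. w [^]\<^bsub>Zn k\<^esub> t)"
    and res: "free_resolution N d s Q p" and lift: "is_lift k (d + s) p \<beta> Bt"
  obtains \<psi> where "group (DG k s (d + s) Bt Q)" "\<psi> \<in> iso (DG k s (d + s) Bt Q) integer_group"
    "\<forall>i\<in>{1..k}. DG_class k s (d + s) Bt Q i \<in> carrier (DG k s (d + s) Bt Q) \<and>
        \<psi> (DG_class k s (d + s) Bt Q i) = w i"
proof -
  let ?L = "Zn k \<times>\<times> Zn s" and ?M = "Zn (d + s)"
  interpret N: group N by fact
  interpret M: comm_group ?M by simp
  have Q: "Q \<in> hom (Zn s) ?M" "inj_on Q (carrier (Zn s))" and p: "p \<in> hom ?M N"
    and Qp: "Q ` carrier (Zn s) = kernel ?M N p" and p_surj: "p ` carrier ?M = carrier N"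
    using res by (simp_all add: free_resolution_def)
  have Bt: "Bt \<in> hom (Zn k) ?M" "\<And>x. x \<in> carrier (Zn k) \<Longrightarrow> p (Bt x) = \<beta> x"
    using lift by (simp_all add: is_lift_def)
  interpret Q: group_hom "Zn s" ?M Q 
    using Q(1) by (intro group_hom.intro group_hom_axioms.intro group_Zn)
  interpret Bt: group_hom "Zn k" ?M Bt 
    using Bt(1) by (intro group_hom.intro group_hom_axioms.intro group_Zn)
  interpret p: group_hom ?M N p using p by unfold_locales
  have L: "group ?L" by (simp add: DirProd_group)
  define \<pi> where "\<pi> = (\<lambda>(x, y). Bt x \<otimes>\<^bsub>?M\<^esub> Q y)"
  have \<pi>_hom: "\<pi> \<in> hom ?L ?M"
    unfolding \<pi>_def
  proof (rule homI)
    fix l l' assume "l \<in> carrier ?L" "l' \<in> carrier ?L"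
    then obtain x y x' y' where l: "l = (x, y)" "l' = (x', y')"
      and c: "x \<in> carrier (Zn k)" "y \<in> carrier (Zn s)" "x' \<in> carrier (Zn k)" "y' \<in> carrier (Zn s)"
      by (auto simp: DirProd_def)
    have "Bt (x \<otimes>\<^bsub>Zn k\<^esub> x') \<otimes>\<^bsub>?M\<^esub> Q (y \<otimes>\<^bsub>Zn s\<^esub> y') =
        (Bt x \<otimes>\<^bsub>?M\<^esub> Q y) \<otimes>\<^bsub>?M\<^esub> (Bt x' \<otimes>\<^bsub>?M\<^esub> Q y')"
      unfolding Bt.hom_mult[OF c(1,3)] Q.hom_mult[OF c(2,4)]
      using Bt.hom_closed[OF c(1)] Bt.hom_closed[OF c(3)] Q.hom_closed[OF c(2)] Q.hom_closed[OF c(4)]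
      by (simp only: M.m_ac M.m_closed)
    then show "(case l \<otimes>\<^bsub>?L\<^esub> l' of (x, y) \<Rightarrow> Bt x \<otimes>\<^bsub>?M\<^esub> Q y) =
        (case l of (x, y) \<Rightarrow> Bt x \<otimes>\<^bsub>?M\<^esub> Q y) \<otimes>\<^bsub>?M\<^esub> (case l' of (x, y) \<Rightarrow> Bt x \<otimes>\<^bsub>?M\<^esub> Q y)"
      by (simp only: l mult_DirProd prod.case)
    show "(case l of (x, y) \<Rightarrow> Bt x \<otimes>\<^bsub>?M\<^esub> Q y) \<in> carrier ?M"
      unfolding l prod.case using Bt.hom_closed[OF c(1)] Q.hom_closed[OF c(2)] by (rule M.m_closed)
  qed
  have pQ: "p (Q y) = \<one>\<^bsub>N\<^esub>" if "y \<in> carrier (Zn s)" for y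
    using that Qp unfolding kernel_def by blast
  have p\<pi>: "p (Bt x \<otimes>\<^bsub>?M\<^esub> Q y) = \<beta> x" if "x \<in> carrier (Zn k)" "y \<in> carrier (Zn s)" for x y
    using p.hom_mult[OF Bt.hom_closed[OF that(1)] Q.hom_closed[OF that(2)]] pQ[OF that(2)] Bt(2)[OF that(1)]
      hom_in_carrier[OF \<beta>(1) that(1)] by (simp only: N.r_one)
  \<comment> \<open>Used twice: for arbitrary \<open>z\<close> it gives surjectivity, and for the
    neutral element it produces the second component \<open>y0\<close> of the kernel
    generator.\<close>
  have complete: "\<exists>y\<in>carrier (Zn s). Bt x \<otimes>\<^bsub>?M\<^esub> Q y = z"
    if x: "x \<in> carrier (Zn k)" and z: "z \<in> carrier ?M" "p z = \<beta> x" for x z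
  proof -
    have Bx: "Bt x \<in> carrier ?M" using Bt.hom_closed[OF x] .
    have "p (inv\<^bsub>?M\<^esub> Bt x \<otimes>\<^bsub>?M\<^esub> z) = \<one>\<^bsub>N\<^esub>"
      using p.hom_mult[OF M.inv_closed[OF Bx] z(1)] p.hom_inv[OF Bx] Bt(2)[OF x] z(2)
        hom_in_carrier[OF \<beta>(1) x] by (simp only: N.l_inv)
    then have "inv\<^bsub>?M\<^esub> Bt x \<otimes>\<^bsub>?M\<^esub> z \<in> kernel ?M N p"
      using M.m_closed[OF M.inv_closed[OF Bx] z(1)] unfolding kernel_def by blast
    then obtain y where y: "y \<in> carrier (Zn s)" "Q y = inv\<^bsub>?M\<^esub> Bt x \<otimes>\<^bsub>?M\<^esub> z"
      unfolding Qp[symmetric] by (metis imageE)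
    have "Bt x \<otimes>\<^bsub>?M\<^esub> Q y = z" unfolding y(2)
      using Bx z(1) by (metis M.inv_closed M.m_assoc M.r_inv M.l_one)
    then show ?thesis using y(1) by blast
  qed
  have \<pi>_surj: "\<pi> ` carrier ?L = carrier ?M"
  proof (intro equalityI subsetI)
    fix z assume z: "z \<in> carrier ?M"
    then have "p z \<in> carrier N" by (rule p.hom_closed)
    then obtain x where x: "x \<in> carrier (Zn k)" "p z = \<beta> x" using \<beta>(2) by blast
    then obtain y where "y \<in> carrier (Zn s)" "Bt x \<otimes>\<^bsub>?M\<^esub> Q y = z" using complete[OF x(1) z] by blast
    then show "z \<in> \<pi> ` carrier ?L" using x(1) unfolding \<pi>_def by (intro image_eqI[of _ _ "(x, y)"]) auto
  qed (use hom_in_carrier[OF \<pi>_hom] in blast)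
  have "w [^]\<^bsub>Zn k\<^esub> (1::int) \<in> kernel (Zn k) N \<beta>" unfolding ker by blast
  then have "\<beta> w = \<one>\<^bsub>N\<^esub>" using group.int_pow_1[OF group_Zn w(1)] by (simp add: kernel_def)
  then obtain y0 where y0: "y0 \<in> carrier (Zn s)" "Bt w \<otimes>\<^bsub>?M\<^esub> Q y0 = \<one>\<^bsub>?M\<^esub>"
    using complete[OF w(1) M.one_closed] p.hom_one by metis
  have \<kappa>: "(w, y0) \<in> carrier ?L" using w(1) y0(1) by simp
  have kernel_\<pi>: "kernel ?L ?M \<pi> = range (\<lambda>t::int. (w, y0) [^]\<^bsub>?L\<^esub> t)"
  proof (intro equalityI subsetI)
    fix l assume "l \<in> kernel ?L ?M \<pi>"
    then obtain x y where l: "l = (x, y)" "x \<in> carrier (Zn k)" "y \<in> carrier (Zn s)"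
      "Bt x \<otimes>\<^bsub>?M\<^esub> Q y = \<one>\<^bsub>?M\<^esub>" by (auto simp: kernel_def \<pi>_def DirProd_def)
    then have "\<beta> x = \<one>\<^bsub>N\<^esub>" using p\<pi>[OF l(2,3)] p.hom_one by metis
    then have "x \<in> kernel (Zn k) N \<beta>" using l(2) by (simp add: kernel_def)
    then obtain t :: int where t: "x = w [^]\<^bsub>Zn k\<^esub> t" unfolding ker by blast
    have yt: "y0 [^]\<^bsub>Zn s\<^esub> t \<in> carrier (Zn s)" using y0(1) by (rule group.int_pow_closed[OF group_Zn])
    have "Bt x \<otimes>\<^bsub>?M\<^esub> Q (y0 [^]\<^bsub>Zn s\<^esub> t) = \<pi> ((w, y0) [^]\<^bsub>?L\<^esub> t)"
      unfolding int_pow_DirProd[OF group_Zn group_Zn w(1) y0(1)] t \<pi>_def by (simp only: prod.case)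
    also have "\<dots> = \<one>\<^bsub>?M\<^esub> [^]\<^bsub>?M\<^esub> t"
      unfolding hom_int_pow[OF \<pi>_hom \<kappa> L group_Zn] using y0(2) by (simp only: \<pi>_def prod.case)
    also have "\<dots> = \<one>\<^bsub>?M\<^esub>" by (rule M.int_pow_one)
    finally have "Bt x \<otimes>\<^bsub>?M\<^esub> Q y = Bt x \<otimes>\<^bsub>?M\<^esub> Q (y0 [^]\<^bsub>Zn s\<^esub> t)" using l(4) by (simp only:)
    then have "Q y = Q (y0 [^]\<^bsub>Zn s\<^esub> t)"
      using M.Units_l_cancel[of "Bt x"] Q.hom_closed[OF l(3)] Q.hom_closed[OF yt] Bt.hom_closed[OF l(2)]
      unfolding M.Units_eq by blast
    then have "y = y0 [^]\<^bsub>Zn s\<^esub> t" using inj_onD[OF Q(2) _ l(3) yt] by blast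
    then have "l = (w, y0) [^]\<^bsub>?L\<^esub> t"
      unfolding int_pow_DirProd[OF group_Zn group_Zn w(1) y0(1)] l(1) t by (simp only:)
    then show "l \<in> range (\<lambda>t::int. (w, y0) [^]\<^bsub>?L\<^esub> t)" by blast
  next
    fix l assume "l \<in> range (\<lambda>t::int. (w, y0) [^]\<^bsub>?L\<^esub> t)"
    then obtain t :: int where l: "l = (w, y0) [^]\<^bsub>?L\<^esub> t" by blast
    have "\<pi> l = \<one>\<^bsub>?M\<^esub> [^]\<^bsub>?M\<^esub> t"
      unfolding l hom_int_pow[OF \<pi>_hom \<kappa> L group_Zn] using y0(2) by (simp only: \<pi>_def prod.case)
    then have "\<pi> l = \<one>\<^bsub>?M\<^esub>" by (simp only: M.int_pow_one)
    moreover have "l \<in> carrier ?L" unfolding l using \<kappa> by (rule group.int_pow_closed[OF L])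
    ultimately show "l \<in> kernel ?L ?M \<pi>" by (simp add: kernel_def)
  qed
  obtain \<phi>0 where \<phi>0: "\<phi>0 \<in> hom ?L integer_group" "\<phi>0 (w, y0) = 1"
    using primitive_kernel_generator[OF \<pi>_hom w(1) y0(1) kernel_\<pi> w(2,3)] by blast
  define I where "I = (\<lambda>\<theta>. \<lambda>l\<in>carrier ?L. \<theta> (\<pi> l)) ` carrier (dual ?M)"
  have image: "DG_image k s (d + s) Bt Q = I"
    unfolding DG_image_def I_def \<pi>_def by (intro image_cong refl restrict_ext) auto
  obtain \<psi> where \<psi>: "group (dual ?L Mod I)" "\<psi> \<in> iso (dual ?L Mod I) integer_group"
    "\<forall>\<phi>\<in>carrier (dual ?L). I #>\<^bsub>dual ?L\<^esub> \<phi> \<in> carrier (dual ?L Mod I) \<and> \<psi> (I #>\<^bsub>dual ?L\<^esub> \<phi>) = \<phi> (w, y0)"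
    using dual_cokernel_iso[OF L group_Zn \<pi>_hom \<pi>_surj \<kappa> kernel_\<pi> \<phi>0] unfolding I_def by blast
  have "DG_class k s (d + s) Bt Q i \<in> carrier (DG k s (d + s) Bt Q) \<and>
        \<psi> (DG_class k s (d + s) Bt Q i) = w i" if i: "i \<in> {1..k}" for i
  proof -
    \<comment> \<open>The isomorphism evaluates representatives at (w, y0), and a coordinate
      function of the first factor does not see \<open>y0\<close>.\<close>
    let ?c = "\<lambda>(x, y)\<in>carrier ?L. x i"
    have "?c \<in> carrier (dual ?L)" using i by (auto simp: hom_def DirProd_def)
    moreover have "?c (w, y0) = w i" using \<kappa> by simp
    ultimately show ?thesis using \<psi>(3) unfolding DG_class_def DG_def image by (metis (no_types, lifting))
  qed
  then show ?thesis using that[of \<psi>] \<psi>(1,2) unfolding DG_def image by blast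
qed


section \<open>One-dimensional diagonalizable groups\<close>

lemma calg_hom_Units:
  assumes "is_calg A" "is_calg B" "f \<in> calg_hom A B" "u \<in> Units A"
  shows "f u \<in> Units B"
proof -
  interpret A: cring A using assms(1) by (simp add: is_calg_def)
  have f: "f \<in> ring_hom A B" using assms(3) by (simp add: calg_hom_def)
  obtain u' where u': "u \<in> carrier A" "u' \<in> carrier A" "u \<otimes>\<^bsub>A\<^esub> u' = \<one>\<^bsub>A\<^esub>" "u' \<otimes>\<^bsub>A\<^esub> u = \<one>\<^bsub>A\<^esub>"
    using assms(4) unfolding Units_def by blast
  have "f u \<otimes>\<^bsub>B\<^esub> f u' = \<one>\<^bsub>B\<^esub>" "f u' \<otimes>\<^bsub>B\<^esub> f u = \<one>\<^bsub>B\<^esub>"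
    using u' ring_hom_mult[OF f] ring_hom_one[OF f] by metis+
  then show ?thesis using ring_hom_closed[OF f] u'(1,2) unfolding Units_def by blast
qed

lemma comm_group_units_of: "is_calg A \<Longrightarrow> comm_group (units_of A)"
  by (intro comm_monoid.units_comm_group cring.axioms(2)) (simp add: is_calg_def)

text \<open>A homomorphism from an infinite cyclic group is given by the image of a generator, which
  may be any unit. Here \<gamma> evaluates at the generator sent to 1 by \<psi>; powers are taken in
  \<open>units_of A\<close> because exponents may be negative.\<close>

lemma diag_group_iso_mult_group:
  fixes M :: "'m monoid"
  assumes M: "group M" and \<psi>: "\<psi> \<in> iso M integer_group"
  obtains \<gamma> :: "'u calg \<Rightarrow> ('m \<Rightarrow> 'u) \<Rightarrow> 'u" and \<delta>
  where "group_functor_iso (diag_group M) mult_group \<gamma> \<delta>"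
    "\<And>A g x. is_calg A \<Longrightarrow> g \<in> carrier (pt_group (diag_group M) A) \<Longrightarrow> x \<in> carrier M \<Longrightarrow>
       \<gamma> A g \<in> Units A \<and> g x = \<gamma> A g [^]\<^bsub>units_of A\<^esub> \<psi> x"
proof -
  interpret M: group M by fact
  have \<psi>_hom: "\<psi> \<in> hom M integer_group" and \<psi>_bij: "bij_betw \<psi> (carrier M) UNIV"
    using \<psi> by (auto simp: iso_def)
  obtain e where e: "e \<in> carrier M" "\<psi> e = 1"
    using \<psi>_bij by (metis UNIV_I bij_betw_imp_surj_on imageE)
  have pow_e: "e [^]\<^bsub>M\<^esub> \<psi> x = x" if "x \<in> carrier M" for x
  proof (rule inj_onD[OF bij_betw_imp_inj_on[OF \<psi>_bij]])
    show "\<psi> (e [^]\<^bsub>M\<^esub> \<psi> x) = \<psi> x"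
      using hom_int_pow[OF \<psi>_hom e(1) M group_integer_group, of "\<psi> x"] e(2) by simp
  qed (use e(1) that in auto)
  define \<gamma> where "\<gamma> = (\<lambda>(A :: 'u calg) (g :: 'm \<Rightarrow> 'u). g e)"
  define \<delta> where "\<delta> = (\<lambda>(A :: 'u calg) \<mu>. \<lambda>x\<in>carrier M. \<mu> [^]\<^bsub>units_of A\<^esub> \<psi> x)"
  have eval: "g x = g e [^]\<^bsub>units_of A\<^esub> \<psi> x"
    if "is_calg A" "g \<in> hom M (units_of A)" "x \<in> carrier M" for A :: "'u calg" and g x
    using hom_int_pow[OF that(2) e(1) M comm_group.axioms(2)[OF comm_group_units_of[OF that(1)]], of "\<psi> x"]
      pow_e[OF that(3)] by simp
  have \<delta>_hom: "\<delta> A \<mu> \<in> hom M (units_of A)"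
    if A: "is_calg A" and \<mu>: "\<mu> \<in> Units A" for A :: "'u calg" and \<mu>
  proof -
    interpret U: comm_group "units_of A" using comm_group_units_of[OF A] .
    have "(\<lambda>x. \<mu> [^]\<^bsub>units_of A\<^esub> \<psi> x) \<in> hom M (units_of A)"
      using \<mu> hom_mult[OF \<psi>_hom] by (intro homI) (simp_all add: units_of_carrier U.int_pow_mult flip: units_of_carrier)
    then show ?thesis unfolding \<delta>_def by (rule restrict_hom[OF M])
  qed
  have iso: "group_functor_iso (diag_group M) mult_group \<gamma> \<delta>"
    unfolding group_functor_iso_def
  proof (intro conjI allI impI ballI)
    fix A :: "'u calg" assume A: "is_calg A"
    interpret U: comm_group "units_of A" using comm_group_units_of[OF A] .
    show "group (pt_group (diag_group M) A)"
      using comm_group_hom_group[OF M U.comm_group_axioms] by (simp add: diag_group_def comm_group.axioms)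
    show "group (pt_group mult_group A)" by (simp add: mult_group_def U.group_axioms)
    show "\<gamma> A \<in> hom (pt_group (diag_group M) A) (pt_group mult_group A)"
      using e(1) by (auto simp: hom_def diag_group_def mult_group_def \<gamma>_def)
    show "\<delta> A \<in> hom (pt_group mult_group A) (pt_group (diag_group M) A)"
    proof (rule homI)
      fix \<mu> assume "\<mu> \<in> carrier (pt_group mult_group A)"
      then have \<mu>: "\<mu> \<in> carrier (units_of A)" by (simp add: mult_group_def)
      then show "\<delta> A \<mu> \<in> carrier (pt_group (diag_group M) A)"
        using \<delta>_hom[OF A] by (simp add: diag_group_def \<delta>_def units_of_carrier)
      fix \<nu> assume "\<nu> \<in> carrier (pt_group mult_group A)"
      then have \<nu>: "\<nu> \<in> carrier (units_of A)" by (simp add: mult_group_def)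
      show "\<delta> A (\<mu> \<otimes>\<^bsub>pt_group mult_group A\<^esub> \<nu>) = \<delta> A \<mu> \<otimes>\<^bsub>pt_group (diag_group M) A\<^esub> \<delta> A \<nu>"
        using U.int_pow_distrib[OF \<mu> \<nu>] by (auto simp: mult_group_def diag_group_def \<delta>_def fun_eq_iff)
    qed
    fix g assume "g \<in> carrier (pt_group (diag_group M) A)"
    then have g: "g \<in> hom M (units_of A)" "g \<in> extensional (carrier M)" by (simp_all add: diag_group_def)
    show "\<delta> A (\<gamma> A g) = g"
      by (rule extensionalityI[OF _ g(2)]) (use eval[OF A g(1)] in \<open>simp_all add: \<delta>_def \<gamma>_def\<close>)
  next
    fix A :: "'u calg" and \<mu> assume A: "is_calg A" and "\<mu> \<in> carrier (pt_group mult_group A)"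
    then show "\<gamma> A (\<delta> A \<mu>) = \<mu>"
      using e comm_group_units_of[OF A] by (simp add: \<gamma>_def \<delta>_def mult_group_def comm_group.axioms group.int_pow_1)
  next
    fix A B :: "'u calg" and f g
    assume A: "is_calg A" and B: "is_calg B" and f: "f \<in> calg_hom A B"
      and g: "g \<in> carrier (pt_group (diag_group M) A)"
    have g: "g \<in> hom M (units_of A)" using g by (simp add: diag_group_def)
    have "f \<in> ring_hom A B" using f by (simp add: calg_hom_def)
    then have "f \<in> hom (units_of A) (units_of B)"
      using calg_hom_Units[OF A B f]
      by (intro homI) (simp_all add: units_of_carrier units_of_mult ring_hom_mult monoid.Units_closed[OF ring.is_monoid]
          cring.axioms(1) A[unfolded is_calg_def])
    then have "compose (carrier M) f g \<in> hom M (units_of B)" using M.hom_compose[OF g] by blast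
    then show "pt_map (diag_group M) A B f g \<in> carrier (pt_group (diag_group M) B)"
      by (simp add: diag_group_def)
    show "\<gamma> B (pt_map (diag_group M) A B f g) = pt_map mult_group A B f (\<gamma> A g)"
      using e(1) by (simp add: diag_group_def mult_group_def \<gamma>_def compose_def)
  qed
  show ?thesis
  proof (rule that[OF iso])
    fix A :: "'u calg" and g x
    assume *: "is_calg A" "g \<in> carrier (pt_group (diag_group M) A)" "x \<in> carrier M"
    then have g: "g \<in> hom M (units_of A)" by (simp add: diag_group_def)
    show "\<gamma> A g \<in> Units A \<and> g x = \<gamma> A g [^]\<^bsub>units_of A\<^esub> \<psi> x"
      using eval[OF *(1) g *(3)] hom_in_carrier[OF g e(1)] by (simp add: \<gamma>_def units_of_carrier)
  qed
qed

section \<open>The zero locus of the ideal of the fan\<close>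

lemma finprod_in_ideal:
  assumes A: "cring A" and I: "ideal I A" and S: "finite S" "j \<in> S" "z \<in> S \<rightarrow> carrier A" "z j \<in> I"
  shows "finprod A z S \<in> I"
proof -
  interpret cring A by fact
  have "finprod A z S = finprod A z (insert j (S - {j}))" using S(2) by (simp add: insert_absorb)
  also have "\<dots> = z j \<otimes>\<^bsub>A\<^esub> finprod A z (S - {j})"
    using S by (intro finprod_insert) auto
  finally have eq: "finprod A z S = z j \<otimes>\<^bsub>A\<^esub> finprod A z (S - {j})" .
  have "finprod A z (S - {j}) \<in> carrier A" using S(3) by (intro finprod_closed) auto
  then show ?thesis unfolding eq by (rule ideal.I_r_closed[OF I S(4)])
qed

text \<open>An ideal contains all the products iff it contains all coordinates: \<open>only\<close>
  exhibits each coordinate as one of the products, and \<open>miss\<close> ensures that each product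
  has a factor.\<close>

lemma complement_points_rays:
  assumes A: "is_calg A"
    and miss: "\<And>\<sigma>. \<sigma> \<in> \<Sigma> \<Longrightarrow> \<exists>j\<in>{1..k}. \<not> \<rho> j \<subseteq> \<sigma>"
    and only: "\<And>j. j \<in> {1..k} \<Longrightarrow> \<exists>\<sigma>\<in>\<Sigma>. {i \<in> {1..k}. \<not> \<rho> i \<subseteq> \<sigma>} = {j}"
  shows "complement_points k A {h. \<exists>\<sigma>\<in>\<Sigma>. h = (\<lambda>z. finprod A z {i \<in> {1..k}. \<not> \<rho> i \<subseteq> \<sigma>})} =
    complement_points k A {h. \<exists>i\<in>{1..k}. h = (\<lambda>z. z i)}"
proof -
  have cring: "cring A" using A by (simp add: is_calg_def)
  interpret cring A by fact
  have vanishing: "(\<forall>h\<in>{h. \<exists>\<sigma>\<in>\<Sigma>. h = (\<lambda>z. finprod A z {i \<in> {1..k}. \<not> \<rho> i \<subseteq> \<sigma>})}. h z \<in> I) \<longleftrightarrow>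
      (\<forall>h\<in>{h. \<exists>i\<in>{1..k}. h = (\<lambda>z. z i)}. h z \<in> I)" (is "?L \<longleftrightarrow> ?R")
    if I: "primeideal I A" and z: "z \<in> {1..k} \<rightarrow>\<^sub>E carrier A" for I z
  proof -
    have ideal: "ideal I A" using I by (rule primeideal.axioms)
    have "z j \<in> I" if L: "\<forall>\<sigma>\<in>\<Sigma>. finprod A z {i \<in> {1..k}. \<not> \<rho> i \<subseteq> \<sigma>} \<in> I" and j: "j \<in> {1..k}" for j
    proof -
      obtain \<sigma> where "\<sigma> \<in> \<Sigma>" "{i \<in> {1..k}. \<not> \<rho> i \<subseteq> \<sigma>} = {j}" using only[OF j] by blast
      then have "finprod A z {j} \<in> I" using L by metis
      moreover have "finprod A z {j} = z j" using z j by (subst finprod_insert) (auto simp: PiE_iff)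
      ultimately show ?thesis by simp
    qed
    moreover have "finprod A z {i \<in> {1..k}. \<not> \<rho> i \<subseteq> \<sigma>} \<in> I"
      if R: "\<forall>j\<in>{1..k}. z j \<in> I" and \<sigma>: "\<sigma> \<in> \<Sigma>" for \<sigma>
    proof -
      obtain j where j: "j \<in> {1..k}" "\<not> \<rho> j \<subseteq> \<sigma>" using miss[OF \<sigma>] by blast
      show ?thesis by (rule finprod_in_ideal[OF cring ideal, of _ j]) (use j R z in \<open>auto simp: PiE_iff\<close>)
    qed
    moreover have "?L \<longleftrightarrow> (\<forall>\<sigma>\<in>\<Sigma>. finprod A z {i \<in> {1..k}. \<not> \<rho> i \<subseteq> \<sigma>} \<in> I)" by auto
    moreover have "?R \<longleftrightarrow> (\<forall>j\<in>{1..k}. z j \<in> I)" by auto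
    ultimately show ?thesis by (simp only:) (intro iffI ballI)
  qed
  show ?thesis unfolding complement_points_def
    by (intro Collect_cong conj_cong refl arg_cong[of _ _ Not] ex_cong1 vanishing)
qed

lemma compatible_actions_Z_space:
  fixes \<gamma> :: "'u calg \<Rightarrow> ('m \<Rightarrow> 'u) \<Rightarrow> 'u" and \<chi> :: "nat \<Rightarrow> 'm"
  assumes miss: "\<And>\<sigma>. \<sigma> \<in> \<Sigma> \<Longrightarrow> \<exists>j\<in>{1..k}. \<not> \<rho> j \<subseteq> \<sigma>"
    and only: "\<And>j. j \<in> {1..k} \<Longrightarrow> \<exists>\<sigma>\<in>\<Sigma>. {i \<in> {1..k}. \<not> \<rho> i \<subseteq> \<sigma>} = {j}"
    and weights: "\<And>A g i. is_calg A \<Longrightarrow> g \<in> carrier (pt_group G A) \<Longrightarrow> i \<in> {1..k} \<Longrightarrow>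
       g (\<chi> i) = \<gamma> A g [^]\<^bsub>A\<^esub> w i"
  shows "compatible_actions G \<gamma> (Z_space k \<rho> \<Sigma> \<chi>) (punctured_space k w)"
proof -
  note pts = complement_points_rays[where \<Sigma> = \<Sigma> and k = k and \<rho> = \<rho>, OF _ miss only]
  show ?thesis unfolding compatible_actions_def
  proof (intro conjI allI impI ballI)
    fix A :: "'u calg" assume A: "is_calg A"
    show sec: "sec (Z_space k \<rho> \<Sigma> \<chi>) A = sec (punctured_space k w) A"
      using pts[OF A] by (simp add: Z_space_def punctured_space_def)
    fix g x assume g: "g \<in> carrier (pt_group G A)" and x: "x \<in> sec (Z_space k \<rho> \<Sigma> \<chi>) A"
    have "x \<in> sec (punctured_space k w) A" using x sec by simp
    then show "act (Z_space k \<rho> \<Sigma> \<chi>) A g x = act (punctured_space k w) A (\<gamma> A g) x"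
      using x weights[OF A g] by (auto simp: Z_space_def punctured_space_def Let_def fun_eq_iff)
  qed (simp add: Z_space_def punctured_space_def Let_def)
qed


section \<open>The stacky fan\<close>

text \<open>Integral preimages \<open>s i\<close> of the unit vectors form a right inverse of
  \<open>B\<close>, and a functional with values \<open>a\<close> on the columns must have
  \<open>a\<close> applied to \<open>s i\<close> as its coefficients. This choice works because
  \<open>a\<close> vanishes on \<open>v\<close>, which spans the kernel of \<open>B\<close>.\<close>

lemma complete_simplex_orbifold_matrix:
  assumes B: "orbifold_matrix n v B" and pos: "\<forall>i\<in>{1..n+1}. v i > 0" and g: "Gcd (v ` {1..n+1}) = 1"
    and n: "n \<ge> 1"
  shows "complete_simplex n (\<lambda>j. of_nat (v j)) (matrix_column n B)"
proof
  show "matrix_column n B j \<in> Qspace n" for j by (auto simp: matrix_column_def Qspace_def)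
next
  fix i assume i: "i \<in> {1..n}"
  have "(\<Sum>j=1..n+1. of_nat (v j) * matrix_column n B j i) = (of_int (\<Sum>j=1..n+1. B i j * int (v j)) :: rat)"
    using i by (simp add: matrix_column_def mult.commute del: sum.cl_ivl_Suc)
  then show "(\<Sum>j=1..n+1. of_nat (v j) * matrix_column n B j i) = 0"
    by (simp only: orbifold_matrix_weights[OF B pos i] of_int_0)
next
  fix a :: "nat \<Rightarrow> rat" assume a: "(\<Sum>j=1..n+1. a j * of_nat (v j)) = 0"
  have "\<exists>x. \<forall>i'\<in>{1..n}. (\<Sum>j=1..n+1. B i' j * x j) = (if i' = i then 1 else 0)" for i
    by (rule orbifold_matrix_surj[OF B pos, of "\<lambda>i'. if i' = i then 1 else 0"]) blast
  then obtain s where s: "\<And>i i'. i' \<in> {1..n} \<Longrightarrow> (\<Sum>j=1..n+1. B i' j * s i j) = (if i' = i then 1 else 0)"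
    by metis
  define f where "f i = (\<Sum>j=1..n+1. a j * of_int (s i j))" for i
  have "(\<Sum>i=1..n. f i * matrix_column n B q i) = a q" if q: "q \<in> {1..n+1}" for q
  proof -
    \<comment> \<open>The difference between unit vector \<open>q\<close> and the combination of the
      \<open>s i\<close> with the entries of column \<open>q\<close>; \<open>B\<close> maps both to
      that column.\<close>
    define x where "x j = (if j = q then 1 else 0) - (\<Sum>i=1..n. B i q * s i j)" for j
    have "(\<Sum>j=1..n+1. B i' j * x j) = 0" if i': "i' \<in> {1..n}" for i'
    proof -
      have "(\<Sum>j=1..n+1. B i' j * x j) =
          (\<Sum>j=1..n+1. B i' j * (if j = q then 1 else 0)) - (\<Sum>j=1..n+1. \<Sum>i=1..n. B i q * (B i' j * s i j))"
        by (simp only: x_def right_diff_distrib sum_subtractf sum_distrib_left mult.left_commute)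
      also have "(\<Sum>j=1..n+1. B i' j * (if j = q then 1 else 0)) = B i' q"
        using q by (simp add: if_distrib[of "\<lambda>x. _ * x"] del: sum.cl_ivl_Suc cong: if_cong)
      also have "(\<Sum>j=1..n+1. \<Sum>i=1..n. B i q * (B i' j * s i j)) = (\<Sum>i=1..n. B i q * (\<Sum>j=1..n+1. B i' j * s i j))"
        unfolding sum_distrib_left by (rule sum.swap)
      also have "\<dots> = (\<Sum>i=1..n. B i q * (if i' = i then 1 else 0))"
        by (simp only: s[OF i'])
      also have "\<dots> = B i' q"
        using i' by (simp add: if_distrib[of "\<lambda>x. _ * x"] del: sum.cl_ivl_Suc cong: if_cong)
      finally show ?thesis by simp
    qed
    then obtain t where t: "\<forall>j\<in>{1..n+1}. x j = t * int (v j)"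
      using orbifold_matrix_kernel[OF B pos g] by blast
    have "(\<Sum>i=1..n. f i * matrix_column n B q i) =
        (\<Sum>i=1..n. \<Sum>j=1..n+1. a j * (of_int (B i q) * of_int (s i j)))"
      unfolding f_def sum_distrib_right by (intro sum.cong) (auto simp: matrix_column_def)
    also have "\<dots> = (\<Sum>j=1..n+1. a j * (\<Sum>i=1..n. of_int (B i q) * of_int (s i j)))"
      unfolding sum_distrib_left by (rule sum.swap)
    also have "\<dots> = (\<Sum>j=1..n+1. a j * (if j = q then 1 else 0) - of_int t * (a j * of_nat (v j)))"
    proof (intro sum.cong refl)
      fix j assume j: "j \<in> {1..n+1}"
      have int_eq: "(\<Sum>i=1..n. B i q * s i j) = (if j = q then 1 else 0) - t * int (v j)"
        using bspec[OF t j] by (simp add: x_def)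
      have "(\<Sum>i=1..n. of_int (B i q) * of_int (s i j)) = (of_int (\<Sum>i=1..n. B i q * s i j) :: rat)" by simp
      also have "\<dots> = (if j = q then 1 else 0) - of_int t * of_nat (v j)"
        unfolding int_eq by simp
      finally show "a j * (\<Sum>i=1..n. of_int (B i q) * of_int (s i j)) =
          a j * (if j = q then 1 else 0) - of_int t * (a j * of_nat (v j))"
        by (simp only: right_diff_distrib mult.left_commute)
    qed
    also have "\<dots> = a q"
      unfolding sum_subtractf sum_distrib_left[symmetric] a
      using q by (simp add: if_distrib[of "\<lambda>x. _ * x"] del: sum.cl_ivl_Suc cong: if_cong)
    finally show ?thesis .
  qed
  then show "\<exists>f. \<forall>j\<in>{1..n+1}. (\<Sum>i=1..n. f i * matrix_column n B j i) = a j" by blast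
qed (use n pos in auto)

section \<open>The homomorphism \<open>stacky_beta\<close> and its target group\<close>

lemma carrier_target_group [simp]:
  "m > 0 \<Longrightarrow> carrier (target_group n m) = carrier (Zn n) \<times> {0..<int m}"
  by (simp add: target_group_def carrier_integer_mod_group)

lemma mult_target_group [simp]:
  "(x, t) \<otimes>\<^bsub>target_group n m\<^esub> (x', t') = (x \<otimes>\<^bsub>Zn n\<^esub> x', (t + t') mod int m)"
  by (simp add: target_group_def)

lemma one_target_group [simp]: "\<one>\<^bsub>target_group n m\<^esub> = (\<one>\<^bsub>Zn n\<^esub>, 0)"
  by (simp add: target_group_def)

lemma comm_group_target_group: "comm_group (target_group n m)"
proof (rule group.group_comm_groupI)
  show "group (target_group n m)" unfolding target_group_def by (rule DirProd_group) simp_all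
qed (auto simp: target_group_def DirProd_def add.commute)

lemma stacky_beta_hom:
  assumes "m > 0"
  shows "stacky_beta n m B c \<in> hom (Zn (n+1)) (target_group n m)"
proof (rule homI)
  fix x assume "x \<in> carrier (Zn (n+1))"
  show "stacky_beta n m B c x \<in> carrier (target_group n m)" using assms by (auto simp: stacky_beta_def)
  fix y assume "y \<in> carrier (Zn (n+1))"
  have "(\<Sum>j=1..n+1. b j * (x \<otimes>\<^bsub>Zn (n+1)\<^esub> y) j) = (\<Sum>j=1..n+1. b j * x j) + (\<Sum>j=1..n+1. b j * y j)"
    for b :: "nat \<Rightarrow> int"
    unfolding sum.distrib[symmetric] by (intro sum.cong) (auto simp: distrib_left)
  then show "stacky_beta n m B c (x \<otimes>\<^bsub>Zn (n+1)\<^esub> y) =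
      stacky_beta n m B c x \<otimes>\<^bsub>target_group n m\<^esub> stacky_beta n m B c y"
    by (auto simp: stacky_beta_def mod_add_eq fun_eq_iff simp del: sum.cl_ivl_Suc)
qed

lemma sum_add_multiple:
  "(\<Sum>j\<in>K. b j * (x j + t * v j)) = (\<Sum>j\<in>K. b j * x j) + t * (\<Sum>j\<in>K. b j * v j)" for t :: int
  by (simp only: distrib_left sum.distrib sum_distrib_left mult.left_commute)

text \<open>The lattice component is solved first. Adding multiples of \<open>v\<close> leaves it
  fixed and, by the condition on \<open>c\<close>, moves the torsion component in steps of
  1.\<close>

lemma stacky_beta_surj:
  assumes m: "m > 0" and B: "orbifold_matrix n v B" and pos: "\<forall>i\<in>{1..n+1}. v i > 0"
    and c: "[(\<Sum>j=1..n+1. c j * int (v j)) = 1] (mod int m)"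
  shows "stacky_beta n m B c ` carrier (Zn (n+1)) = carrier (target_group n m)"
proof (intro equalityI subsetI)
  fix z assume "z \<in> carrier (target_group n m)"
  then obtain y t where z: "z = (y, t)" "y \<in> carrier (Zn n)" "0 \<le> t" "t < int m" using m by auto
  obtain x where x: "\<forall>i\<in>{1..n}. (\<Sum>j=1..n+1. B i j * x j) = y i" using orbifold_matrix_surj[OF B pos] .
  define u where "u = t - (\<Sum>j=1..n+1. c j * x j)"
  define x' where "x' = (\<lambda>j\<in>{1..n+1}. x j + u * int (v j))"
  have sum_x': "(\<Sum>j=1..n+1. b j * x' j) = (\<Sum>j=1..n+1. b j * x j) + u * (\<Sum>j=1..n+1. b j * int (v j))" for b
    unfolding sum_add_multiple[symmetric] by (intro sum.cong) (auto simp: x'_def)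
  have "(\<Sum>j=1..n+1. B i j * x' j) = y i" if "i \<in> {1..n}" for i
    unfolding sum_x' using orbifold_matrix_weights[OF B pos that] bspec[OF x that] by simp
  moreover have "[(\<Sum>j=1..n+1. c j * x' j) = t - u + u * 1] (mod int m)"
    unfolding sum_x' using c by (intro cong_add cong_mult) (simp_all add: u_def)
  then have "(\<Sum>j=1..n+1. c j * x' j) mod int m = t" using z(3,4) by (simp add: cong_def)
  ultimately have "stacky_beta n m B c x' = z"
    using z(2) unfolding z(1) stacky_beta_def by (auto simp: fun_eq_iff PiE_iff extensional_def simp del: sum.cl_ivl_Suc)
  then show "z \<in> stacky_beta n m B c ` carrier (Zn (n+1))" by (auto simp: x'_def)
qed (use hom_in_carrier[OF stacky_beta_hom[OF m]] in blast)

text \<open>The lattice component forces \<open>x\<close> to be \<open>t\<close> times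
  \<open>v\<close>, and the condition on \<open>c\<close> makes the torsion component of that vector
  equal to \<open>t\<close> modulo \<open>m\<close>. So the torsion row is what replaces the
  generator \<open>v\<close> by \<open>w\<close>.\<close>

lemma stacky_beta_kernel:
  assumes m: "m > 0" and B: "orbifold_matrix n v B" and pos: "\<forall>i\<in>{1..n+1}. v i > 0"
    and g: "Gcd (v ` {1..n+1}) = 1" and c: "[(\<Sum>j=1..n+1. c j * int (v j)) = 1] (mod int m)"
    and w: "\<forall>j\<in>{1..n+1}. w j = m * v j"
  shows "kernel (Zn (n+1)) (target_group n m) (stacky_beta n m B c) =
    range (\<lambda>t::int. (\<lambda>j\<in>{1..n+1}. int (w j)) [^]\<^bsub>Zn (n+1)\<^esub> t)"
proof (intro equalityI subsetI)
  fix x assume "x \<in> kernel (Zn (n+1)) (target_group n m) (stacky_beta n m B c)"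
  then have x: "x \<in> carrier (Zn (n+1))"
    and Bx: "(\<lambda>i\<in>{1..n}. \<Sum>j=1..n+1. B i j * x j) = (\<lambda>i\<in>{1..n}. 0)" and cx: "(\<Sum>j=1..n+1. c j * x j) mod int m = 0"
    by (simp_all add: kernel_def stacky_beta_def del: sum.cl_ivl_Suc)
  have "\<forall>i\<in>{1..n}. (\<Sum>j=1..n+1. B i j * x j) = 0"
    using Bx by (metis (no_types, lifting) restrict_apply')
  then obtain t where t: "\<forall>j\<in>{1..n+1}. x j = t * int (v j)"
    using orbifold_matrix_kernel[OF B pos g] by blast
  have "(\<Sum>j=1..n+1. c j * x j) = t * (\<Sum>j=1..n+1. c j * int (v j))"
    unfolding sum_distrib_left using t by (intro sum.cong) auto
  then have "[t * (\<Sum>j=1..n+1. c j * int (v j)) = 0] (mod int m)" using cx by (simp only: cong_def mod_0)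
  then have "[t * 1 = 0] (mod int m)" using cong_scalar_left[OF c, of t] cong_trans cong_sym by blast
  then obtain s where "t = int m * s" by (auto simp: cong_0_iff)
  then have "x = (\<lambda>j\<in>{1..n+1}. int (w j)) [^]\<^bsub>Zn (n+1)\<^esub> s"
    using x t w by (subst int_pow_Zn) (auto simp: fun_eq_iff PiE_iff extensional_def)
  then show "x \<in> range (\<lambda>t::int. (\<lambda>j\<in>{1..n+1}. int (w j)) [^]\<^bsub>Zn (n+1)\<^esub> t)" by blast
next
  fix x assume "x \<in> range (\<lambda>t::int. (\<lambda>j\<in>{1..n+1}. int (w j)) [^]\<^bsub>Zn (n+1)\<^esub> t)"
  then obtain t :: int where "x = (\<lambda>j\<in>{1..n+1}. int (w j)) [^]\<^bsub>Zn (n+1)\<^esub> t" by blast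
  then have x: "x = (\<lambda>j\<in>{1..n+1}. t * int m * int (v j))"
    using w by (subst (asm) int_pow_Zn) (auto simp: fun_eq_iff)
  have sum_x: "(\<Sum>j=1..n+1. b j * x j) = t * int m * (\<Sum>j=1..n+1. b j * int (v j))" for b
    unfolding sum_distrib_left by (intro sum.cong) (auto simp: x)
  have "stacky_beta n m B c x = \<one>\<^bsub>target_group n m\<^esub>"
    using orbifold_matrix_weights[OF B pos] unfolding stacky_beta_def sum_x
    by (auto simp: fun_eq_iff simp del: sum.cl_ivl_Suc)
  then show "x \<in> kernel (Zn (n+1)) (target_group n m) (stacky_beta n m B c)"
    by (auto simp: kernel_def x)
qed

text \<open>Induction on a bound for the positions of the nonzero coordinates, clearing the last one
  by a multiple of a unit vector. With surjectivity of \<beta> this yields finite generation of the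
  target group.\<close>

lemma generate_Zn: "generate (Zn k) (unit_vec k ` {1..k}) = carrier (Zn k)"
proof -
  interpret G: comm_group "Zn k" by simp
  let ?U = "unit_vec k ` {1..k}"
  have U: "?U \<subseteq> carrier (Zn k)" by (auto simp: unit_vec_def)
  note sub = G.generate_is_subgroup[OF U]
  have "x \<in> generate (Zn k) ?U" if "x \<in> carrier (Zn k)" "\<forall>i\<in>{1..k}. i > m \<longrightarrow> x i = 0" for m x
    using that
  proof (induction m arbitrary: x)
    case 0
    then have "x = \<one>\<^bsub>Zn k\<^esub>" by (auto simp: fun_eq_iff PiE_iff extensional_def)
    then show ?case using subgroup.one_closed[OF sub] by (simp only:)
  next
    case (Suc m)
    show ?case
    proof (cases "Suc m \<le> k")
      case True
      let ?y = "\<lambda>i\<in>{1..k}. if i = Suc m then 0 else x i"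
      have e: "unit_vec k (Suc m) \<in> carrier (Zn k)" "unit_vec k (Suc m) \<in> ?U" using True by (auto simp: unit_vec_def)
      have "?y \<in> generate (Zn k) ?U" using Suc.prems by (intro Suc.IH) auto
      moreover have "unit_vec k (Suc m) [^]\<^bsub>Zn k\<^esub> x (Suc m) \<in> generate (Zn k) ?U"
        by (intro G.subgroup_int_pow_closed[OF sub] generate.incl e(2))
      ultimately have "?y \<otimes>\<^bsub>Zn k\<^esub> unit_vec k (Suc m) [^]\<^bsub>Zn k\<^esub> x (Suc m) \<in> generate (Zn k) ?U"
        by (rule subgroup.m_closed[OF sub])
      also have "?y \<otimes>\<^bsub>Zn k\<^esub> unit_vec k (Suc m) [^]\<^bsub>Zn k\<^esub> x (Suc m) = x"
        unfolding int_pow_Zn[OF e(1)] using Suc.prems(1) True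
        by (auto simp: fun_eq_iff unit_vec_def PiE_iff extensional_def)
      finally show ?thesis .
    next
      case False
      then show ?thesis using Suc.prems by (intro Suc.IH) auto
    qed
  qed
  from this[of _ k] show ?thesis using G.generate_incl[OF U] by auto
qed

lemma rationalization_target_group:
  assumes m: "m > 0"
  shows "rationalization (target_group n m) n (target_map n)"
  unfolding rationalization_def
proof (intro conjI ballI)
  show "target_map n \<in> carrier (target_group n m) \<rightarrow> Qspace n"
    by (auto simp: target_map_def Qspace_def)
next
  fix z z' i assume "i \<in> {1..n}"
  then show "target_map n (z \<otimes>\<^bsub>target_group n m\<^esub> z') i = target_map n z i + target_map n z' i"
    by (cases z; cases z') (simp add: target_map_def)
next
  fix z assume "z \<in> carrier (target_group n m)"
  then obtain x t where z: "z = (x, t)" "x \<in> carrier (Zn n)" "t \<in> carrier (integer_mod_group m)"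
    by (auto simp: target_group_def DirProd_def)
  have "z [^]\<^bsub>target_group n m\<^esub> l = (\<lambda>i\<in>{1..n}. int l * x i, (int l * t) mod int m)" for l :: nat
    using int_pow_DirProd[OF group_Zn group_integer_mod_group z(2,3), of "int l"] int_pow_Zn[OF z(2), of "int l"]
    unfolding z(1) target_group_def by (simp add: int_pow_int)
  then have *: "z [^]\<^bsub>target_group n m\<^esub> l = \<one>\<^bsub>target_group n m\<^esub> \<longleftrightarrow>
      (\<lambda>i\<in>{1..n}. int l * x i) = (\<lambda>i\<in>{1..n}. 0) \<and> (int l * t) mod int m = 0" for l :: nat
    by simp
  show "(\<forall>i\<in>{1..n}. target_map n z i = 0) \<longleftrightarrow> (\<exists>l::nat. l > 0 \<and> z [^]\<^bsub>target_group n m\<^esub> l = \<one>\<^bsub>target_group n m\<^esub>)"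
  proof
    assume "\<forall>i\<in>{1..n}. target_map n z i = 0"
    then have "\<forall>i\<in>{1..n}. x i = 0" by (simp add: z(1) target_map_def)
    \<comment> \<open>With the free part zero, the order \<open>m\<close> of the torsion summand
      annihilates \<open>z\<close>.\<close>
    then show "\<exists>l::nat. l > 0 \<and> z [^]\<^bsub>target_group n m\<^esub> l = \<one>\<^bsub>target_group n m\<^esub>"
      using m by (intro exI[of _ m] conjI m, subst *) (auto simp: fun_eq_iff)
  next
    assume "\<exists>l::nat. l > 0 \<and> z [^]\<^bsub>target_group n m\<^esub> l = \<one>\<^bsub>target_group n m\<^esub>"
    then obtain l :: nat where l: "l > 0" "(\<lambda>i\<in>{1..n}. int l * x i) = (\<lambda>i\<in>{1..n}. 0)" using * by blast
    have "x i = 0" if "i \<in> {1..n}" for i using fun_cong[OF l(2), of i] l(1) that by simp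
    then show "\<forall>i\<in>{1..n}. target_map n z i = 0" by (simp add: z(1) target_map_def)
  qed
next
  fix q assume "q \<in> Qspace n"
  define d where "d i = snd (quotient_of (q i))" for i
  \<comment> \<open>A common denominator: multiplying by it takes \<open>q\<close> into the
    lattice.\<close>
  define D where "D = (\<Prod>i=1..n. d i)"
  have d: "d i > 0" for i by (simp add: d_def quotient_of_denom_pos')
  then have D: "D > 0" unfolding D_def by (intro prod_pos) auto
  define x where "x = (\<lambda>i\<in>{1..n}. fst (quotient_of (q i)) * (D div d i))"
  have "of_int (x i) = of_int D * q i" if i: "i \<in> {1..n}" for i
  proof -
    have "d i dvd D" unfolding D_def using i by (intro dvd_prodI) auto
    then have "(of_int D :: rat) = of_int (d i) * of_int (D div d i)" by (simp flip: of_int_mult)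
    moreover have "q i = of_int (fst (quotient_of (q i))) / of_int (d i)"
      unfolding d_def by (rule quotient_of_div) simp
    moreover have "(of_int (d i) :: rat) \<noteq> 0" using d[of i] by simp
    ultimately have "of_int (fst (quotient_of (q i))) * of_int (D div d i) = of_int D * q i"
      by (metis (no_types, lifting) mult.commute mult.left_commute nonzero_mult_div_cancel_left times_divide_eq_right)
    then show ?thesis using i by (simp add: x_def)
  qed
  then have "\<forall>i\<in>{1..n}. target_map n (x, 0) i = of_nat (nat D) * q i"
    using D by (simp add: target_map_def of_nat_nat)
  moreover have "(x, 0) \<in> carrier (target_group n m)" using m by (auto simp: x_def)
  ultimately show "\<exists>l::nat. l > 0 \<and> (\<exists>z\<in>carrier (target_group n m). \<forall>i\<in>{1..n}. target_map n z i = of_nat l * q i)"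
    using D by (intro exI[of _ "nat D"]) auto
qed

text \<open>The finite cokernel of \<beta> reduces to this case, because \<beta> is onto.\<close>

lemma finite_Mod_carrier:
  assumes "group G"
  shows "finite (carrier (G Mod carrier G))"
proof -
  interpret group G by fact
  have "carrier (G Mod carrier G) \<subseteq> {carrier G}"
    using coset_join2[OF _ subgroup_self] by (auto simp: FactGroup_def RCOSETS_def)
  then show ?thesis by (rule finite_subset) simp
qed

lemma stacky_fan_orbifold_matrix:
  assumes n: "n \<ge> 1" and m: "m > 0" and B: "orbifold_matrix n v B" and pos: "\<forall>i\<in>{1..n+1}. v i > 0"
    and g: "Gcd (v ` {1..n+1}) = 1" and c: "[(\<Sum>j=1..n+1. c j * int (v j)) = 1] (mod int m)"
  shows "stacky_fan (target_group n m) n (target_map n) (column_fan n B) (n+1) (column_ray n B) (stacky_beta n m B c)"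
proof -
  interpret F: complete_simplex n "\<lambda>j. of_nat (v j)" "matrix_column n B"
    by (rule complete_simplex_orbifold_matrix[OF B pos g n])
  interpret N: comm_group "target_group n m" by (rule comm_group_target_group)
  let ?\<beta> = "stacky_beta n m B c"
  note hom = stacky_beta_hom[OF m, of n B c] and surj = stacky_beta_surj[OF m B pos c]
  have fan: "column_fan n B = F.fan" by (simp add: column_fan_def F.fan_def)
  have ray: "column_ray n B = (\<lambda>j. F.cone {j})" by (simp add: column_ray_def F.cone_def fun_eq_iff)
  interpret \<beta>: group_hom "Zn (n+1)" "target_group n m" ?\<beta>
    using hom by (intro group_hom.intro group_hom_axioms.intro group_Zn N.group_axioms)
  have U: "unit_vec (n+1) ` {1..n+1} \<subseteq> carrier (Zn (n+1))" by (auto simp: unit_vec_def)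
  have "generate (target_group n m) (?\<beta> ` unit_vec (n+1) ` {1..n+1}) = carrier (target_group n m)"
    using \<beta>.generate_img[OF U] by (simp only: generate_Zn surj)
  moreover have "?\<beta> ` unit_vec (n+1) ` {1..n+1} \<subseteq> carrier (target_group n m)"
    using U surj by blast
  ultimately have fg: "\<exists>S. finite S \<and> S \<subseteq> carrier (target_group n m) \<and> generate (target_group n m) S = carrier (target_group n m)"
    by (intro exI[of _ "?\<beta> ` unit_vec (n+1) ` {1..n+1}"]) simp
  have "target_map n (?\<beta> (unit_vec (n+1) j)) = matrix_column n B j" if j: "j \<in> {1..n+1}" for j
  proof -
    have "(\<Sum>l=1..n+1. B i l * unit_vec (n+1) j l) = (\<Sum>l=1..n+1. if l = j then B i l else 0)" for i
      by (intro sum.cong) (auto simp: unit_vec_def)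
    also have "(\<Sum>l=1..n+1. if l = j then B i l else 0) = B i j" for i
      using j by (simp del: sum.cl_ivl_Suc)
    finally show ?thesis
      by (simp add: target_map_def stacky_beta_def matrix_column_def fun_eq_iff del: sum.cl_ivl_Suc)
  qed
  then have rays: "\<forall>i\<in>{1..n+1}. column_ray n B i = cone_hull n {target_map n (?\<beta> (unit_vec (n+1) i))}"
    by (simp add: column_ray_def)
  have cok: "finite (carrier (target_group n m Mod (?\<beta> ` carrier (Zn (n+1)))))"
    unfolding surj by (rule finite_Mod_carrier[OF N.group_axioms])
  show ?thesis unfolding stacky_fan_def
    using N.comm_group_axioms fg rationalization_target_group[OF m] hom cok rays
      F.simplicial_fan[folded fan] F.bij_betw_rays[folded fan ray] by (intro conjI)
qed


section \<open>The equivalence with the weighted projective stack\<close>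

theorem proposition2p7:
  fixes n lam :: nat and w :: "nat \<Rightarrow> nat" and c :: "nat \<Rightarrow> int" and B' :: "nat \<Rightarrow> nat \<Rightarrow> int"
  assumes "n \<ge> 1"
    and "\<And>i. i \<in> {1..n+1} \<Longrightarrow> w i > 0"
    and "lam = Gcd (w ` {1..n+1})"
    and "lam \<noteq> 1"
    and "[(\<Sum>i=1..n+1. c i * int (w i div lam)) = 1] (mod int lam)"
    and "orbifold_matrix n (\<lambda>i. w i div lam) B'"
  shows "stacky_fan (target_group n lam) n (target_map n) (column_fan n B')
           (n+1) (column_ray n B') (stacky_beta n lam B' c)
       \<and> (\<forall>s Q p Bt.
            free_resolution (target_group n lam) n s Q p \<longrightarrow>
            is_lift (n+1) (n+s) p (stacky_beta n lam B' c) Bt \<longrightarrow>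
            equivalent_over
              (toric_stack n (column_fan n B') (n+1) (column_ray n B') s Q Bt
                 :: (('u, dg_elt \<Rightarrow> 'u, nat \<Rightarrow> 'u) qobj, 'u qarr, 'u) cat_over)
              (weighted_projective_stack (n+1) w))"
proof -
  define v where "v i = w i div lam" for i
  have B: "orbifold_matrix n v B'" using assms(6) unfolding v_def .
  have c: "[(\<Sum>i=1..n+1. c i * int (v i)) = 1] (mod int lam)" using assms(5) unfolding v_def .
  have dvd: "lam dvd w i" if "i \<in> {1..n+1}" for i unfolding assms(3) using that by (intro Gcd_dvd imageI)
  have one: "1 \<in> {1..n+1}" by simp
  have lam: "lam > 0" using dvd_pos_nat[OF assms(2)[OF one] dvd[OF one]] .
  have w: "\<forall>i\<in>{1..n+1}. w i = lam * v i" using dvd by (simp add: v_def)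
  have pos: "\<forall>i\<in>{1..n+1}. v i > 0"
  proof
    fix i assume "i \<in> {1..n+1}"
    then show "v i > 0" using w assms(2)[of i] by (metis gr0I mult_0_right)
  qed
  \<comment> \<open>Dividing by their gcd makes the weights coprime, as the description of the
    kernel of \<open>B'\<close> requires.\<close>
  have "Gcd (w ` {1..n+1}) = Gcd ((*) lam ` v ` {1..n+1})"
    unfolding image_image using w by (intro arg_cong[of _ _ Gcd] image_cong) auto
  then have "lam = lam * Gcd (v ` {1..n+1})" unfolding Gcd_mult assms(3)[symmetric] by simp
  then have g: "Gcd (v ` {1..n+1}) = 1" using lam by simp
  interpret F: complete_simplex n "\<lambda>j. of_nat (v j)" "matrix_column n B'"
    by (rule complete_simplex_orbifold_matrix[OF B pos g assms(1)])
  have fan: "column_fan n B' = F.fan" by (simp add: column_fan_def F.fan_def)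
  have ray: "column_ray n B' = (\<lambda>j. F.cone {j})" by (simp add: column_ray_def F.cone_def fun_eq_iff)
  let ?N = "target_group n lam" and ?\<beta> = "stacky_beta n lam B' c"
  have "equivalent_over
      (toric_stack n (column_fan n B') (n+1) (column_ray n B') s Q Bt
         :: (('u, dg_elt \<Rightarrow> 'u, nat \<Rightarrow> 'u) qobj, 'u qarr, 'u) cat_over)
      (weighted_projective_stack (n+1) w)"
    if res: "free_resolution ?N n s Q p" and lift: "is_lift (n+1) (n+s) p ?\<beta> Bt" for s Q p Bt
  proof -
    let ?DG = "DG (n+1) s (n+s) Bt Q" and ?\<chi> = "DG_class (n+1) s (n+s) Bt Q"
    let ?w = "\<lambda>j\<in>{1..n+1}. int (w j)"
    have w1: "?w \<in> carrier (Zn (n+1))" "?w 1 \<noteq> 0" using assms(2)[OF one] by auto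
    obtain \<psi> where \<psi>: "group ?DG" "\<psi> \<in> iso ?DG integer_group"
      and \<chi>: "\<forall>i\<in>{1..n+1}. ?\<chi> i \<in> carrier ?DG \<and> \<psi> (?\<chi> i) = ?w i"
      by (rule DG_iso_integers[OF comm_group.axioms(2)[OF comm_group_target_group] stacky_beta_hom[OF lam]
            stacky_beta_surj[OF lam B pos c] w1(1) one w1(2) stacky_beta_kernel[OF lam B pos g c w] res lift])
    obtain \<gamma> :: "'u calg \<Rightarrow> (dg_elt \<Rightarrow> 'u) \<Rightarrow> 'u" and \<delta>
      where iso: "group_functor_iso (diag_group ?DG) mult_group \<gamma> \<delta>"
        and eval: "\<And>A g x. is_calg A \<Longrightarrow> g \<in> carrier (pt_group (diag_group ?DG) A) \<Longrightarrow> x \<in> carrier ?DG \<Longrightarrow>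
          \<gamma> A g \<in> Units A \<and> g x = \<gamma> A g [^]\<^bsub>units_of A\<^esub> \<psi> x"
      using diag_group_iso_mult_group[OF \<psi>] by metis
    have weights: "g (?\<chi> i) = \<gamma> A g [^]\<^bsub>A\<^esub> w i"
      if A: "is_calg A" and g: "g \<in> carrier (pt_group (diag_group ?DG) A)" and i: "i \<in> {1..n+1}" for A g i
    proof -
      have A': "monoid A" using A by (intro ring.is_monoid cring.axioms(1)) (simp add: is_calg_def)
      have \<chi>_i: "?\<chi> i \<in> carrier ?DG" "\<psi> (?\<chi> i) = int (w i)" using bspec[OF \<chi> i] i by simp_all
      have "g (?\<chi> i) = \<gamma> A g [^]\<^bsub>units_of A\<^esub> int (w i)" and unit: "\<gamma> A g \<in> Units A"
        using eval[OF A g \<chi>_i(1)] unfolding \<chi>_i(2) by simp_all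
      \<comment> \<open>A weight is a nonnegative exponent, so the power among the units agrees with
        the power in \<open>A\<close>.\<close>
      then show ?thesis using monoid.units_of_pow[OF A' unit] by (simp add: int_pow_int)
    qed
    have "compatible_actions (diag_group ?DG) \<gamma> (Z_space (n+1) (column_ray n B') (column_fan n B') ?\<chi>)
        (punctured_space (n+1) w)"
    proof (rule compatible_actions_Z_space[OF _ _ weights])
      show "\<exists>j\<in>{1..n+1}. \<not> column_ray n B' j \<subseteq> \<sigma>" if "\<sigma> \<in> column_fan n B'" for \<sigma>
        unfolding ray by (rule F.fan_misses_ray[OF that[unfolded fan]]) (rule bexI)
      show "\<exists>\<sigma>\<in>column_fan n B'. {i \<in> {1..n+1}. \<not> column_ray n B' i \<subseteq> \<sigma>} = {j}" if "j \<in> {1..n+1}" for j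
        unfolding ray fan by (rule F.fan_misses_only_ray[OF that]) (rule bexI)
    qed
    then show ?thesis unfolding toric_stack_def weighted_projective_stack_def
      by (rule equivalent_over_quotient_stack[OF iso])
  qed
  then show ?thesis
    by (intro conjI allI impI stacky_fan_orbifold_matrix[OF assms(1) lam B pos g c])
qed

end
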